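(* Let $q$ be a power of $2$. The Penttila–Williford $3$-class association schemes and the Hollmann–Xiang $3$-class (fusion) association scheme are isomorphic: for each of the two relative hemisystems $\mathcal H$ described below, there is a bijection $\varphi$ from the set $\mathcal E$ of elliptic lines to $\mathcal H$ such that for every $i\in\{0,1,2,3\}$, $(\bar\ell,\bar\ell')\in R_i$ if and only if $(\varphi(\bar\ell),\varphi(\bar\ell'))\in \widetilde R_i$.
   Context: Throughout $q=2^h$. An isomorphism of association schemes $(X,\{R_i\}_{i=0}^d)$ and $(X',\{R'_i\}_{i=0}^d)$ is a bijection $\varphi:X\to X'$ such that for each $i$ there is $j$ with $\{(\varphi(x),\varphi(y)):(x,y)\in R_i\}=R'_j$. Hollmann–Xiang scheme. Embed $\mathrm{PG}(2,q^2)$ in $\mathrm{PG}(2,q^4)$ by extension of scalars and let $\overline{\mathcal C}=\{\langle(1,t,t^2)\rangle: t\in\mathbb F_{q^4}\}\cup\{\langle(0,0,1)\rangle\}$ be the conic $y^2=xz$ of $\mathrm{PG}(2,q^4)$. An elliptic line is the extension to $\mathrm{PG}(2,q^4)$ of a line of $\mathrm{PG}(2,q^2)$ disjoint from $\mathcal C=\overline{\mathcal C}\cap \mathrm{PG}(2,q^2)$; each such line meets $\overline{\mathcal C}$ in $\{\langle(1,t,t^2)\rangle,\langle(1,t^{q^2},t^{2q^2})\rangle\}$ for some $t\in\mathbb F_{q^4}\setminus\mathbb F_{q^2}$, and we denote it $\bar\ell_{\mathbf t}$ with $\mathbf t=\{t,t^{q^2}\}$. Let $\mathcal E$ be the set of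 elliptic lines. For distinct $\bar\ell_{\mathbf s},\bar\ell_{\mathbf t}$ put $\rho(s,t)=\frac{(s+t)(s^{q^2}+t^{q^2})}{(s+t^{q^2})(s^{q^2}+t)}$ and $\widehat\rho(\mathbf s,\mathbf t)=1/(\rho(s,t)+\rho(s,t)^{-1})\in\mathbb F_{q^2}$. Let $\mathbf T_0$ be the set of elements of $\mathbb F_{q^2}$ of absolute trace $0$ (i.e. $\sum_{i=0}^{2h-1}x^{2^i}=0$), $\mathbf S_0$ the set of elements of $\mathbb F_q$ of absolute trace $0$ ($\sum_{i=0}^{h-1}x^{2^i}=0$), $\mathbf S_0^*=\mathbf S_0\setminus\{0\}$, $\mathbf S_1=\mathbb F_q\setminus\mathbf S_0$. Relations on $\mathcal E$: $R_0$ is the identity; $(\bar\ell_{\mathbf s},\bar\ell_{\mathbf t})\in R_1$ iff $\widehat\rho(\mathbf s,\mathbf t)\in\mathbf S_0^*$; $\in R_2$ iff $\widehat\rho(\mathbf s,\mathbf t)\in\mathbf S_1$; $\in R_3$ iff $\widehat\rho(\mathbf s,\mathbf t)\in\mathbf T_0\setminus\mathbb F_q$. This is a $3$-class association scheme. Penttila–Williford schemes. On $V(4,q^2)$ let $h(\mathbf X,\mathbf Y)=X_1Y_4^q+X_2Y_2^q+X_3Y_3^q+X_4Y_1^q$, with unitary polar space $H(3,q^2)$ (its lines are the totally isotropic $2$-dimensional subspaces). Let $\widehat V=\{(\alpha,x^q,x,\beta):\alpha,\beta\in\mathbb F_q,x\in\mathbb F_{q^2}\}$, a $4$-dimensional $\mathbb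 F_q$-space; $h$ restricts on it to the non-degenerate alternating form $\widehat b(v,v')=\alpha\beta'+\beta\alpha'+xx'^q+x^qx'$, defining a symplectic polar space $W(3,q)$, and $\widehat b$ is the polar form of the quadratic form $\widehat Q(v)=\alpha\beta+x^{q+1}$ (of Witt index $1$). Let $\widehat{\mathcal W}$ be the set of $\mathbb F_{q^2}$-spans of totally isotropic subspaces of $(\widehat V,\widehat b)$; its points are the points $\langle v\rangle$, $v\in\widehat V\setminus\{0\}$. Let $\mathrm{PO}^-(\widehat V)$ be the stabilizer in $\mathrm{PGU}(4,q^2)$ (the group preserving $h$) of the set of $\mathbb F_{q^2}$-extensions of the singular subspaces of $\widehat Q$, and $\mathrm{P}\Omega^-(\widehat V)$ its commutator subgroup. This group has exactly two orbits on the lines of $H(3,q^2)$ containing no point of $\widehat{\mathcal W}$; let $\mathcal H$ be either orbit. For a line $l$ of $H(3,q^2)$ disjoint from $\widehat{\mathcal W}$ let $\mathcal S_l$ be the set of lines of $\widehat{\mathcal W}$ meeting $l$. Relations on $\mathcal H$: $\widetilde R_0$ the identity; $(l,m)\in\widetilde R_1$ iff $|l\cap m|=1$ (as point sets); $(l,m)\in\widetilde R_2$ iff $l\cap m=\emptyset$ and $|\mathcal S_l\cap\mathcal S_m|=1$; $(l,m)\in\widetilde R_3$ iff $l\cap m=\emptyset$ and $|\mathcal S_l\cap\mathcal S_m|=q+1$. This is a $3$-class association scheme. *)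

theory Defs
  imports "HOL-Analysis.Analysis" "HOL-Algebra.Generated_Groups" "HOL-Algebra.Group_Action"
begin

section \<open>Finite fields and projective spaces\<close>

text \<open>
  For a field of order \<open>q ^ k\<close> the set below is its subfield of order \<open>q\<close>.
\<close>

definition GF :: "nat \<Rightarrow> 'a::field set" where
  "GF q = {x. x ^ q = x}"

definition field_embedding :: "('a::field \<Rightarrow> 'b::field) \<Rightarrow> bool" where
  "field_embedding \<epsilon> \<longleftrightarrow> \<epsilon> 1 = 1 \<and> (\<forall>x y. \<epsilon> (x + y) = \<epsilon> x + \<epsilon> y) \<and> (\<forall>x y. \<epsilon> (x * y) = \<epsilon> x * \<epsilon> y)"

text \<open>On the subfield of order \<open>2 ^ m\<close> this is the absolute trace.\<close>

definition abs_trace :: "nat \<Rightarrow> 'a::field \<Rightarrow> 'a" where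
  "abs_trace m x = (\<Sum>i<m. x ^ (2 ^ i))"

text \<open>
  Projective subspaces are represented by the underlying vector subspaces; incidence is inclusion.
\<close>

definition proj_points :: "('a::field ^ 'n) set \<Rightarrow> ('a ^ 'n) set set" where
  "proj_points W = {P. vec.subspace P \<and> vec.dim P = 1 \<and> P \<subseteq> W}"

definition proj_lines :: "('a::field ^ 'n) set set" where
  "proj_lines = {l. vec.subspace l \<and> vec.dim l = 2}"

definition extend_scalars :: "('a::field \<Rightarrow> 'b::field) \<Rightarrow> ('a ^ 'n) set \<Rightarrow> ('b ^ 'n) set" where
  "extend_scalars \<epsilon> W = vec.span ((\<lambda>v. \<chi> i. \<epsilon> (v $ i)) ` W)"


section \<open>Isomorphisms of association schemes\<close>

definition scheme_iso ::
  "nat \<Rightarrow> 'a set \<Rightarrow> (nat \<Rightarrow> ('a \<times> 'a) set) \<Rightarrow> 'b set \<Rightarrow> (nat \<Rightarrow> ('b \<times> 'b) set) \<Rightarrow> ('a \<Rightarrow> 'b) \<Rightarrow> bool"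
where
  "scheme_iso d X R X' R' \<phi> \<longleftrightarrow>
     bij_betw \<phi> X X' \<and> (\<forall>i\<le>d. \<exists>j\<le>d. {(\<phi> x, \<phi> y) | x y. (x, y) \<in> R i} = R' j)"


section \<open>The Hollmann--Xiang scheme\<close>

text \<open>
  Here \<open>'k\<close> is the field of order \<open>q\<^sup>2\<close>, \<open>'l\<close> the field of order \<open>q ^ 4\<close>, and \<open>\<epsilon>\<close> embeds
  the former into the latter.
\<close>

definition conic_point :: "'l::field \<Rightarrow> ('l ^ 3) set" where
  "conic_point t = vec.span {vector [1, t, t\<^sup>2]}"

definition conic :: "('l::field ^ 3) set set" where
  "conic = range conic_point \<union> {vec.span {vector [0, 0, 1]}}"

definition small_conic :: "('k::field \<Rightarrow> 'l::field) \<Rightarrow> ('k ^ 3) set set" where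
  "small_conic \<epsilon> = {P \<in> proj_points UNIV. extend_scalars \<epsilon> P \<in> conic}"

definition elliptic_lines :: "('k::field \<Rightarrow> 'l::field) \<Rightarrow> ('l ^ 3) set set" where
  "elliptic_lines \<epsilon> =
     {extend_scalars \<epsilon> l | l. l \<in> proj_lines \<and> proj_points l \<inter> small_conic \<epsilon> = {}}"

text \<open>
  The line meets the conic precisely in the points with parameters \<open>t\<close> and its conjugate; \<open>t\<close> is
  determined by the line only up to conjugation.
\<close>

definition elliptic_param :: "nat \<Rightarrow> ('l::field ^ 3) set \<Rightarrow> 'l \<Rightarrow> bool" where
  "elliptic_param q l t \<longleftrightarrow>
     t \<notin> GF (q\<^sup>2) \<and> proj_points l \<inter> conic = {conic_point t, conic_point (t ^ (q\<^sup>2))}"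

definition rho :: "nat \<Rightarrow> 'l::field \<Rightarrow> 'l \<Rightarrow> 'l" where
  "rho q s t = ((s + t) * (s ^ (q\<^sup>2) + t ^ (q\<^sup>2))) / ((s + t ^ (q\<^sup>2)) * (s ^ (q\<^sup>2) + t))"

definition rho_hat :: "nat \<Rightarrow> 'l::field \<Rightarrow> 'l \<Rightarrow> 'l" where
  "rho_hat q s t = 1 / (rho q s t + inverse (rho q s t))"

definition T0 :: "nat \<Rightarrow> 'l::field set" where
  "T0 h = {x \<in> GF ((2 ^ h)\<^sup>2). abs_trace (2 * h) x = 0}"

definition S0 :: "nat \<Rightarrow> 'l::field set" where
  "S0 h = {x \<in> GF (2 ^ h). abs_trace h x = 0}"

definition S1 :: "nat \<Rightarrow> 'l::field set" where
  "S1 h = GF (2 ^ h) - S0 h"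

text \<open>
  Replacing \<open>s\<close> or \<open>t\<close> by its conjugate inverts \<^term>\<open>rho q s t\<close> and so does not change
  \<^term>\<open>rho_hat q s t\<close>; hence the choice of parameters below is immaterial.
\<close>

definition hx_related ::
  "nat \<Rightarrow> ('k::field \<Rightarrow> 'l::field) \<Rightarrow> 'l set \<Rightarrow> (('l ^ 3) set \<times> ('l ^ 3) set) set" where
  "hx_related q \<epsilon> D =
     {(l, m). l \<in> elliptic_lines \<epsilon> \<and> m \<in> elliptic_lines \<epsilon> \<and> l \<noteq> m \<and>
        (\<exists>s t. elliptic_param q l s \<and> elliptic_param q m t \<and> rho_hat q s t \<in> D)}"

definition hx_rel ::
  "nat \<Rightarrow> ('k::field \<Rightarrow> 'l::field) \<Rightarrow> nat \<Rightarrow> (('l ^ 3) set \<times> ('l ^ 3) set) set" where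
  "hx_rel h \<epsilon> i =
     [Id_on (elliptic_lines \<epsilon>),
      hx_related (2 ^ h) \<epsilon> (S0 h - {0}),
      hx_related (2 ^ h) \<epsilon> (S1 h),
      hx_related (2 ^ h) \<epsilon> (T0 h - GF (2 ^ h))] ! i"


section \<open>The Penttila--Williford schemes\<close>

definition herm :: "nat \<Rightarrow> 'k::field ^ 4 \<Rightarrow> 'k ^ 4 \<Rightarrow> 'k" where
  "herm q X Y = X$1 * (Y$4) ^ q + X$2 * (Y$2) ^ q + X$3 * (Y$3) ^ q + X$4 * (Y$1) ^ q"

definition herm_lines :: "nat \<Rightarrow> ('k::field ^ 4) set set" where
  "herm_lines q = {l \<in> proj_lines. \<forall>u\<in>l. \<forall>v\<in>l. herm q u v = 0}"

definition Vhat :: "nat \<Rightarrow> ('k::field ^ 4) set" where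
  "Vhat q = {vector [\<alpha>, x ^ q, x, \<beta>] | \<alpha> x \<beta>. \<alpha> \<in> GF q \<and> \<beta> \<in> GF q}"

definition bhat :: "nat \<Rightarrow> 'k::field ^ 4 \<Rightarrow> 'k ^ 4 \<Rightarrow> 'k" where
  "bhat q u v = u$1 * v$4 + u$4 * v$1 + u$3 * (v$3) ^ q + (u$3) ^ q * v$3"

definition Qhat :: "nat \<Rightarrow> 'k::field ^ 4 \<Rightarrow> 'k" where
  "Qhat q v = v$1 * v$4 + (v$3) ^ (q + 1)"

definition Vhat_subspace :: "nat \<Rightarrow> ('k::field ^ 4) set \<Rightarrow> bool" where
  "Vhat_subspace q U \<longleftrightarrow> U \<subseteq> Vhat q \<and> 0 \<in> U \<and>
     (\<forall>u\<in>U. \<forall>v\<in>U. u + v \<in> U) \<and> (\<forall>c\<in>GF q. \<forall>u\<in>U. c *s u \<in> U)"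

definition What :: "nat \<Rightarrow> ('k::field ^ 4) set set" where
  "What q = {vec.span U | U. Vhat_subspace q U \<and> (\<forall>u\<in>U. \<forall>v\<in>U. bhat q u v = 0)}"

definition What_points :: "nat \<Rightarrow> ('k::field ^ 4) set set" where
  "What_points q = {vec.span {v} | v. v \<in> Vhat q - {0}}"

text \<open>
  Vectors of \<^term>\<open>Vhat q\<close> independent over the subfield of order \<open>q\<close> stay independent over the
  field of order \<open>q\<^sup>2\<close>, so taking spans preserves dimension.
\<close>

definition What_lines :: "nat \<Rightarrow> ('k::field ^ 4) set set" where
  "What_lines q = What q \<inter> proj_lines"

definition GU :: "nat \<Rightarrow> ('k::field ^ 4 ^ 4) monoid" where
  "GU q = \<lparr>carrier = {A. invertible A \<and> (\<forall>X Y. herm q (A *v X) (A *v Y) = herm q X Y)},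
           mult = (**), one = mat 1\<rparr>"

definition GU_scalars :: "nat \<Rightarrow> ('k::field ^ 4 ^ 4) set" where
  "GU_scalars q = {A \<in> carrier (GU q). \<exists>c. A = mat c}"

definition PGU :: "nat \<Rightarrow> ('k::field ^ 4 ^ 4) set monoid" where
  "PGU q = GU q Mod GU_scalars q"

text \<open>
  All matrices in a class \<open>g\<close> of \<^term>\<open>PGU q\<close> differ by scalars and have the same effect on a
  subspace, so the union over \<open>g\<close> is the image under any one of them.
\<close>

definition proj_act :: "('k::field ^ 4 ^ 4) set \<Rightarrow> ('k ^ 4) set \<Rightarrow> ('k ^ 4) set" where
  "proj_act g W = (\<Union>A\<in>g. (*v) A ` W)"

definition singular_extensions :: "nat \<Rightarrow> ('k::field ^ 4) set set" where
  "singular_extensions q = {vec.span U | U. Vhat_subspace q U \<and> (\<forall>u\<in>U. Qhat q u = 0)}"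

definition PO_minus :: "nat \<Rightarrow> ('k::field ^ 4 ^ 4) set set" where
  "PO_minus q = stabilizer (PGU q) (\<lambda>g S. proj_act g ` S) (singular_extensions q)"

definition POmega_minus :: "nat \<Rightarrow> ('k::field ^ 4 ^ 4) set set" where
  "POmega_minus q = derived (PGU q) (PO_minus q)"

definition external_lines :: "nat \<Rightarrow> ('k::field ^ 4) set set" where
  "external_lines q = {l \<in> herm_lines q. proj_points l \<inter> What_points q = {}}"

definition relative_hemisystems :: "nat \<Rightarrow> ('k::field ^ 4) set set set" where
  "relative_hemisystems q =
     orbits (PGU q \<lparr>carrier := POmega_minus q\<rparr>) (external_lines q) proj_act"

definition meeting_lines :: "nat \<Rightarrow> ('k::field ^ 4) set \<Rightarrow> ('k ^ 4) set set" where
  "meeting_lines q l = {w \<in> What_lines q. proj_points w \<inter> proj_points l \<noteq> {}}"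

definition pw_rel ::
  "nat \<Rightarrow> ('k::field ^ 4) set set \<Rightarrow> nat \<Rightarrow> (('k ^ 4) set \<times> ('k ^ 4) set) set" where
  "pw_rel q H i =
     [Id_on H,
      {(l, m) \<in> H \<times> H. card (proj_points l \<inter> proj_points m) = 1},
      {(l, m) \<in> H \<times> H. proj_points l \<inter> proj_points m = {} \<and>
                        card (meeting_lines q l \<inter> meeting_lines q m) = 1},
      {(l, m) \<in> H \<times> H. proj_points l \<inter> proj_points m = {} \<and>
                        card (meeting_lines q l \<inter> meeting_lines q m) = q + 1}] ! i"


section \<open>Consistency of the definitions\<close>

lemma vector_4_nth:
  "(vector [a, b, c, d] :: 'a::zero ^ 4) $ 1 = a"
  "(vector [a, b, c, d] :: 'a ^ 4) $ 2 = b"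
  "(vector [a, b, c, d] :: 'a ^ 4) $ 3 = c"
  "(vector [a, b, c, d] :: 'a ^ 4) $ 4 = d"
  by (simp_all add: vector_def)

lemma herm_eq_bhat:
  fixes u v :: "'k::{field, finite} ^ 4"
  assumes frob: "\<And>x :: 'k. x ^ (q\<^sup>2) = x" and "u \<in> Vhat q" and "v \<in> Vhat q"
  shows "herm q u v = bhat q u v"
proof -
  have "(x ^ q) ^ q = x" for x :: 'k
    using frob[of x] by (simp add: power_mult[symmetric] power2_eq_square)
  then show ?thesis
    using assms(2,3) by (auto simp: Vhat_def herm_def bhat_def GF_def vector_4_nth algebra_simps)
qed

lemma group_GU: "group (GU q :: ('k::field ^ 4 ^ 4) monoid)"
proof (rule groupI)
  fix A :: "'k ^ 4 ^ 4"
  assume A: "A \<in> carrier (GU q)"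
  then obtain B where B: "A ** B = mat 1" "B ** A = mat 1"
    by (auto simp: GU_def invertible_def)
  have "herm q (B *v X) (B *v Y) = herm q X Y" for X Y
  proof -
    have "herm q (A *v (B *v X)) (A *v (B *v Y)) = herm q (B *v X) (B *v Y)"
      using A by (simp add: GU_def)
    then show ?thesis
      by (simp add: matrix_vector_mul_assoc B)
  qed
  with B have "B \<in> carrier (GU q)"
    by (auto simp: GU_def invertible_def)
  with B show "\<exists>B\<in>carrier (GU q). B \<otimes>\<^bsub>GU q\<^esub> A = \<one>\<^bsub>GU q\<^esub>"
    by (auto simp: GU_def)
next
  have "invertible (mat 1 :: 'k ^ 4 ^ 4)"
    unfolding invertible_def by (rule exI[of _ "mat 1"]) simp
  then show "\<one>\<^bsub>GU q\<^esub> \<in> carrier (GU q :: ('k ^ 4 ^ 4) monoid)"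
    by (simp add: GU_def)
qed (simp_all add: GU_def invertible_mult matrix_mul_assoc matrix_vector_mul_assoc[symmetric])

lemma group_PGU: "group (PGU q :: ('k::field ^ 4 ^ 4) set monoid)"
proof -
  interpret group "GU q :: ('k ^ 4 ^ 4) monoid"
    by (rule group_GU)
  have comm: "mat c ** A = A ** mat c" for c and A :: "'k ^ 4 ^ 4"
    by (simp add: matrix_matrix_mult_def mat_def vec_eq_iff mult_delta_left mult_delta_right mult.commute)
  have mult: "mult (GU q) = (**)" and one: "one (GU q) = mat 1"
    by (simp_all add: GU_def)
  have mat_mult: "mat c ** mat d = (mat (c * d) :: 'k ^ 4 ^ 4)" for c d
    by (simp add: matrix_matrix_mult_def mat_def vec_eq_iff mult_delta_left mult_delta_right)
  have sub: "subgroup (GU_scalars q) (GU q :: ('k ^ 4 ^ 4) monoid)"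
  proof (rule subgroupI)
    fix A :: "'k ^ 4 ^ 4"
    assume "A \<in> GU_scalars q"
    then obtain c where A: "A \<in> carrier (GU q)" "A = mat c"
      by (auto simp: GU_scalars_def)
    from A(1) obtain B where "A ** B = mat 1"
      by (auto simp: GU_def invertible_def)
    then have "(A ** B) $ 1 $ 1 = 1"
      by (simp add: mat_def)
    then have "c \<noteq> 0"
      by (auto simp: A(2) matrix_matrix_mult_def mat_def)
    then have "A ** mat (inverse c) = mat 1"
      by (simp add: A(2) mat_mult)
    moreover have inv: "inv\<^bsub>GU q\<^esub> A \<in> carrier (GU q)" "inv\<^bsub>GU q\<^esub> A ** A = mat 1"
      using A(1) l_inv[OF A(1)] by (simp_all add: mult one)
    moreover have "inv\<^bsub>GU q\<^esub> A ** (A ** mat (inverse c)) = mat (inverse c)"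
      by (simp add: matrix_mul_assoc inv)
    ultimately have "inv\<^bsub>GU q\<^esub> A = mat (inverse c)"
      by simp
    with inv(1) show "inv\<^bsub>GU q\<^esub> A \<in> GU_scalars q"
      by (auto simp: GU_scalars_def)
  next
    fix A B :: "'k ^ 4 ^ 4"
    assume "A \<in> GU_scalars q" "B \<in> GU_scalars q"
    then show "A \<otimes>\<^bsub>GU q\<^esub> B \<in> GU_scalars q"
      using m_closed by (auto simp: GU_scalars_def mult mat_mult)
  qed (use one_closed in \<open>auto simp: GU_scalars_def one\<close>)
  have "GU_scalars q \<lhd> (GU q :: ('k ^ 4 ^ 4) monoid)"
  proof (rule normalI[OF sub], intro ballI)
    fix A :: "'k ^ 4 ^ 4"
    show "GU_scalars q #>\<^bsub>GU q\<^esub> A = A <#\<^bsub>GU q\<^esub> GU_scalars q"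
      by (auto simp: r_coset_def l_coset_def GU_scalars_def mult comm)
  qed
  then show ?thesis
    unfolding PGU_def by (rule normal.factorgroup_is_group)
qed

end

(*
Identify the elliptic quadric of Q with the projective line over GF(q^2), so that POmega acts as
PSL(2, q^2) and a conjugate pair {t, t^(q^2)} over GF(q^4) determines an elliptic line.  In
V(4, q^2) = V(2, q^2) (x) V(2, q^2)^(q) the same pair determines two totally isotropic lines free of
points of the symplectic subgeometry: the kernel of X4 + t X2 + t^q X3 + t^(q+1) X1 and its image
under interchanging X2 and X3.  These exhaust the external lines, the affine group x -> a x + b, which
consists of commutators, is transitive on each of the two kinds, and an element of PO fixing three
points of the quadric is trivial or the interchange; hence the two kinds are the two orbits.

The relations on both sides are read off from tau = x + x^q, where x = 1 / (rho(s, t) + 1) lies in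
GF(q^2).  Since rho_hat = x^2 + x, the classes R1, R2, R3 are tau = 0, tau = 1 and tau not in {0, 1}.
On the other side tau is, up to a factor, the determinant that decides whether the two lines meet.
The lines of the symplectic subgeometry meeting a given line l correspond to the points of l, and those
that meet a second line are the zeros of a Hermitian form on l with discriminant proportional to
tau^2 + tau: one zero if tau = 1, and q + 1 if tau is not in {0, 1}.
*)
theory Submission
  imports Defs
begin

section \<open>Finite fields of characteristic two\<close>

text \<open>Below, the small field has order q^2, embedded by \<open>\<epsilon>\<close>, and the
  large field has order q^4. The two kinds of lines come from the two square roots of the
  conjugation \<open>bar\<close> in the Galois group over GF(q): x^q and x^(q^3). They agree on the
  small field, so tau does not see the choice; the locale \<open>conjugation\<close> fixes an
  arbitrary such root \<open>\<phi>\<close>, the incidence computations are made there once, and it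
  is interpreted twice at the end. The obstacle on the group side is that the group is given only as
  the derived subgroup of a stabilizer of projective classes. It is never identified with a linear
  group: each element of the stabilizer gets a sign, according to whether it preserves or
  interchanges the two families. The sign is multiplicative, hence trivial on commutators; in the
  other direction enough elements are exhibited as explicit commutators. Descent always has the same
  form: what \<open>bar\<close> fixes comes from the small field. In characteristic two quadratic
  equations are solved by Artin-Schreier theory instead of discriminants, and determinants become
  sums.\<close>

lemma power_card_eq:
  fixes x :: "'a::{field, finite}"
  shows "x ^ CARD('a) = x"
proof (cases "x = 0")
  case True
  have "CARD('a) \<noteq> 0"
    by simp
  with True show ?thesis
    by simp
next
  case False
  let ?U = "UNIV - {0::'a}"
  have bij: "bij_betw ((*) x) ?U ?U"
    by (rule bij_betw_byWitness[where f' = "\<lambda>y. y / x"]) (use False in auto)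
  have "x ^ card ?U * (\<Prod>y\<in>?U. y) = (\<Prod>y\<in>?U. x * y)"
    by (simp add: prod.distrib)
  also have "\<dots> = (\<Prod>y\<in>?U. y)"
    using prod.reindex_bij_betw[OF bij, of "\<lambda>y. y"] by simp
  finally have "x ^ card ?U = 1"
    by (simp add: prod_zero_iff)
  moreover have "CARD('a) = Suc (card ?U)"
    by (rule card_Suc_Diff1[symmetric]) auto
  ultimately show ?thesis
    by (simp only: power_Suc mult_1_right)
qed

text \<open>Adding 1 permutes the field, so the sum of all elements absorbs \<open>CARD('a)\<close>
  copies of 1; hence a power of 2 is zero, and then 2 itself.\<close>

lemma add_self_eq_0:
  fixes x :: "'a::{field, finite}"
  assumes "CARD('a) = 2 ^ n"
  shows "x + x = 0"
proof -
  have bij: "bij_betw (\<lambda>y. y + 1) (UNIV :: 'a set) UNIV"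
    by (rule bij_betw_byWitness[where f' = "\<lambda>y. y - 1"]) auto
  have "(\<Sum>y\<in>(UNIV::'a set). y + 1) = (\<Sum>y\<in>(UNIV::'a set). y)"
    using sum.reindex_bij_betw[OF bij, of "\<lambda>y. y"] by simp
  then have "(of_nat CARD('a) :: 'a) = 0"
    by (simp add: sum.distrib)
  then have "(2 :: 'a) ^ n = 0"
    by (simp add: assms)
  then have "(2 :: 'a) = 0"
    by simp
  then show ?thesis
    by (simp only: mult_2[symmetric] mult_zero_left)
qed

lemma frobenius_add:
  fixes x y :: "'a::comm_semiring_1"
  assumes "\<And>z :: 'a. z + z = 0"
  shows "(x + y) ^ (2 ^ n) = x ^ (2 ^ n) + y ^ (2 ^ n)"
proof (induction n)
  case (Suc n)
  have "(x + y) ^ (2 ^ Suc n) = ((x + y) ^ (2 ^ n))\<^sup>2"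
    by (simp only: power_Suc2 power_mult)
  also have "\<dots> = (x ^ (2 ^ n))\<^sup>2 + (y ^ (2 ^ n))\<^sup>2 + (x ^ (2 ^ n) * y ^ (2 ^ n) + x ^ (2 ^ n) * y ^ (2 ^ n))"
    by (simp add: Suc power2_eq_square algebra_simps)
  also have "\<dots> = x ^ (2 ^ Suc n) + y ^ (2 ^ Suc n)"
    by (simp only: assms power_Suc2 power_mult add_0_right)
  finally show ?case .
qed simp

lemma card_roots_of_power_le:
  fixes c :: "'a::field"
  assumes "n > 0"
  shows "finite {x. x ^ n = c}" and "card {x. x ^ n = c} \<le> n"
proof -
  let ?p = "Polynomial.monom 1 n + [:- c:]"
  have deg: "degree ?p = n"
    using assms by (subst degree_add_eq_left) (auto simp: degree_monom_eq)
  with assms have "?p \<noteq> 0"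
    by auto
  moreover have "{x. poly ?p x = 0} = {x. x ^ n = c}"
    by (auto simp: poly_monom)
  ultimately show "finite {x. x ^ n = c}" and "card {x. x ^ n = c} \<le> n"
    using poly_roots_finite[of ?p] card_poly_roots_bound[of ?p] deg by auto
qed

lemma card_GF_le:
  assumes "n > 1"
  shows "finite (GF n :: 'a::field set)" and "card (GF n :: 'a set) \<le> n"
proof -
  let ?p = "Polynomial.monom 1 n + [:0, - 1 :: 'a:]"
  have deg: "degree ?p = n"
    using assms by (subst degree_add_eq_left) (auto simp: degree_monom_eq)
  with assms have "?p \<noteq> 0"
    by auto
  moreover have "{x. poly ?p x = 0} = (GF n :: 'a set)"
    by (auto simp: poly_monom GF_def)
  ultimately show "finite (GF n :: 'a set)" and "card (GF n :: 'a set) \<le> n"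
    using poly_roots_finite[of ?p] card_poly_roots_bound[of ?p] deg by auto
qed

lemma card_le_fibres:
  assumes "finite A" and "\<And>y. y \<in> f ` A \<Longrightarrow> card {x \<in> A. f x = y} \<le> n"
  shows "card A \<le> card (f ` A) * n"
proof -
  have "card A = (\<Sum>y\<in>f ` A. card {x \<in> A. f x = y})"
    using sum.image_gen[OF assms(1), of "\<lambda>_. 1::nat" f] by simp
  also have "\<dots> \<le> (\<Sum>y\<in>f ` A. n)"
    by (rule sum_mono) (rule assms(2))
  finally show ?thesis
    by simp
qed

lemma add_eq_0_iff_char_2:
  fixes x y :: "'a::group_add"
  assumes "\<And>z :: 'a. z + z = 0"
  shows "x + y = 0 \<longleftrightarrow> x = y"
  by (metis assms add_right_cancel)

text \<open>The simp rules below remove subtraction, reduce numerals modulo 2 and turn x + y = 0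
  into x = y. The last rewriting breaks up equations that are meant as sums, hence the many
  \<open>del: L.add_eq_0\<close> later. The parameter \<open>ty\<close> carries the type, so that
  the locale can be interpreted at two fields.\<close>

locale finite_field_char_2 =
  fixes n :: nat and ty :: "'a::{field, finite} itself"
  assumes card: "CARD('a) = 2 ^ n"
begin

lemma add_self [simp]: "(x :: 'a) + x = 0"
  by (rule add_self_eq_0[OF card])

lemma add_self_left [simp]: "(x :: 'a) + (x + y) = y"
  by (simp add: add.assoc[symmetric])

lemma numeral_Bit0 [simp]: "(numeral (num.Bit0 m) :: 'a) = 0"
  by (simp only: numeral_Bit0 add_self)

lemma numeral_Bit1 [simp]: "(numeral (num.Bit1 m) :: 'a) = 1"
  by (simp only: numeral_Bit1 add_self add_0)

lemma uminus_eq [simp]: "- (x :: 'a) = x"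
  using add_self[of x] by (simp add: eq_neg_iff_add_eq_0[symmetric])

lemma minus_eq [simp]: "(x :: 'a) - y = x + y"
  by (metis diff_conv_add_uminus uminus_eq)

lemma add_eq_0 [simp]: "(x :: 'a) + y = 0 \<longleftrightarrow> x = y"
  by (rule add_eq_0_iff_char_2) simp

lemma add_power [simp]: "((x :: 'a) + y) ^ (2 ^ m) = x ^ (2 ^ m) + y ^ (2 ^ m)"
  by (rule frobenius_add) simp

text \<open>The map is additive with kernel {0, 1}, so each fibre is a pair {y, y + 1}.\<close>

lemma card_image_artin_schreier: "2 ^ n \<le> 2 * card (range (\<lambda>x :: 'a. x\<^sup>2 + x))"
proof -
  have "card {x \<in> UNIV. x\<^sup>2 + x = y\<^sup>2 + y} \<le> 2" for y :: 'a
  proof -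
    have "x = y \<or> x = y + 1" if "x\<^sup>2 + x = y\<^sup>2 + y" for x
    proof -
      have "(x + y) * (x + y + 1) = (x\<^sup>2 + x) + (y\<^sup>2 + y)"
        by (simp add: algebra_simps power2_eq_square)
      with that have "x + y = 0 \<or> x + y + 1 = 0"
        by (metis add_self mult_eq_0_iff)
      then show ?thesis
        by (metis add_eq_0 add.assoc add.commute)
    qed
    then have "{x \<in> UNIV. x\<^sup>2 + x = y\<^sup>2 + y} \<subseteq> {y, y + 1}"
      by auto
    then have "card {x \<in> UNIV. x\<^sup>2 + x = y\<^sup>2 + y} \<le> card {y, y + 1}"
      by (rule card_mono[rotated]) simp
    also have "\<dots> \<le> 2"
      by (simp add: card_insert_if)
    finally show ?thesis .
  qed
  then have "card (UNIV :: 'a set) \<le> card (range (\<lambda>x :: 'a. x\<^sup>2 + x)) * 2"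
    by (intro card_le_fibres) auto
  then show ?thesis
    by (simp add: card)
qed

text \<open>The image is closed under addition, so for c outside it the image and its translate by c
  are disjoint; each has at least half of the elements, so together they fill the field.\<close>

lemma artin_schreier_dichotomy:
  fixes c d :: 'a
  assumes "c \<notin> range (\<lambda>x. x\<^sup>2 + x)"
  shows "d \<in> range (\<lambda>x. x\<^sup>2 + x) \<or> d + c \<in> range (\<lambda>x. x\<^sup>2 + x)"
proof -
  let ?I = "range (\<lambda>x :: 'a. x\<^sup>2 + x)"
  have add: "u + v \<in> ?I" if "u \<in> ?I" "v \<in> ?I" for u v
  proof -
    from that obtain a b where "u = a\<^sup>2 + a" "v = b\<^sup>2 + b"
      by auto
    then have "u + v = (a + b)\<^sup>2 + (a + b)"
      by (simp add: algebra_simps power2_eq_square)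
    then show ?thesis
      by blast
  qed
  have disj: "?I \<inter> (\<lambda>u. u + c) ` ?I = {}"
  proof (rule ccontr)
    assume "?I \<inter> (\<lambda>u. u + c) ` ?I \<noteq> {}"
    then obtain u v where "u \<in> ?I" "v \<in> ?I" "v = u + c"
      by blast
    then have "c \<in> ?I"
      using add[of u v] by simp
    with assms show False ..
  qed
  have "card ((\<lambda>u. u + c) ` ?I) = card ?I"
    by (rule card_image) (simp add: inj_on_def)
  then have "card (?I \<union> (\<lambda>u. u + c) ` ?I) = 2 * card ?I"
    using disj by (subst card_Un_disjoint) auto
  with card_image_artin_schreier have "card (?I \<union> (\<lambda>u. u + c) ` ?I) \<ge> CARD('a)"
    by (simp add: card)
  then have "?I \<union> (\<lambda>u. u + c) ` ?I = UNIV"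
    by (intro card_seteq) auto
  then have "d \<in> ?I \<union> (\<lambda>u. u + c) ` ?I"
    by simp
  then show ?thesis
    by (elim UnE imageE) (auto simp: add.assoc)
qed

lemma ex_square_root: "\<exists>y :: 'a. y\<^sup>2 = x"
proof -
  have "inj (\<lambda>y :: 'a. y\<^sup>2)"
  proof (rule injI)
    fix y z :: 'a
    assume "y\<^sup>2 = z\<^sup>2"
    then have "(y + z)\<^sup>2 = 0"
      by (simp add: power2_eq_square algebra_simps)
    then show "y = z"
      by simp
  qed
  then have "surj (\<lambda>y :: 'a. y\<^sup>2)"
    by (simp add: finite_UNIV_inj_surj)
  then show ?thesis
    by (metis surjD)
qed

end

section \<open>The fields of order q^2 and q^4 and their automorphisms\<close>

locale field_tower =
  fixes h q :: nat and \<epsilon> :: "'k::{field, finite} \<Rightarrow> 'l::{field, finite}"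
  assumes h_ge_1: "h \<ge> 1" and q_eq: "q = 2 ^ h"
    and card_k: "CARD('k) = q ^ 2" and card_l: "CARD('l) = q ^ 4"
    and embedding: "field_embedding \<epsilon>"
begin

sublocale K: finite_field_char_2 "2 * h" "TYPE('k)"
  by unfold_locales (simp add: card_k q_eq power_mult[symmetric] mult.commute)

sublocale L: finite_field_char_2 "4 * h" "TYPE('l)"
  by unfold_locales (simp add: card_l q_eq power_mult[symmetric] mult.commute)

lemma q_ge_2: "q \<ge> 2"
  using power_increasing[OF h_ge_1, of "2::nat"] by (simp add: q_eq)

lemma q_pos [simp]: "q > 0" "q \<noteq> 0"
  using q_ge_2 by auto

lemma power_q_add [simp]:
  "((x :: 'k) + y) ^ q = x ^ q + y ^ q"
  "((a :: 'l) + b) ^ q = a ^ q + b ^ q"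
  by (simp_all add: q_eq)

lemma power_q_q [simp]: "((x :: 'k) ^ q) ^ q = x"
  using power_card_eq[of x] by (simp add: card_k power2_eq_square power_mult[symmetric])

lemma eps_1 [simp]: "\<epsilon> 1 = 1"
  and eps_add [simp]: "\<epsilon> (x + y) = \<epsilon> x + \<epsilon> y"
  and eps_mult [simp]: "\<epsilon> (x * y) = \<epsilon> x * \<epsilon> y"
  using embedding by (auto simp: field_embedding_def)

lemma eps_0 [simp]: "\<epsilon> 0 = 0"
  using eps_add[of 0 0] by simp

lemma eps_eq_0 [simp]: "\<epsilon> x = 0 \<longleftrightarrow> x = 0"
proof
  assume "\<epsilon> x = 0"
  then have "\<epsilon> (x * inverse x) = 0"
    by simp
  then show "x = 0"
    by (metis eps_1 right_inverse zero_neq_one)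
qed simp

lemma eps_eq [simp]: "\<epsilon> x = \<epsilon> y \<longleftrightarrow> x = y"
  by (metis K.add_eq_0 L.add_eq_0 eps_add eps_eq_0)

lemma eps_eq_1 [simp]: "\<epsilon> x = 1 \<longleftrightarrow> x = 1"
  using eps_eq[of x 1] by (simp del: eps_eq)

lemma eps_power [simp]: "\<epsilon> (x ^ n) = \<epsilon> x ^ n"
  by (induction n) simp_all

lemma eps_inverse [simp]: "\<epsilon> (inverse x) = inverse (\<epsilon> x)"
proof (cases "x = 0")
  case False
  then have "\<epsilon> x * \<epsilon> (inverse x) = 1"
    by (simp del: eps_mult add: eps_mult[symmetric])
  then show ?thesis
    by (simp add: inverse_unique)
qed simp

lemma eps_divide [simp]: "\<epsilon> (x / y) = \<epsilon> x / \<epsilon> y"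
  by (simp add: divide_inverse)

definition bar :: "'l \<Rightarrow> 'l" where
  "bar x = x ^ q\<^sup>2"

lemma bar_add [simp]: "bar (x + y) = bar x + bar y"
  by (simp add: bar_def power2_eq_square power_mult)

lemma bar_mult [simp]: "bar (x * y) = bar x * bar y"
  by (simp add: bar_def power_mult_distrib)

lemma bar_0 [simp]: "bar 0 = 0" and bar_1 [simp]: "bar 1 = 1"
  by (simp_all add: bar_def)

lemma bar_bar [simp]: "bar (bar x) = x"
  using power_card_eq[of x] by (simp add: bar_def card_l power_mult[symmetric] power_add[symmetric])

lemma bar_eq_0 [simp]: "bar x = 0 \<longleftrightarrow> x = 0"
  by (simp add: bar_def)

lemma bar_eq [simp]: "bar x = bar y \<longleftrightarrow> x = y"
  by (metis bar_bar)

lemma bar_power [simp]: "bar (x ^ n) = bar x ^ n"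
  by (simp add: bar_def power_mult[symmetric] mult.commute)

lemma bar_inverse [simp]: "bar (inverse x) = inverse (bar x)"
  by (simp add: bar_def power_inverse)

lemma bar_divide [simp]: "bar (x / y) = bar x / bar y"
  by (simp add: bar_def power_divide)

lemma bar_eps [simp]: "bar (\<epsilon> x) = \<epsilon> x"
  using power_card_eq[of x] by (simp add: bar_def card_k eps_power[symmetric] del: eps_power)

text \<open>One inclusion is clear, and as a set of roots the left side has at most q^2 elements.
  This is what makes "fixed by \<open>bar\<close>" a test for membership in the small field.\<close>

lemma GF_q2: "GF (q\<^sup>2) = range \<epsilon>"
proof (rule card_seteq[symmetric])
  have "q * q \<ge> 2 * 2"
    using q_ge_2 by (rule mult_le_mono[OF _ q_ge_2])
  then have q2: "q\<^sup>2 > 1"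
    by (simp add: power2_eq_square)
  show "finite (GF (q\<^sup>2) :: 'l set)"
    by simp
  show "range \<epsilon> \<subseteq> GF (q\<^sup>2)"
    using bar_eps by (auto simp: GF_def bar_def)
  have "card (range \<epsilon>) = q\<^sup>2"
    by (subst card_image) (auto simp: inj_on_def card_k)
  then show "card (GF (q\<^sup>2) :: 'l set) \<le> card (range \<epsilon>)"
    using card_GF_le(2)[OF q2, where 'a = 'l] by simp
qed

lemma bar_eq_self_iff: "bar x = x \<longleftrightarrow> x \<in> range \<epsilon>"
  using GF_q2 by (auto simp: GF_def bar_def)

lemma bar_eq_selfE:
  assumes "bar x = x"
  obtains y where "x = \<epsilon> y"
  using assms bar_eq_self_iff by blast

lemma ex_not_range: "\<exists>t. t \<notin> range \<epsilon>"
proof (rule ccontr)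
  assume "\<not> ?thesis"
  then have "range \<epsilon> = UNIV"
    by auto
  moreover have "card (range \<epsilon>) = q\<^sup>2"
    by (subst card_image) (auto simp: inj_on_def card_k)
  ultimately have "q ^ 4 = q ^ 2"
    using card_l by simp
  then show False
    using q_ge_2 power_inject_exp[of q 4 2] by simp
qed

lemma ex_power_q_neq: "\<exists>w :: 'k. w ^ q \<noteq> w"
proof (rule ccontr)
  assume "\<not> ?thesis"
  then have "GF q = (UNIV :: 'k set)"
    by (auto simp: GF_def)
  then have "q ^ 2 \<le> q"
    using card_GF_le(2)[of q, where 'a = 'k] q_ge_2 by (simp add: card_k)
  then show False
    using q_ge_2 by (simp add: power2_eq_square)
qed

text \<open>A quadratic extension makes all these equations solvable at once: values x^2 + x of the
  small field have index two, so if c is not one of them, then c + d is, for a single non-value d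
  that has the root y in the large field.\<close>

lemma ex_artin_schreier_root: "\<exists>z :: 'l. z\<^sup>2 + z = \<epsilon> c"
proof -
  obtain t where t: "t \<notin> range \<epsilon>"
    using ex_not_range by blast
  \<comment> \<open>This y has relative trace 1, that is \<open>bar y = y + 1\<close>. So y^2 + y
    descends to some d, whose only roots y and y + 1 lie outside the small field.\<close>
  define y where "y = t / (t + bar t)"
  have ne: "t + bar t \<noteq> 0"
    using t bar_eq_self_iff[of t] by (metis L.add_eq_0)
  have bar_y: "bar y = y + 1"
    using ne by (simp add: y_def add.commute field_simps)
  then have "bar (y\<^sup>2 + y) = y\<^sup>2 + y"
    by (simp add: power2_eq_square algebra_simps)
  then obtain d where d: "y\<^sup>2 + y = \<epsilon> d"
    by (rule bar_eq_selfE)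
  have "d \<notin> range (\<lambda>x. x\<^sup>2 + x)"
  proof
    assume "d \<in> range (\<lambda>x. x\<^sup>2 + x)"
    then obtain x where x: "d = x\<^sup>2 + x"
      by blast
    have "(y + \<epsilon> x) * (y + \<epsilon> x + 1) = y\<^sup>2 + y + \<epsilon> d"
      by (simp add: x algebra_simps power2_eq_square)
    then have "y + \<epsilon> x = 0 \<or> y + (\<epsilon> x + 1) = 0"
      by (simp add: d add.assoc del: L.add_eq_0)
    then have "y = \<epsilon> x \<or> y = \<epsilon> (x + 1)"
      by simp
    then show False
      using bar_y bar_eps by (metis add_cancel_right_right zero_neq_one)
  qed
  then have "c \<in> range (\<lambda>x. x\<^sup>2 + x) \<or> c + d \<in> range (\<lambda>x. x\<^sup>2 + x)"
    by (rule K.artin_schreier_dichotomy)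
  then consider x where "c = x\<^sup>2 + x" | x where "c + d = x\<^sup>2 + x"
    by blast
  then show ?thesis
  proof cases
    case 1
    then show ?thesis
      by (intro exI[of _ "\<epsilon> x"]) simp
  next
    case 2
    have "c = (c + d) + d"
      by (simp add: add.assoc)
    then have "c = x\<^sup>2 + x + d"
      by (simp add: 2)
    then have "\<epsilon> c = \<epsilon> x ^ 2 + \<epsilon> x + (y\<^sup>2 + y)"
      by (simp add: d)
    then show ?thesis
      by (intro exI[of _ "\<epsilon> x + y"]) (simp add: power2_eq_square algebra_simps)
  qed
qed

lemma ex_quadratic_root:
  assumes "b \<noteq> 0"
  shows "\<exists>t :: 'l. t\<^sup>2 + \<epsilon> b * t + \<epsilon> c = 0"
proof -
  obtain z where "z\<^sup>2 + z = \<epsilon> (c / b\<^sup>2)"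
    using ex_artin_schreier_root by blast
  then have "(\<epsilon> b)\<^sup>2 * (z\<^sup>2 + z) = \<epsilon> c"
    using assms by simp
  then show ?thesis
    by (intro exI[of _ "\<epsilon> b * z"]) (simp add: power2_eq_square algebra_simps)
qed

text \<open>The norm maps q^2 - 1 nonzero elements to at most q - 1 nonzero values, with fibres of
  size at most q + 1; a single smaller fibre would break the count.\<close>

lemma card_norm_fibre:
  fixes f :: 'k
  assumes "f \<noteq> 0" and "f ^ q = f"
  shows "card {y. y ^ (q + 1) = f} = q + 1"
proof (rule ccontr)
  let ?F = "GF q - {0 :: 'k}"
  have le: "card {y :: 'k. y ^ (q + 1) = g} \<le> q + 1" for g
    using card_roots_of_power_le(2)[of "q + 1" g] by simp
  assume "card {y. y ^ (q + 1) = f} \<noteq> q + 1"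
  then have lt: "card {y. y ^ (q + 1) = f} < q + 1"
    using le[of f] by simp
  have im: "y ^ (q + 1) \<in> ?F" if "y \<in> UNIV - {0}" for y :: 'k
    using that by (simp add: GF_def power_mult_distrib)
  have fibre: "{y \<in> UNIV - {0}. y ^ (q + 1) = g} = {y. y ^ (q + 1) = g}" if "g \<in> ?F" for g :: 'k
    using that by auto
  have "card (UNIV - {0 :: 'k}) = (\<Sum>g\<in>?F. card {y \<in> UNIV - {0}. y ^ (q + 1) = g})"
    unfolding card_eq_sum by (rule sum.group[symmetric]) (simp, simp, rule image_subsetI, rule im)
  also have "\<dots> = (\<Sum>g\<in>?F. card {y. y ^ (q + 1) = g})"
    by (rule sum.cong) (simp_all only: fibre)
  also have "\<dots> < (\<Sum>g\<in>?F. q + 1)"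
    by (rule sum_strict_mono_ex1) (use le lt assms in \<open>auto simp: GF_def\<close>)
  also have "\<dots> = card ?F * (q + 1)"
    by simp
  also have "\<dots> \<le> (q - 1) * (q + 1)"
    using card_GF_le(2)[of q, where 'a = 'k] q_ge_2
    by (intro mult_le_mono1) (subst card_Diff_singleton, auto simp: GF_def)
  also have "\<dots> = q\<^sup>2 - 1"
    by (simp add: power2_eq_square algebra_simps)
  also have "\<dots> = card (UNIV - {0 :: 'k})"
    by (simp add: card_k)
  finally show False
    by simp
qed

end

locale conjugation = field_tower h q \<epsilon>
  for h q :: nat and \<epsilon> :: "'k::{field, finite} \<Rightarrow> 'l::{field, finite}" +
  fixes \<phi> :: "'l \<Rightarrow> 'l"
  assumes phi_add [simp]: "\<phi> (x + y) = \<phi> x + \<phi> y"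
    and phi_mult [simp]: "\<phi> (x * y) = \<phi> x * \<phi> y"
    and phi_phi [simp]: "\<phi> (\<phi> x) = bar x"
    and phi_eps [simp]: "\<phi> (\<epsilon> u) = \<epsilon> (u ^ q)"
begin

lemma phi_0 [simp]: "\<phi> 0 = 0" and phi_1 [simp]: "\<phi> 1 = 1"
  using phi_eps[of 0] phi_eps[of 1] by (simp_all del: phi_eps)

lemma phi_eq [simp]: "\<phi> x = \<phi> y \<longleftrightarrow> x = y"
  by (metis phi_phi bar_bar)

lemma phi_eq_0 [simp]: "\<phi> x = 0 \<longleftrightarrow> x = 0"
  using phi_eq[of x 0] by simp

lemma phi_bar: "\<phi> (bar x) = bar (\<phi> x)"
  by (metis phi_phi)

end

context field_tower
begin

lemma conjugation_power_q: "conjugation h q \<epsilon> (\<lambda>x. x ^ q)"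
  by unfold_locales
    (simp_all add: power_mult_distrib bar_def power_mult[symmetric] power2_eq_square)

lemma conjugation_power_q3: "conjugation h q \<epsilon> (\<lambda>x. x ^ q ^ 3)"
proof unfold_locales
  have q3: "x ^ q ^ 3 = bar (x ^ q)" for x
    by (simp add: bar_def power_mult[symmetric] power_Suc[symmetric] del: power_Suc bar_power)
  show "(x + y) ^ q ^ 3 = x ^ q ^ 3 + y ^ q ^ 3" for x y :: 'l
    by (simp only: q3 power_q_add bar_add)
  show "(x * y) ^ q ^ 3 = x ^ q ^ 3 * y ^ q ^ 3" for x y :: 'l
    by (simp add: power_mult_distrib)
  show "(x ^ q ^ 3) ^ q ^ 3 = bar x" for x :: 'l
  proof -
    have "(x ^ q ^ 3) ^ q ^ 3 = bar (bar ((x ^ q) ^ q))"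
      by (simp only: q3 bar_power)
    also have "\<dots> = bar x"
      by (simp only: bar_bar) (simp add: bar_def power_mult[symmetric] power2_eq_square)
    finally show ?thesis .
  qed
  show "\<epsilon> y ^ q ^ 3 = \<epsilon> (y ^ q)" for y
    by (simp only: q3 eps_power[symmetric] bar_eps)
qed

end

section \<open>Projective points and lines\<close>

lemma in_vec_span_pair:
  "x \<in> vec.span {u, v :: 'a::field ^ 'n} \<longleftrightarrow> (\<exists>a b. x = a *s u + b *s v)"
proof -
  have "x \<in> vec.span {u, v} \<longleftrightarrow> (\<exists>a b. x - a *s u = b *s v)"
    by (auto simp: vec.span_breakdown_eq[of x u] vec.span_singleton)
  also have "\<dots> \<longleftrightarrow> (\<exists>a b. x = a *s u + b *s v)"
    by (simp add: diff_eq_eq add.commute)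
  finally show ?thesis .
qed

lemma vec_span_pair_subset:
  fixes u v :: "'a::field ^ 'n"
  assumes "vec.subspace W" and "u \<in> W" and "v \<in> W"
  shows "vec.span {u, v} \<subseteq> W"
  using assms by (intro vec.span_minimal) auto

lemma vec_span_singleton_subset:
  assumes "vec.subspace W"
  shows "vec.span {v :: 'a::field ^ 'n} \<subseteq> W \<longleftrightarrow> v \<in> W"
proof
  assume "vec.span {v} \<subseteq> W"
  then show "v \<in> W"
    by (meson insertI1 subsetD vec.span_base)
next
  assume "v \<in> W"
  with assms show "vec.span {v} \<subseteq> W"
    by (intro vec.span_minimal) auto
qed

lemma vec_span_singleton_eq:
  fixes v :: "'a::field ^ 'n"
  assumes "w \<in> vec.span {v}" and "w \<noteq> 0"
  shows "vec.span {w} = vec.span {v}"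
proof
  show "vec.span {w} \<subseteq> vec.span {v}"
    using assms by (simp add: vec_span_singleton_subset)
  obtain c where c: "w = c *s v"
    using assms(1) by (auto simp: vec.span_singleton)
  with assms(2) have "c \<noteq> 0"
    by auto
  then have "v = inverse c *s w"
    by (simp add: c)
  then have "v \<in> vec.span {w}"
    by (auto simp: vec.span_singleton)
  then show "vec.span {v} \<subseteq> vec.span {w}"
    by (simp add: vec_span_singleton_subset)
qed

lemma proj_points_eq:
  fixes W :: "('a::field ^ 'n) set"
  assumes "vec.subspace W"
  shows "proj_points W = {vec.span {v} | v. v \<in> W \<and> v \<noteq> 0}"
proof (intro equalityI subsetI)
  fix P
  assume "P \<in> proj_points W"
  then have P: "vec.subspace P" "vec.dim P = 1" "P \<subseteq> W"
    by (auto simp: proj_points_def)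
  obtain B where B: "B \<subseteq> P" "vec.independent B" "P \<subseteq> vec.span B" "card B = vec.dim P"
    by (rule vec.basis_exists)
  with P(2) obtain v where v: "B = {v}"
    by (metis card_1_singletonE)
  then have "P = vec.span {v}"
    using B P(1) by (metis subset_antisym vec.span_minimal)
  moreover have "v \<noteq> 0" "v \<in> W"
    using v B(1,2) P(3) vec.dependent_zero[of B] by blast+
  ultimately show "P \<in> {vec.span {v} | v. v \<in> W \<and> v \<noteq> 0}"
    by blast
next
  fix P
  assume "P \<in> {vec.span {v} | v. v \<in> W \<and> v \<noteq> 0}"
  then show "P \<in> proj_points W"
    using vec_span_singleton_subset[OF assms] by (auto simp: proj_points_def)
qed

lemma proj_linesE:
  fixes l :: "('a::field ^ 'n) set"
  assumes "l \<in> proj_lines"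
  obtains u v where "l = vec.span {u, v}"
    and "\<forall>a b. a *s u + b *s v = 0 \<longrightarrow> a = 0 \<and> b = 0"
proof -
  obtain B where B: "B \<subseteq> l" "vec.independent B" "l \<subseteq> vec.span B" "card B = 2"
    using assms vec.basis_exists[of l] by (auto simp: proj_lines_def)
  then obtain u v where uv: "B = {u, v}" "u \<noteq> v"
    by (auto simp: card_2_iff)
  show ?thesis
  proof (rule that)
    show "l = vec.span {u, v}"
      using B(1,3) vec.span_minimal[OF B(1)] assms unfolding uv proj_lines_def by blast
  next
    have *: "c = 0" if "c *s x + d *s y = 0" "{u, v} = {x, y}" "x \<noteq> y" for c d x y
    proof (rule ccontr)
      assume "c \<noteq> 0"
      have "x = inverse c *s (c *s x)"
        using \<open>c \<noteq> 0\<close> by simp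
      also have "c *s x = - (d *s y)"
        using that(1) by (simp add: eq_neg_iff_add_eq_0)
      finally have "x \<in> vec.span {y}"
        by (simp add: vec.span_base vec.span_scale vec.span_neg)
      moreover have "{u, v} - {x} = {y}"
        using that by auto
      ultimately show False
        using B(2) uv that by (auto simp: vec.dependent_def)
    qed
    have "a = 0" "b = 0" if "a *s u + b *s v = 0" for a b
      using *[of a u b v] *[of b v a u] that uv(2) by (auto simp: add.commute insert_commute)
    then show "\<forall>a b. a *s u + b *s v = 0 \<longrightarrow> a = 0 \<and> b = 0"
      by blast
  qed
qed

lemma span_pair_in_proj_lines:
  fixes u v :: "'a::field ^ 'n"
  assumes "\<And>a b. a *s u + b *s v = 0 \<Longrightarrow> a = 0 \<and> b = 0"
  shows "vec.span {u, v} \<in> proj_lines"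
proof -
  have "v \<noteq> 0"
    using assms[of 0 1] by auto
  moreover have "u \<notin> vec.span {v}"
  proof
    assume "u \<in> vec.span {v}"
    then obtain c where "u = c *s v"
      by (auto simp: vec.span_singleton)
    then have "1 *s u + (- c) *s v = 0"
      by simp
    then show False
      using assms by fastforce
  qed
  ultimately have "vec.dim {u, v} = 2"
    by (simp add: vec.dim_insert)
  then show ?thesis
    by (simp add: proj_lines_def)
qed

lemma proj_points_disjoint_iff:
  fixes l m :: "('a::field ^ 'n) set"
  assumes "vec.subspace l" and "vec.subspace m"
  shows "proj_points l \<inter> proj_points m = {} \<longleftrightarrow> l \<inter> m \<subseteq> {0}"
proof
  assume *: "proj_points l \<inter> proj_points m = {}"
  show "l \<inter> m \<subseteq> {0}"
  proof
    fix v
    assume v: "v \<in> l \<inter> m"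
    show "v \<in> {0}"
    proof (rule ccontr)
      assume "v \<notin> {0}"
      with v have "vec.span {v} \<in> proj_points l \<inter> proj_points m"
        by (auto simp: proj_points_eq assms)
      with * show False
        by blast
    qed
  qed
next
  assume *: "l \<inter> m \<subseteq> {0}"
  show "proj_points l \<inter> proj_points m = {}"
  proof (rule ccontr)
    assume "proj_points l \<inter> proj_points m \<noteq> {}"
    then obtain v where v: "v \<noteq> 0" "vec.span {v} \<in> proj_points l" "vec.span {v} \<in> proj_points m"
      by (auto simp: proj_points_eq assms)
    then have "v \<in> l \<inter> m"
      using assms by (auto simp: proj_points_def vec_span_singleton_subset)
    with * v show False
      by auto
  qed
qed

text \<open>The projection of \<open>l\<close> to the coordinates i and j is injective, hence onto
  by dimension; Cramer's rule with determinant \<open>D\<close> makes this explicit.\<close>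

lemma proj_line_coordinates:
  fixes l :: "('a::field ^ 'n) set"
  assumes "l \<in> proj_lines" and zero: "\<And>w. w \<in> l \<Longrightarrow> w $ i = 0 \<Longrightarrow> w $ j = 0 \<Longrightarrow> w = 0"
  shows "\<exists>v\<in>l. v $ i = x \<and> v $ j = y"
proof -
  obtain u v where l: "l = vec.span {u, v}" and indep: "\<forall>a b. a *s u + b *s v = 0 \<longrightarrow> a = 0 \<and> b = 0"
    using assms(1) by (rule proj_linesE)
  have comb: "a *s u + b *s v \<in> l" for a b
    by (auto simp: l in_vec_span_pair)
  define D where "D = u $ i * v $ j - u $ j * v $ i"
  \<comment> \<open>If \<open>D = 0\<close>, two combinations of u and v vanish in both coordinates;
    this forces first \<open>u $ i = u $ j = 0\<close> and then u = 0.\<close>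
  have "D \<noteq> 0"
  proof
    assume D: "D = 0"
    have "v $ i *s u + (- u $ i) *s v = 0" "v $ j *s u + (- u $ j) *s v = 0"
      by (rule zero[OF comb]; use D in \<open>simp add: D_def mult.commute\<close>)+
    then have "u $ i = 0" "u $ j = 0"
      using indep neg_equal_0_iff_equal by blast+
    then have "1 *s u + 0 *s v = 0"
      by (intro zero[OF comb]) simp_all
    then show False
      using indep one_neq_zero by blast
  qed
  let ?w = "((x * v $ j - y * v $ i) / D) *s u + ((y * u $ i - x * u $ j) / D) *s v"
  have "(x * v $ j - y * v $ i) * u $ i + (y * u $ i - x * u $ j) * v $ i = x * D"
    "(x * v $ j - y * v $ i) * u $ j + (y * u $ i - x * u $ j) * v $ j = y * D"
    by (simp_all add: D_def algebra_simps)
  then have "?w $ i = x * D / D" "?w $ j = y * D / D"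
    by (simp_all only: vector_add_component vector_smult_component times_divide_eq_left
        add_divide_distrib[symmetric])
  with \<open>D \<noteq> 0\<close> have "?w $ i = x" "?w $ j = y"
    by simp_all
  then show ?thesis
    using comb by blast
qed

section \<open>Elliptic lines\<close>

lemma conic_point_eq_iff: "conic_point s = conic_point t \<longleftrightarrow> s = t"
proof
  assume "conic_point s = conic_point t"
  then have "vector [1, s, s\<^sup>2] \<in> vec.span {vector [1, t, t\<^sup>2] :: 'a ^ 3}"
    by (metis conic_point_def insertI1 vec.span_base)
  then show "s = t"
    by (auto simp: vec.span_singleton vec_eq_iff forall_3 vector_3)
qed simp

context field_tower
begin

lemma add_bar_neq_0 [simp]: "t \<notin> range \<epsilon> \<Longrightarrow> bar t \<noteq> t" "t \<notin> range \<epsilon> \<Longrightarrow> t \<noteq> bar t"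
  using bar_eq_self_iff[of t] by auto

lemma bar_in_range_iff [simp]: "bar t \<in> range \<epsilon> \<longleftrightarrow> t \<in> range \<epsilon>"
  by (metis bar_bar bar_eq_self_iff)

text \<open>The join of the conic points with parameters t and \<open>bar t\<close>. Its
  coefficients are the norm and the trace of t, so it is defined over the small field.\<close>

definition ell :: "'l \<Rightarrow> ('l ^ 3) set" where
  "ell t = {v. v $ 3 = t * bar t * v $ 1 + (t + bar t) * v $ 2}"

lemma subspace_ell: "vec.subspace (ell t)"
  by (simp add: vec.subspace_def ell_def algebra_simps)

lemma ell_bar: "ell (bar t) = ell t"
  by (simp add: ell_def algebra_simps)

lemma conic_point_subset_ell: "conic_point u \<subseteq> ell t \<longleftrightarrow> u = t \<or> u = bar t"
proof -
  have "conic_point u \<subseteq> ell t \<longleftrightarrow> u\<^sup>2 = t * bar t + (t + bar t) * u"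
    by (simp add: conic_point_def vec_span_singleton_subset[OF subspace_ell]) (simp add: ell_def)
  also have "\<dots> \<longleftrightarrow> u\<^sup>2 + (t * bar t + (t + bar t) * u) = 0"
    by simp
  also have "u\<^sup>2 + (t * bar t + (t + bar t) * u) = (u + t) * (u + bar t)"
    by (simp add: power2_eq_square algebra_simps)
  finally show ?thesis
    by simp
qed

lemma conic_in_proj_points:
  fixes P :: "('l ^ 3) set"
  assumes "P \<in> conic"
  shows "P \<in> proj_points W \<longleftrightarrow> P \<subseteq> W"
proof -
  from assms consider t where "P = conic_point t" | "P = vec.span {vector [0, 0, 1]}"
    by (auto simp: conic_def)
  then obtain v :: "'l ^ 3" where "P = vec.span {v}" "v \<noteq> 0"
    by cases (auto simp: conic_point_def vec_eq_iff forall_3)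
  then show ?thesis
    by (simp add: proj_points_def)
qed

lemma proj_points_ell_conic: "proj_points (ell t) \<inter> conic = {conic_point t, conic_point (bar t)}"
proof (intro equalityI subsetI)
  fix P
  assume "P \<in> proj_points (ell t) \<inter> conic"
  then have P: "P \<in> conic" "P \<subseteq> ell t"
    by (auto simp: conic_in_proj_points)
  have "P \<noteq> vec.span {vector [0, 0, 1]}"
  proof
    assume "P = vec.span {vector [0, 0, 1]}"
    with P(2) have "vector [0, 0, 1] \<in> ell t"
      by (simp add: vec_span_singleton_subset[OF subspace_ell])
    then show False
      by (simp add: ell_def)
  qed
  with P(1) obtain u where "P = conic_point u"
    by (auto simp: conic_def)
  with P(2) show "P \<in> {conic_point t, conic_point (bar t)}"
    by (auto simp: conic_point_subset_ell)
next
  fix P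
  assume "P \<in> {conic_point t, conic_point (bar t)}"
  then show "P \<in> proj_points (ell t) \<inter> conic"
    by (auto simp: conic_in_proj_points conic_point_subset_ell) (auto simp: conic_def conic_in_proj_points conic_point_subset_ell)
qed

lemma elliptic_param_ell:
  assumes "t \<notin> range \<epsilon>"
  shows "elliptic_param q (ell t) s \<longleftrightarrow> s = t \<or> s = bar t"
proof -
  have "elliptic_param q (ell t) s \<longleftrightarrow> s \<notin> range \<epsilon> \<and>
      {conic_point t, conic_point (bar t)} = {conic_point s, conic_point (bar s)}"
    by (simp add: elliptic_param_def proj_points_ell_conic GF_q2 bar_def)
  then show ?thesis
    unfolding doubleton_eq_iff conic_point_eq_iff
    using assms by (metis bar_bar bar_in_range_iff)
qed

lemma ell_eq_iff:
  assumes "s \<notin> range \<epsilon>" "t \<notin> range \<epsilon>"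
  shows "ell s = ell t \<longleftrightarrow> s = t \<or> s = bar t"
  using elliptic_param_ell[OF assms(1), of s] elliptic_param_ell[OF assms(2), of s]
  by (auto simp: ell_bar)

text \<open>The line \<open>z = \<alpha> x + \<beta> y\<close> meets the conic where \<open>t\<^sup>2 = \<alpha> + \<beta> t\<close>.\<close>

lemma extend_scalars_line:
  assumes "t + bar t = \<epsilon> \<beta>" and "t * bar t = \<epsilon> \<alpha>"
  shows "extend_scalars \<epsilon> {v. v $ 3 = \<alpha> * v $ 1 + \<beta> * v $ 2} = ell t"
    (is "extend_scalars \<epsilon> ?l = _")
proof
  show "extend_scalars \<epsilon> ?l \<subseteq> ell t"
    unfolding extend_scalars_def
    by (rule vec.span_minimal[OF _ subspace_ell]) (auto simp: ell_def assms)
  show "ell t \<subseteq> extend_scalars \<epsilon> ?l"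
  proof
    fix v
    assume "v \<in> ell t"
    then have v: "v = v $ 1 *s vector [1, 0, \<epsilon> \<alpha>] + v $ 2 *s vector [0, 1, \<epsilon> \<beta>]"
      by (simp add: ell_def assms vec_eq_iff forall_3 mult.commute)
    have "(vector [1, 0, \<epsilon> \<alpha>] :: 'l ^ 3) = (\<chi> i. \<epsilon> (vector [1, 0, \<alpha>] $ i))"
      "(vector [0, 1, \<epsilon> \<beta>] :: 'l ^ 3) = (\<chi> i. \<epsilon> (vector [0, 1, \<beta>] $ i))"
      by (simp_all add: vec_eq_iff forall_3)
    then have "vector [1, 0, \<epsilon> \<alpha>] \<in> extend_scalars \<epsilon> ?l" "vector [0, 1, \<epsilon> \<beta>] \<in> extend_scalars \<epsilon> ?l"
      unfolding extend_scalars_def by (auto intro!: vec.span_base imageI simp del: vec_lambda_beta)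
    then show "v \<in> extend_scalars \<epsilon> ?l"
      unfolding extend_scalars_def by (subst v) (intro vec.span_add vec.span_scale)
  qed
qed

lemma extend_scalars_span:
  "extend_scalars \<epsilon> (vec.span {v}) = vec.span {\<chi> i. \<epsilon> (v $ i)}"
proof
  show "extend_scalars \<epsilon> (vec.span {v}) \<subseteq> vec.span {\<chi> i. \<epsilon> (v $ i)}"
    unfolding extend_scalars_def
  proof (rule vec.span_minimal, safe)
    fix u
    assume "u \<in> vec.span {v}"
    then obtain c where "u = c *s v"
      by (auto simp: vec.span_singleton)
    then have "(\<chi> i. \<epsilon> (u $ i)) = \<epsilon> c *s (\<chi> i. \<epsilon> (v $ i))"
      by (simp add: vec_eq_iff)
    then show "(\<chi> i. \<epsilon> (u $ i)) \<in> vec.span {\<chi> i. \<epsilon> (v $ i)}"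
      by (auto simp: vec.span_singleton)
  qed
  show "vec.span {\<chi> i. \<epsilon> (v $ i)} \<subseteq> extend_scalars \<epsilon> (vec.span {v})"
    unfolding extend_scalars_def by (rule vec.span_mono) (auto intro: vec.span_base)
qed

lemma small_conicI:
  "vec.span {vector [1, u, u\<^sup>2]} \<in> small_conic \<epsilon>" "vec.span {vector [0, 0, 1]} \<in> small_conic \<epsilon>"
proof -
  have "(\<chi> i. \<epsilon> (vector [1, u, u\<^sup>2] $ i)) = (vector [1, \<epsilon> u, (\<epsilon> u)\<^sup>2] :: 'l ^ 3)"
    "(\<chi> i. \<epsilon> (vector [0, 0, 1] $ i)) = (vector [0, 0, 1] :: 'l ^ 3)"
    by (simp_all add: vec_eq_iff forall_3)
  moreover have "vec.span {v} \<in> proj_points UNIV" if "v $ 1 \<noteq> 0 \<or> v $ 3 \<noteq> 0" for v :: "'k ^ 3"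
    using that by (subst proj_points_eq) (auto simp: vec_eq_iff)
  ultimately show "vec.span {vector [1, u, u\<^sup>2]} \<in> small_conic \<epsilon>" "vec.span {vector [0, 0, 1]} \<in> small_conic \<epsilon>"
    by (simp_all add: small_conic_def extend_scalars_span conic_def conic_point_def)
qed

lemma proj_line_eq_graph:
  fixes l :: "('k ^ 3) set"
  assumes "l \<in> proj_lines" and e3: "\<And>z. vector [0, 0, z] \<in> l \<Longrightarrow> z = 0"
  obtains \<alpha> \<beta> where "l = {v. v $ 3 = \<alpha> * v $ 1 + \<beta> * v $ 2}"
proof -
  have sub: "vec.subspace l"
    using assms(1) by (simp add: proj_lines_def)
  have zero: "w = 0" if "w \<in> l" "w $ 1 = 0" "w $ 2 = 0" for w
  proof -
    have "w = vector [0, 0, w $ 3]"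
      using that by (simp add: vec_eq_iff forall_3)
    with e3[of "w $ 3"] that show ?thesis
      by (simp add: vec_eq_iff forall_3)
  qed
  obtain u where u: "u \<in> l" "u $ 1 = 1" "u $ 2 = 0"
    using proj_line_coordinates[OF assms(1) zero] by blast
  obtain v where v: "v \<in> l" "v $ 1 = 0" "v $ 2 = 1"
    using proj_line_coordinates[OF assms(1) zero] by blast
  have comb: "x *s u + y *s v \<in> l" for x y
    by (intro vec.subspace_add vec.subspace_scale sub u v)
  have "w \<in> l \<longleftrightarrow> w $ 3 = u $ 3 * w $ 1 + v $ 3 * w $ 2" for w
  proof
    assume "w \<in> l"
    then have "w - (w $ 1 *s u + w $ 2 *s v) \<in> l"
      by (intro vec.subspace_diff[OF sub] comb)
    then have "w - (w $ 1 *s u + w $ 2 *s v) = 0"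
      by (rule zero) (simp_all add: u v)
    then have "w $ 3 = (w $ 1 *s u + w $ 2 *s v) $ 3"
      by simp
    then show "w $ 3 = u $ 3 * w $ 1 + v $ 3 * w $ 2"
      by (simp add: mult.commute)
  next
    assume "w $ 3 = u $ 3 * w $ 1 + v $ 3 * w $ 2"
    then have "w = w $ 1 *s u + w $ 2 *s v"
      by (simp add: mult.commute vec_eq_iff forall_3 u v)
    then show "w \<in> l"
      using comb by metis
  qed
  then show ?thesis
    by (intro that) blast
qed

text \<open>A line missing the conic misses (0, 0, 1), so it is a graph z = \<alpha> x + \<beta> y
  for which t^2 + \<beta> t + \<alpha> has no root in the small field. Its roots in the large field
  are conjugate, with trace \<beta> and norm \<alpha>. Conversely, a rational point of
  \<open>ell t\<close> on the conic would make t or \<open>bar t\<close> rational.\<close>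

lemma elliptic_lines_eq: "elliptic_lines \<epsilon> = ell ` (- range \<epsilon>)"
proof (intro equalityI subsetI)
  fix m
  assume "m \<in> elliptic_lines \<epsilon>"
  then obtain l where l: "m = extend_scalars \<epsilon> l" "l \<in> proj_lines" "proj_points l \<inter> small_conic \<epsilon> = {}"
    by (auto simp: elliptic_lines_def)
  have sub: "vec.subspace l"
    using l(2) by (simp add: proj_lines_def)
  have no: "v \<notin> l" if "vec.span {v} \<in> small_conic \<epsilon>" for v
  proof
    assume "v \<in> l"
    then have "vec.span {v} \<in> proj_points l"
      using that sub by (auto simp: small_conic_def proj_points_def vec_span_singleton_subset)
    with l(3) that show False
      by blast
  qed
  obtain \<alpha> \<beta> where \<alpha>\<beta>: "l = {v. v $ 3 = \<alpha> * v $ 1 + \<beta> * v $ 2}"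
  proof (rule proj_line_eq_graph[OF l(2)])
    fix z
    assume z: "vector [0, 0, z] \<in> l"
    show "z = 0"
    proof (rule ccontr)
      assume "z \<noteq> 0"
      then have "vector [0, 0, 1] = inverse z *s (vector [0, 0, z] :: 'k ^ 3)"
        by (simp add: vec_eq_iff forall_3)
      then have "vector [0, 0, 1] \<in> l"
        using z by (metis vec.subspace_scale[OF sub])
      then show False
        using no small_conicI(2) by blast
    qed
  qed
  have noroot: "u\<^sup>2 \<noteq> \<alpha> + \<beta> * u" for u
    using no[OF small_conicI(1), of u] by (auto simp: \<alpha>\<beta>)
  \<comment> \<open>For \<beta> = 0 the equation u^2 = \<alpha> would be solvable, as squaring is
    onto.\<close>
  have "\<beta> \<noteq> 0"
    using noroot by (metis K.ex_square_root add.right_neutral mult_zero_left)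
  then obtain t where t: "t\<^sup>2 + \<epsilon> \<beta> * t + \<epsilon> \<alpha> = 0"
    using ex_quadratic_root by blast
  have tn: "t \<notin> range \<epsilon>"
  proof
    assume "t \<in> range \<epsilon>"
    then obtain u where "t = \<epsilon> u"
      by blast
    with t have "\<epsilon> (u\<^sup>2 + \<beta> * u + \<alpha>) = 0"
      by (simp del: L.add_eq_0)
    then have "u\<^sup>2 + \<beta> * u + \<alpha> = 0"
      by (simp only: eps_eq_0)
    then have "u\<^sup>2 + \<beta> * u = \<alpha>"
      by simp
    then have "u\<^sup>2 = \<alpha> + \<beta> * u"
      by (metis K.add_self_left add.commute)
    with noroot show False
      by blast
  qed
  have "bar (t\<^sup>2 + \<epsilon> \<beta> * t + \<epsilon> \<alpha>) = 0"
    by (simp only: t bar_0)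
  then have t': "(bar t)\<^sup>2 + \<epsilon> \<beta> * bar t + \<epsilon> \<alpha> = 0"
    by (simp del: L.add_eq_0)
  \<comment> \<open>The sum of the two root equations factors; as t is not fixed by
    \<open>bar\<close>, its conjugate is the second root and the roots add up to \<beta>.\<close>
  have "(t + bar t) * (t + bar t + \<epsilon> \<beta>) = (t\<^sup>2 + \<epsilon> \<beta> * t + \<epsilon> \<alpha>) + ((bar t)\<^sup>2 + \<epsilon> \<beta> * bar t + \<epsilon> \<alpha>)"
    by (simp add: power2_eq_square algebra_simps)
  then have "(t + bar t) * (t + bar t + \<epsilon> \<beta>) = 0"
    by (simp only: t t' add_0)
  then have sum: "t + bar t = \<epsilon> \<beta>"
    using tn by simp
  have "\<epsilon> \<alpha> = t\<^sup>2 + \<epsilon> \<beta> * t"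
    using t by simp
  then have "t * bar t = \<epsilon> \<alpha>"
    by (simp add: sum[symmetric] power2_eq_square algebra_simps)
  with sum have "m = ell t"
    by (simp add: l(1) \<alpha>\<beta> extend_scalars_line)
  with tn show "m \<in> ell ` (- range \<epsilon>)"
    by blast
next
  fix m
  assume "m \<in> ell ` (- range \<epsilon>)"
  then obtain t where t: "t \<notin> range \<epsilon>" "m = ell t"
    by blast
  obtain \<beta> where \<beta>: "t + bar t = \<epsilon> \<beta>"
    by (rule bar_eq_selfE[of "t + bar t"]) (simp add: add.commute)
  obtain \<alpha> where \<alpha>: "t * bar t = \<epsilon> \<alpha>"
    by (rule bar_eq_selfE[of "t * bar t"]) (simp add: mult.commute)
  define l :: "('k ^ 3) set" where "l = {v. v $ 3 = \<alpha> * v $ 1 + \<beta> * v $ 2}"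
  have ext: "extend_scalars \<epsilon> l = m"
    using extend_scalars_line[OF \<beta> \<alpha>] by (simp add: l_def t)
  have sub: "vec.subspace l"
    by (simp add: vec.subspace_def l_def algebra_simps)
  have l_span: "l = vec.span {vector [1, 0, \<alpha>], vector [0, 1, \<beta>]}"
  proof
    show "vec.span {vector [1, 0, \<alpha>], vector [0, 1, \<beta>]} \<subseteq> l"
      by (rule vec_span_pair_subset[OF sub]) (simp_all add: l_def)
    show "l \<subseteq> vec.span {vector [1, 0, \<alpha>], vector [0, 1, \<beta>]}"
    proof
      fix v
      assume "v \<in> l"
      then have "v = v $ 1 *s vector [1, 0, \<alpha>] + v $ 2 *s vector [0, 1, \<beta>]"
        by (simp add: l_def vec_eq_iff forall_3 mult.commute)
      then show "v \<in> vec.span {vector [1, 0, \<alpha>], vector [0, 1, \<beta>]}"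
        by (auto simp: in_vec_span_pair)
    qed
  qed
  have "l \<in> proj_lines"
    unfolding l_span by (rule span_pair_in_proj_lines) (simp add: vec_eq_iff forall_3)
  moreover have "proj_points l \<inter> small_conic \<epsilon> = {}"
  proof (rule ccontr)
    assume "proj_points l \<inter> small_conic \<epsilon> \<noteq> {}"
    then obtain v where v: "v \<in> l" "v \<noteq> 0" "vec.span {v} \<in> small_conic \<epsilon>"
      by (auto simp: proj_points_eq[OF sub])
    let ?w = "\<chi> i. \<epsilon> (v $ i)"
    have "vec.span {?w} \<in> conic"
      using v(3) by (simp add: small_conic_def extend_scalars_span)
    moreover have "vec.span {?w} \<subseteq> m"
      unfolding ext[symmetric] extend_scalars_span[symmetric] extend_scalars_def
      using v(1) sub by (intro vec.span_mono image_mono) (simp add: vec_span_singleton_subset)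
    ultimately have "vec.span {?w} \<in> proj_points (ell t) \<inter> conic"
      by (simp add: t(2) conic_in_proj_points)
    then obtain u where u: "u = t \<or> u = bar t" "vec.span {?w} = conic_point u"
      by (auto simp: proj_points_ell_conic)
    then have "?w \<in> conic_point u"
      by (metis insertI1 vec.span_base)
    then obtain c where "?w = c *s vector [1, u, u\<^sup>2]"
      by (auto simp: conic_point_def vec.span_singleton)
    then have c: "\<epsilon> (v $ 1) = c" "\<epsilon> (v $ 2) = c * u" "\<epsilon> (v $ 3) = c * u\<^sup>2"
      by (auto simp: vec_eq_iff forall_3)
    have "c \<noteq> 0"
    proof
      assume "c = 0"
      with c have "v = 0"
        by (simp add: vec_eq_iff forall_3)
      with v(2) show False ..
    qed
    then have "u = \<epsilon> (v $ 2 / v $ 1)"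
      using c by simp
    then have "u \<in> range \<epsilon>"
      by blast
    with u(1) t(1) show False
      by (metis bar_in_range_iff)
  qed
  ultimately show "m \<in> elliptic_lines \<epsilon>"
    using ext by (auto simp: elliptic_lines_def)
qed

end

section \<open>The Hollmann--Xiang relations\<close>

context field_tower
begin

text \<open>
  With \<open>x = 1 / (\<rho> + 1)\<close> one has \<open>1 / (\<rho> + \<rho>\<^sup>-\<^sup>1) = x\<^sup>2 + x\<close>, so the absolute traces of
  \<^term>\<open>rho_hat q s t\<close> telescope; the three relations are told apart by \<open>x + x\<^sup>q\<close>.
\<close>

definition cross :: "'l \<Rightarrow> 'l \<Rightarrow> 'l" where
  "cross s t = ((bar s + t) * (s + bar t)) / ((s + bar s) * (t + bar t))"

definition tau :: "'l \<Rightarrow> 'l \<Rightarrow> 'l" where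
  "tau s t = cross s t + cross s t ^ q"

lemma bar_cross [simp]: "bar (cross s t) = cross s t"
  by (simp add: cross_def add.commute mult.commute)

text \<open>The three products belong to the three ways of pairing off s, \<open>bar s\<close>, t,
  \<open>bar t\<close>: this is the three-term cross-ratio relation in characteristic two.\<close>

lemma sum_products: "(s + t) * (bar s + bar t) + (bar s + t) * (s + bar t) = (s + bar s) * (t + bar t)"
  by (simp add: algebra_simps)

lemma rho_hat_eq_quotient:
  assumes "s \<noteq> t" and "s \<noteq> bar t"
  shows "rho_hat q s t =
    ((s + t) * (bar s + bar t)) * ((bar s + t) * (s + bar t)) / ((s + bar s) * (t + bar t))\<^sup>2"
proof -
  define P R where "P = (s + t) * (bar s + bar t)" and "R = (bar s + t) * (s + bar t)"
  have ne: "P \<noteq> 0" "R \<noteq> 0"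
    using assms bar_bar by (auto simp: P_def R_def)
  have "rho q s t = P / R"
    by (simp add: rho_def P_def R_def bar_def[symmetric] mult.commute)
  then have "rho_hat q s t = 1 / (P / R + R / P)"
    by (simp add: rho_hat_def)
  also have "P / R + R / P = (P + R)\<^sup>2 / (P * R)"
    using ne by (simp add: power2_eq_square field_simps)
  also have "1 / \<dots> = P * R / (P + R)\<^sup>2"
    by simp
  also have "P + R = (s + bar s) * (t + bar t)"
    by (simp only: P_def R_def sum_products)
  finally show ?thesis
    by (simp only: P_def R_def)
qed

lemma rho_hat_eq:
  assumes "s \<noteq> t" and "s \<noteq> bar t" and "s \<notin> range \<epsilon>" and "t \<notin> range \<epsilon>"
  shows "rho_hat q s t = (cross s t)\<^sup>2 + cross s t"
proof -
  define P R where "P = (s + t) * (bar s + bar t)" and "R = (bar s + t) * (s + bar t)"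
  define e where "e = (s + bar s) * (t + bar t)"
  have "e \<noteq> 0"
    using assms by (simp add: e_def)
  have P: "P = e + R"
    by (simp only: sum_products[symmetric] e_def P_def R_def add.assoc L.add_self add_0_right)
  have "rho_hat q s t = P * R / e\<^sup>2"
    using rho_hat_eq_quotient[OF assms(1,2)] by (simp only: P_def R_def e_def)
  also have "\<dots> = (R / e)\<^sup>2 + R / e"
    using \<open>e \<noteq> 0\<close> by (simp add: P power2_eq_square field_simps)
  finally show ?thesis
    by (simp only: cross_def R_def e_def)
qed

lemma rho_hat_bar:
  assumes "s \<noteq> t" and "s \<noteq> bar t"
  shows "rho_hat q (bar s) t = rho_hat q s t" and "rho_hat q s (bar t) = rho_hat q s t"
proof -
  have "bar s \<noteq> t" "bar s \<noteq> bar t"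
    using assms by (metis bar_bar)+
  then show "rho_hat q (bar s) t = rho_hat q s t"
    using assms by (simp add: rho_hat_eq_quotient mult_ac add_ac)
  show "rho_hat q s (bar t) = rho_hat q s t"
    using assms by (simp add: rho_hat_eq_quotient mult_ac add_ac)
qed

lemma hx_related_ell_iff:
  assumes "s \<notin> range \<epsilon>" and "t \<notin> range \<epsilon>" and "s \<noteq> t" and "s \<noteq> bar t"
  shows "(ell s, ell t) \<in> hx_related q \<epsilon> D \<longleftrightarrow> rho_hat q s t \<in> D"
proof -
  have "rho_hat q (bar s) (bar t) = rho_hat q s t"
    using rho_hat_bar[of s t] rho_hat_bar[of s "bar t"] assms by simp
  with assms show ?thesis
    unfolding hx_related_def
    by (auto simp: elliptic_param_ell ell_eq_iff elliptic_lines_eq rho_hat_bar)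
qed

lemma abs_trace_artin_schreier:
  fixes x :: 'l
  shows "abs_trace m (x\<^sup>2 + x) = x ^ (2 ^ m) + x"
proof (induction m)
  case (Suc m)
  have "abs_trace (Suc m) (x\<^sup>2 + x) = abs_trace m (x\<^sup>2 + x) + (x\<^sup>2 + x) ^ (2 ^ m)"
    by (simp add: abs_trace_def)
  also have "\<dots> = (x ^ (2 ^ m) + x) + ((x\<^sup>2) ^ (2 ^ m) + x ^ (2 ^ m))"
    by (simp only: Suc L.add_power)
  also have "(x\<^sup>2) ^ (2 ^ m) = x ^ (2 ^ Suc m)"
    by (simp add: power_mult[symmetric])
  finally show ?case
    by (simp add: add_ac)
qed (simp add: abs_trace_def)

text \<open>Write r for \<open>rho_hat q s t\<close>. Since r^q + r = tau (tau + 1), r lies in GF(q)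
  exactly when tau is 0 or 1, and the trace sum of length h at r equals tau. The trace over GF(q^2)
  vanishes, so the third class says that r is outside GF(q). As the first class demands, r is
  nonzero: s and t are neither equal nor conjugate.\<close>

lemma hx_rel_ell_iff:
  assumes "s \<notin> range \<epsilon>" and "t \<notin> range \<epsilon>" and "s \<noteq> t" and "s \<noteq> bar t"
  shows "(ell s, ell t) \<in> hx_rel h \<epsilon> 1 \<longleftrightarrow> tau s t = 0"
    and "(ell s, ell t) \<in> hx_rel h \<epsilon> 2 \<longleftrightarrow> tau s t = 1"
    and "(ell s, ell t) \<in> hx_rel h \<epsilon> 3 \<longleftrightarrow> tau s t \<noteq> 0 \<and> tau s t \<noteq> 1"
proof -
  let ?x = "cross s t" and ?r = "rho_hat q s t"
  have r: "?r = ?x\<^sup>2 + ?x"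
    using assms by (intro rho_hat_eq)
  have "bar s \<noteq> t"
    using assms(4) by (metis bar_bar)
  then have "?r \<noteq> 0"
    unfolding rho_hat_eq_quotient[OF assms(3,4)] using assms by simp
  have tr: "abs_trace h ?r = tau s t"
    unfolding r abs_trace_artin_schreier tau_def q_eq[symmetric] by (rule add.commute)
  have tr2: "abs_trace (2 * h) ?r = 0"
  proof -
    have "q\<^sup>2 = 2 ^ (2 * h)"
      by (simp add: q_eq power_mult[symmetric] mult.commute)
    then have "?x ^ (2 ^ (2 * h)) = bar ?x"
      by (simp only: bar_def)
    then show ?thesis
      by (simp add: r abs_trace_artin_schreier del: bar_cross) simp
  qed
  have gf2: "?r \<in> GF (q\<^sup>2)"
    by (simp add: GF_def bar_def[symmetric] r)
  have "tau s t * (tau s t + 1) = ?r ^ q + ?r"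
    by (simp add: r tau_def algebra_simps power2_eq_square power_mult_distrib)
  moreover have "?r \<in> GF q \<longleftrightarrow> ?r ^ q + ?r = 0"
    by (simp add: GF_def)
  ultimately have "?r \<in> GF q \<longleftrightarrow> tau s t * (tau s t + 1) = 0"
    by (simp only:)
  then have gf: "?r \<in> GF q \<longleftrightarrow> tau s t = 0 \<or> tau s t = 1"
    by simp
  show "(ell s, ell t) \<in> hx_rel h \<epsilon> 1 \<longleftrightarrow> tau s t = 0"
    using \<open>?r \<noteq> 0\<close> hx_related_ell_iff[OF assms, of "S0 h - {0}"] gf
    by (auto simp: hx_rel_def S0_def q_eq[symmetric] tr)
  show "(ell s, ell t) \<in> hx_rel h \<epsilon> 2 \<longleftrightarrow> tau s t = 1"
    using hx_related_ell_iff[OF assms, of "S1 h"] gf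
    by (auto simp: hx_rel_def S0_def S1_def q_eq[symmetric] tr)
  show "(ell s, ell t) \<in> hx_rel h \<epsilon> 3 \<longleftrightarrow> tau s t \<noteq> 0 \<and> tau s t \<noteq> 1"
    using hx_related_ell_iff[OF assms, of "T0 h - GF (2 ^ h)"] gf gf2
    by (auto simp: hx_rel_def T0_def tr2 q_eq[symmetric] numeral_3_eq_3)
qed

end

section \<open>Hermitian forms on the field extension\<close>

context field_tower
begin

definition down :: "'l \<Rightarrow> 'k" where
  "down x = inv_into UNIV \<epsilon> x"

lemma eps_down [simp]: "bar x = x \<Longrightarrow> \<epsilon> (down x) = x"
  unfolding down_def bar_eq_self_iff by (rule f_inv_into_f)

text \<open>Completing the norm: multiplied by a, the expression becomes a^2 (N(y + b^q / a) + f)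
  with N(y) = y^(q + 1) and f as in \<open>?f\<close>, so the zeros are counted by the elements of
  norm f.\<close>

lemma card_affine_hermitian_zeros:
  fixes a b d :: 'k
  assumes "a \<noteq> 0" and "a ^ q = a" and "d ^ q = d"
  shows "card {y. a * y ^ (q + 1) + b * y + b ^ q * y ^ q + d = 0} =
    (if a * d + b ^ (q + 1) = 0 then 1 else q + 1)"
proof -
  let ?f = "(a * d + b ^ (q + 1)) / a\<^sup>2"
  have shift: "a * (a * y ^ (q + 1) + b * y + b ^ q * y ^ q + d) = a\<^sup>2 * ((y + b ^ q / a) ^ (q + 1) + ?f)" for y
  proof -
    define r where "r = b ^ q / a"
    have r: "a * r = b ^ q" "a * r ^ q = b"
      using assms(1,2) by (simp_all add: r_def power_divide)
    have "a\<^sup>2 * ?f = a * d + b ^ (q + 1)"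
      using assms(1) by (simp only: times_divide_eq_right nonzero_mult_div_cancel_left power_eq_0_iff simp_thms)
    moreover have "a\<^sup>2 * ((y + r) ^ (q + 1) + ?f) = (a * y + a * r) * (a * y ^ q + a * r ^ q) + a\<^sup>2 * ?f"
      by (simp only: distrib_left power_add power_one_right power_q_add)
        (simp only: power2_eq_square distrib_left distrib_right mult_ac add_ac)
    ultimately have "a\<^sup>2 * ((y + r) ^ (q + 1) + ?f) = (a * y + b ^ q) * (a * y ^ q + b) + (a * d + b ^ (q + 1))"
      by (simp only: r)
    then have "a\<^sup>2 * ((y + b ^ q / a) ^ (q + 1) + ?f) = (a * y + b ^ q) * (a * y ^ q + b) + (a * d + b ^ (q + 1))"
      by (simp only: r_def)
    also have "\<dots> = a * (a * y ^ (q + 1) + b * y + b ^ q * y ^ q + d)"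
      by (simp add: algebra_simps)
    finally show ?thesis ..
  qed
  have "(a * y ^ (q + 1) + b * y + b ^ q * y ^ q + d = 0) \<longleftrightarrow> (y + b ^ q / a) ^ (q + 1) = ?f" for y
  proof -
    have "(a * y ^ (q + 1) + b * y + b ^ q * y ^ q + d = 0) \<longleftrightarrow>
        a * (a * y ^ (q + 1) + b * y + b ^ q * y ^ q + d) = 0"
      using assms(1) by (simp only: mult_eq_0_iff simp_thms)
    also have "\<dots> \<longleftrightarrow> a\<^sup>2 * ((y + b ^ q / a) ^ (q + 1) + ?f) = 0"
      by (simp only: shift)
    also have "\<dots> \<longleftrightarrow> (y + b ^ q / a) ^ (q + 1) + ?f = 0"
      using assms(1) by (simp only: mult_eq_0_iff power_eq_0_iff simp_thms)
    finally show ?thesis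
      by (simp only: K.add_eq_0)
  qed
  then have "card {y. a * y ^ (q + 1) + b * y + b ^ q * y ^ q + d = 0} = card {y. (y + b ^ q / a) ^ (q + 1) = ?f}"
    by (simp only:)
  also have "\<dots> = card {y. y ^ (q + 1) = ?f}"
  proof (rule bij_betw_same_card)
    show "bij_betw (\<lambda>y. y + b ^ q / a) {y. (y + b ^ q / a) ^ (q + 1) = ?f} {y. y ^ (q + 1) = ?f}"
      by (rule bij_betw_byWitness[where f' = "\<lambda>y. y + b ^ q / a"]) (auto simp only: add.assoc K.add_self add_0_right mem_Collect_eq)
  qed
  also have "\<dots> = (if a * d + b ^ (q + 1) = 0 then 1 else q + 1)"
  proof (cases "a * d + b ^ (q + 1) = 0")
    case True
    then have "{y. y ^ (q + 1) = ?f} = {0}"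
      by (simp only: True) auto
    with True show ?thesis
      by simp
  next
    case False
    have "?f ^ q = ?f"
    proof -
      have "(b ^ (q + 1)) ^ q = b ^ (q + 1)"
        by (simp only: power_add power_one_right power_mult_distrib power_q_q mult.commute)
      moreover have "(a\<^sup>2) ^ q = a\<^sup>2"
        by (simp only: power2_eq_square power_mult_distrib assms)
      ultimately show ?thesis
        by (simp only: power_divide power_q_add power_mult_distrib assms)
    qed
    moreover have "?f \<noteq> 0"
      using False assms(1) by (simp only: divide_eq_0_iff power_eq_0_iff simp_thms)
    ultimately have "card {y. y ^ (q + 1) = ?f} = q + 1"
      by (intro card_norm_fibre)
    with False show ?thesis
      by simp
  qed
  finally show ?thesis .
qed

text \<open>\<open>c\<^sub>0\<close> and \<open>g\<close> form a basis of the large field over the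
  small one. With u and w the ratios to \<open>c\<^sub>0\<close>, the coefficient z is the quotient
  of the relative traces of u and w; then u + z w is fixed by \<open>bar\<close>.\<close>

lemma ex_coordinates:
  assumes "c\<^sub>0 \<noteq> 0" and "g / c\<^sub>0 \<notin> range \<epsilon>"
  obtains y z where "c = \<epsilon> y * c\<^sub>0 + \<epsilon> z * g"
proof -
  define u w where "u = c / c\<^sub>0" and "w = g / c\<^sub>0"
  have w: "w + bar w \<noteq> 0"
    using add_bar_neq_0(2)[OF assms(2)] unfolding w_def L.add_eq_0 .
  obtain z where z: "(u + bar u) / (w + bar w) = \<epsilon> z"
    by (rule bar_eq_selfE[of "(u + bar u) / (w + bar w)"]) (simp add: add.commute)
  have uw: "u + bar u = \<epsilon> z * (w + bar w)"
    using w by (simp add: z[symmetric] del: L.add_eq_0)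
  have "bar (u + \<epsilon> z * w) + (u + \<epsilon> z * w) = (u + bar u) + \<epsilon> z * (w + bar w)"
    by (simp add: algebra_simps)
  then have "bar (u + \<epsilon> z * w) + (u + \<epsilon> z * w) = 0"
    by (simp only: uw L.add_self)
  then have "bar (u + \<epsilon> z * w) = u + \<epsilon> z * w"
    by (simp only: L.add_eq_0)
  then obtain y where "u + \<epsilon> z * w = \<epsilon> y"
    by (rule bar_eq_selfE)
  then have "u = \<epsilon> y + \<epsilon> z * w"
    by (metis L.add_self_left add.commute)
  then have "c = (\<epsilon> y + \<epsilon> z * w) * c\<^sub>0"
    using assms(1) by (simp add: u_def field_simps)
  then have "c = \<epsilon> y * c\<^sub>0 + \<epsilon> z * g"
    using assms(1) by (simp add: w_def distrib_right)
  then show ?thesis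
    by (rule that)
qed

end

context conjugation
begin

declare phi_bar [simp]

text \<open>The relative trace of \<open>\<phi> m * c * \<phi> g + m * c * bar (\<phi> g)\<close>, a
  Hermitian form in c and g over the small field. It is the shape taken by the determinant in
  \<open>wline_meets_hline_iff\<close>.\<close>

definition hform :: "'l \<Rightarrow> 'l \<Rightarrow> 'l \<Rightarrow> 'l" where
  "hform m c g = \<phi> m * c * \<phi> g + m * c * bar (\<phi> g) + bar m * bar c * \<phi> g + bar (\<phi> m) * bar c * bar (\<phi> g)"

lemma bar_hform [simp]: "bar (hform m c g) = hform m c g"
  by (simp add: hform_def add_ac)

lemma phi_hform: "\<phi> (hform m c g) = hform m g c"
  by (simp add: hform_def algebra_simps)

lemma hform_add: "hform m (c + c') g = hform m c g + hform m c' g" "hform m c (g + g') = hform m c g + hform m c g'"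
  by (simp_all add: hform_def algebra_simps)

lemma hform_scale: "hform m (\<epsilon> y * c) g = \<epsilon> y * hform m c g" "hform m c (\<epsilon> y * g) = \<epsilon> (y ^ q) * hform m c g"
  by (simp_all add: hform_def algebra_simps del: eps_power)

text \<open>The Gram determinant splits: the part containing c and g is nonzero when they are
  independent over the small field, so degeneracy depends on m alone.\<close>

lemma hform_gram:
  "hform m c c * hform m g g + hform m c g * hform m g c =
    (c * bar g + bar c * g) * \<phi> (c * bar g + bar c * g) * (\<phi> (m * bar m) + m * bar m)"
  by (simp add: hform_def algebra_simps)

text \<open>If all diagonal values vanish, polarization kills the whole form; testing it in each
  argument at 1 and at some t outside the small field then leaves only m = 0.\<close>

lemma ex_hform_neq_0:
  assumes "m \<noteq> 0"
  shows "\<exists>c. hform m c c \<noteq> 0"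
proof (rule ccontr)
  assume "\<not> ?thesis"
  then have zero: "hform m c c = 0" for c
    by blast
  have zero2: "hform m c g = 0" for c g
  proof (rule ccontr)
    assume ne: "hform m c g \<noteq> 0"
    obtain x where x: "hform m c g = \<epsilon> x"
      by (rule bar_eq_selfE[OF bar_hform])
    with ne have "x \<noteq> 0"
      by auto
    obtain w :: 'k where w: "w ^ q \<noteq> w"
      using ex_power_q_neq by blast
    \<comment> \<open>This scalar turns the polar term into w + w^q, which is nonzero by the choice
      of w.\<close>
    define k where "k = w / x"
    have "hform m (\<epsilon> k * c + g) (\<epsilon> k * c + g) = 0"
      by (rule zero)
    then have "\<epsilon> k * hform m c g + \<epsilon> (k ^ q) * hform m g c = 0"
      by (simp only: hform_add hform_scale zero mult_zero_right add_0 add_0_right add.commute)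
    moreover have "hform m g c = \<epsilon> (x ^ q)"
      by (simp only: phi_hform[of m c g, symmetric] x phi_eps)
    ultimately have "\<epsilon> (k * x + (k * x) ^ q) = 0"
      by (simp only: x eps_mult eps_add power_mult_distrib)
    then have "k * x + (k * x) ^ q = 0"
      by (simp only: eps_eq_0)
    moreover have "k * x = w"
      using \<open>x \<noteq> 0\<close> by (simp add: k_def)
    ultimately have "w + w ^ q = 0"
      by (simp only:)
    then have "w ^ q = w"
      unfolding K.add_eq_0 by (rule sym)
    with w show False ..
  qed
  obtain t where t: "t \<notin> range \<epsilon>"
    using ex_not_range by blast
  have lin: "\<phi> m * c + bar m * bar c = 0" for c
  proof -
    let ?A = "\<phi> m * c + bar m * bar c" and ?B = "m * c + bar (\<phi> m) * bar c"
    have AB: "?A * \<phi> g + ?B * bar (\<phi> g) = 0" for g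
      using zero2[of c g] by (simp only: hform_def) (simp only: algebra_simps)
    have "?A + ?B = 0"
      using AB[of 1] by (simp only: phi_1 bar_1 mult_1_right)
    then have "?B = ?A"
      by (simp only: L.add_eq_0)
    with AB[of t] have "?A * (\<phi> t + bar (\<phi> t)) = 0"
      by (simp only: distrib_left)
    moreover have "\<phi> t + bar (\<phi> t) \<noteq> 0"
      using t by (simp add: phi_bar[symmetric] del: phi_bar)
    ultimately show ?thesis
      by (simp only: mult_eq_0_iff simp_thms)
  qed
  have "\<phi> m + bar m = 0"
    using lin[of 1] by (simp only: bar_1 mult_1_right)
  then have "\<phi> m = bar m"
    by (simp only: L.add_eq_0)
  with lin[of t] have "bar m * (t + bar t) = 0"
    by (simp only: distrib_left)
  with assms t show False
    by simp
qed

text \<open>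
  The form is Hermitian over the subfield of order \<open>q\<^sup>2\<close>; an affine chart of its projective line is
  taken so that the omitted point \<open>c\<^sub>0\<close> is anisotropic.
\<close>

lemma card_hform_zeros:
  assumes c0: "hform m c\<^sub>0 c\<^sub>0 \<noteq> 0" and g: "g / c\<^sub>0 \<notin> range \<epsilon>"
  shows "card {y. hform m (\<epsilon> y * c\<^sub>0 + g) (\<epsilon> y * c\<^sub>0 + g) = 0} =
    (if \<phi> (m * bar m) + m * bar m = 0 then 1 else q + 1)"
proof -
  have "c\<^sub>0 \<noteq> 0"
    using c0 by (auto simp: hform_def)
  obtain a where a: "hform m c\<^sub>0 c\<^sub>0 = \<epsilon> a"
    by (rule bar_eq_selfE[OF bar_hform])
  obtain b where b: "hform m c\<^sub>0 g = \<epsilon> b"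
    by (rule bar_eq_selfE[OF bar_hform])
  obtain d where d: "hform m g g = \<epsilon> d"
    by (rule bar_eq_selfE[OF bar_hform])
  have b': "hform m g c\<^sub>0 = \<epsilon> (b ^ q)"
    by (simp only: phi_hform[of m c\<^sub>0 g, symmetric] b phi_eps)
  have "\<epsilon> (a ^ q) = \<epsilon> a" "\<epsilon> (d ^ q) = \<epsilon> d"
    by (simp_all only: phi_eps[symmetric] a[symmetric] d[symmetric] phi_hform)
  then have ad: "a ^ q = a" "d ^ q = d"
    by (simp_all only: eps_eq)
  have "a \<noteq> 0"
    using c0 a by auto
  have "hform m (\<epsilon> y * c\<^sub>0 + g) (\<epsilon> y * c\<^sub>0 + g) = \<epsilon> (a * y ^ (q + 1) + b * y + b ^ q * y ^ q + d)" for y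
    by (simp only: hform_add hform_scale a b b' d eps_add[symmetric] eps_mult[symmetric])
      (simp add: algebra_simps)
  then have "card {y. hform m (\<epsilon> y * c\<^sub>0 + g) (\<epsilon> y * c\<^sub>0 + g) = 0} =
      card {y. a * y ^ (q + 1) + b * y + b ^ q * y ^ q + d = 0}"
    by (simp only: eps_eq_0)
  also have "\<dots> = (if a * d + b ^ (q + 1) = 0 then 1 else q + 1)"
    by (rule card_affine_hermitian_zeros) fact+
  also have "a * d + b ^ (q + 1) = 0 \<longleftrightarrow> \<phi> (m * bar m) + m * bar m = 0"
  proof -
    let ?P = "c\<^sub>0 * bar g + bar c\<^sub>0 * g"
    have "?P \<noteq> 0"
    proof
      assume "?P = 0"
      then have "c\<^sub>0 * bar g = bar c\<^sub>0 * g"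
        by (simp only: L.add_eq_0)
      with \<open>c\<^sub>0 \<noteq> 0\<close> have "bar (g / c\<^sub>0) = g / c\<^sub>0"
        by (simp add: frac_eq_eq mult.commute)
      with g show False
        by (simp add: bar_eq_self_iff del: bar_divide)
    qed
    have "a * d + b ^ (q + 1) = 0 \<longleftrightarrow> \<epsilon> (a * d + b * b ^ q) = 0"
      by (simp only: eps_eq_0 power_add power_one_right mult.commute)
    also have "\<epsilon> (a * d + b * b ^ q) = ?P * \<phi> ?P * (\<phi> (m * bar m) + m * bar m)"
      unfolding hform_gram[symmetric] by (simp only: eps_add eps_mult a b b' d)
    also have "\<dots> = 0 \<longleftrightarrow> \<phi> (m * bar m) + m * bar m = 0"
      using \<open>?P \<noteq> 0\<close> by (simp only: mult_eq_0_iff phi_eq_0 simp_thms)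
    finally show ?thesis .
  qed
  finally show ?thesis .
qed

end

section \<open>The lines of a relative hemisystem\<close>

lemma vec_eq_iff_4: "(u :: 'a ^ 4) = v \<longleftrightarrow> u $ 1 = v $ 1 \<and> u $ 2 = v $ 2 \<and> u $ 3 = v $ 3 \<and> u $ 4 = v $ 4"
  by (simp add: vec_eq_iff forall_4)

context field_tower
begin

text \<open>At a vector (1, x, x^q, x^(q + 1)) this is (x + r)(x^q + t): the functional is a pure
  tensor, with r and t as the parameters of its two factors. Keeping them independent treats both
  kinds of lines together.\<close>

definition pform :: "'l \<Rightarrow> 'l \<Rightarrow> 'k ^ 4 \<Rightarrow> 'l" where
  "pform t r X = \<epsilon> (X $ 4) + t * \<epsilon> (X $ 2) + r * \<epsilon> (X $ 3) + t * r * \<epsilon> (X $ 1)"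

definition pline :: "'l \<Rightarrow> 'l \<Rightarrow> ('k ^ 4) set" where
  "pline t r = {X. pform t r X = 0}"

text \<open>The semilinear involution whose fixed vectors are those of \<open>Vhat q\<close>. Every
  X is orthogonal to \<open>sg X\<close>, see \<open>herm_self_sg\<close>.\<close>

definition sg :: "'k ^ 4 \<Rightarrow> 'k ^ 4" where
  "sg X = vector [X $ 1 ^ q, X $ 3 ^ q, X $ 2 ^ q, X $ 4 ^ q]"

lemma sg_nth [simp]:
  "sg X $ 1 = X $ 1 ^ q" "sg X $ 2 = X $ 3 ^ q" "sg X $ 3 = X $ 2 ^ q" "sg X $ 4 = X $ 4 ^ q"
  by (simp_all add: sg_def vector_4_nth)

lemma sg_sg [simp]: "sg (sg X) = X"
  by (simp add: vec_eq_iff_4)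

lemma sg_add [simp]: "sg (X + Y) = sg X + sg Y"
  by (simp add: vec_eq_iff_4)

lemma sg_scale [simp]: "sg (c *s X) = c ^ q *s sg X"
  by (simp add: vec_eq_iff_4 power_mult_distrib)

lemma sg_0 [simp]: "sg 0 = 0"
  unfolding vec_eq_iff_4 sg_nth zero_index by (simp add: zero_power)

lemma Vhat_eq: "Vhat q = {X :: 'k ^ 4. sg X = X}"
proof (intro equalityI subsetI)
  fix X :: "'k ^ 4"
  assume "X \<in> Vhat q"
  then show "X \<in> {X. sg X = X}"
    by (auto simp: Vhat_def GF_def vec_eq_iff_4 vector_4_nth)
next
  fix X :: "'k ^ 4"
  assume "X \<in> {X. sg X = X}"
  then have "X = vector [X $ 1, (X $ 3) ^ q, X $ 3, X $ 4]" "X $ 1 \<in> GF q" "X $ 4 \<in> GF q"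
    by (auto simp: GF_def vec_eq_iff_4 vector_4_nth)
  then show "X \<in> Vhat q"
    unfolding Vhat_def by blast
qed

lemma herm_add:
  "herm q (X + X') (Y :: 'k ^ 4) = herm q X Y + herm q X' Y"
  "herm q (X :: 'k ^ 4) (Y + Y') = herm q X Y + herm q X Y'"
  by (simp_all add: herm_def algebra_simps)

lemma herm_scale:
  "herm q (c *s X) (Y :: 'k ^ 4) = c * herm q X Y"
  "herm q (X :: 'k ^ 4) (c *s Y) = c ^ q * herm q X Y"
  by (simp_all add: herm_def algebra_simps power_mult_distrib)

lemma herm_self_sg: "herm q X (sg X) = (0 :: 'k)"
  by (simp add: herm_def algebra_simps)

lemma herm_sg_sg: "herm q (sg X) (sg Y) = herm q Y (X :: 'k ^ 4)"
  by (simp add: herm_def algebra_simps)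

text \<open>For an isotropic X independent of \<open>sg X\<close>, this is the unique line of the
  symplectic subgeometry through X.\<close>

definition wline :: "'k ^ 4 \<Rightarrow> ('k ^ 4) set" where
  "wline X = vec.span {X, sg X}"

lemma herm_wline:
  assumes "herm q X X = (0 :: 'k)" and "u \<in> wline X" and "v \<in> wline X"
  shows "herm q u v = 0"
proof -
  have "herm q (sg X) X = (0 :: 'k)"
    using herm_self_sg[of "sg X"] by simp
  with assms show ?thesis
    by (auto simp: wline_def in_vec_span_pair herm_add herm_scale herm_self_sg herm_sg_sg)
qed

lemma wline_scale:
  assumes "k \<noteq> 0"
  shows "wline (k *s X) = wline X"
proof
  show "wline (k *s X) \<subseteq> wline X"
    unfolding wline_def by (rule vec_span_pair_subset) (simp_all add: vec.span_base vec.span_scale)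
  have *: "Y \<in> vec.span {k *s X, k ^ q *s sg X}" if "c *s Y \<in> {k *s X, k ^ q *s sg X}" "c \<noteq> 0" for Y c
  proof -
    have "Y = inverse c *s (c *s Y)"
      using that by simp
    then show ?thesis
      using that(1) vec.span_base vec.span_scale by metis
  qed
  show "wline X \<subseteq> wline (k *s X)"
    unfolding wline_def sg_scale
    by (rule vec_span_pair_subset) (use assms in \<open>auto intro: *[of k] *[of "k ^ q"]\<close>)
qed

text \<open>The line is stable under \<open>sg\<close> and is spanned by fixed vectors: X can be
  recovered from X + sg X and w X + w^q sg X, because w^q differs from w.\<close>

lemma wline_in_What_lines:
  assumes h0: "herm q X X = (0 :: 'k)" and indep: "\<And>a b. a *s X + b *s sg X = 0 \<Longrightarrow> a = 0 \<and> b = 0"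
  shows "wline X \<in> What_lines q"
proof -
  let ?U = "Vhat q \<inter> wline X"
  have sub: "Vhat_subspace q ?U"
    by (auto simp: Vhat_subspace_def Vhat_eq GF_def wline_def vec.span_zero vec.span_add vec.span_scale)
  have iso: "bhat q u v = 0" if "u \<in> ?U" "v \<in> ?U" for u v
  proof -
    have "x ^ q\<^sup>2 = x" for x :: 'k
      using power_card_eq[of x] by (simp add: card_k)
    then show ?thesis
      using herm_eq_bhat[of q u v] herm_wline[OF h0] that by auto
  qed
  obtain w :: 'k where w: "w ^ q \<noteq> w"
    using ex_power_q_neq by blast
  have "X + sg X \<in> ?U"
    by (simp add: Vhat_eq add.commute wline_def vec.span_add vec.span_base)
  moreover have "w *s X + w ^ q *s sg X \<in> ?U"
    by (simp add: Vhat_eq add.commute wline_def vec.span_add vec.span_base vec.span_scale)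
  ultimately have in_span: "X + sg X \<in> vec.span ?U" "w *s X + w ^ q *s sg X \<in> vec.span ?U"
    by (simp_all only: vec.span_base)
  have "X = inverse (w ^ q + w) *s (w ^ q *s (X + sg X) - (w *s X + w ^ q *s sg X))"
  proof -
    have "w ^ q *s (X + sg X) - (w *s X + w ^ q *s sg X) = (w ^ q + w) *s X"
      by (simp add: vec_eq_iff_4 algebra_simps)
    moreover have "w ^ q + w \<noteq> 0"
      using w by simp
    ultimately show ?thesis
      by (simp only: vector_smult_assoc left_inverse vector_smult_lid not_False_eq_True)
  qed
  then have X: "X \<in> vec.span ?U"
    using in_span by (metis vec.span_diff vec.span_scale)
  then have "(X + sg X) - X \<in> vec.span ?U"
    using in_span(1) by (rule vec.span_diff[rotated])
  then have "sg X \<in> vec.span ?U"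
    by simp
  with X have "wline X \<subseteq> vec.span ?U"
    unfolding wline_def by (intro vec_span_pair_subset) auto
  moreover have "vec.span ?U \<subseteq> wline X"
    by (rule vec.span_minimal) (auto simp: wline_def)
  ultimately have "wline X \<in> What q"
    unfolding What_def using sub iso by blast
  moreover have "wline X \<in> proj_lines"
    unfolding wline_def by (rule span_pair_in_proj_lines) (rule indep)
  ultimately show ?thesis
    by (simp add: What_lines_def)
qed

text \<open>Being spanned by vectors that \<open>sg\<close> fixes, w is stable under
  \<open>sg\<close>, so it contains X and \<open>sg X\<close>; the dimensions agree.\<close>

lemma What_line_eq_wline:
  assumes "w \<in> What_lines q" and "X \<in> w"
    and indep: "\<And>a b. a *s X + b *s sg X = 0 \<Longrightarrow> a = 0 \<and> b = 0"
  shows "w = wline X"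
proof -
  obtain U where U: "w = vec.span U" "U \<subseteq> Vhat q"
    using assms(1) by (auto simp: What_lines_def What_def Vhat_subspace_def)
  have dim: "vec.dim w = 2"
    using assms(1) by (simp add: What_lines_def proj_lines_def)
  have "sg Y \<in> vec.span U" if "Y \<in> vec.span U" for Y
    using that
  proof (induction rule: vec.span_induct_alt)
    case base
    show ?case
      by (simp add: vec.span_zero)
  next
    case (step c x y)
    then have "sg x = x"
      using U(2) by (auto simp: Vhat_eq)
    with step show ?case
      by (simp add: vec.span_add vec.span_base vec.span_scale)
  qed
  then have "wline X \<subseteq> w"
    unfolding wline_def U(1) using assms(2) U(1) by (intro vec_span_pair_subset) auto
  moreover have "vec.dim (wline X) = 2"
    using span_pair_in_proj_lines[of X "sg X"] indep by (simp add: wline_def proj_lines_def)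
  ultimately show ?thesis
    using vec.subspace_dim_equal[of "wline X" w] dim by (simp add: wline_def U(1))
qed

lemma pform_add: "pform t r (X + Y) = pform t r X + pform t r Y"
  by (simp add: pform_def algebra_simps)

lemma pform_scale: "pform t r (c *s X) = \<epsilon> c * pform t r X"
  by (simp add: pform_def algebra_simps)

lemma subspace_pline: "vec.subspace (pline t r)"
proof -
  have "pform t r 0 = 0"
    by (simp add: pform_def)
  then show ?thesis
    unfolding vec.subspace_def by (simp add: pline_def pform_add pform_scale del: L.add_eq_0)
qed

end

context conjugation
begin

lemma bar_phi_eq [simp]: "bar (\<phi> x) = \<phi> y \<longleftrightarrow> bar x = y" "\<phi> x = bar (\<phi> y) \<longleftrightarrow> x = bar y"
  by (simp_all only: phi_bar[symmetric] phi_eq)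

definition hline :: "'l \<Rightarrow> ('k ^ 4) set" where
  "hline t = pline t (\<phi> t)"

text \<open>
  Over the field of order \<open>q ^ 4\<close> the vector \<open>pt s c\<close> is the trace of \<open>c (1, s') \<otimes> (1, s)\<close> where
  \<^term>\<open>\<phi>\<close> maps \<open>s'\<close> to \<open>s\<close>.
\<close>

definition pt :: "'l \<Rightarrow> 'l \<Rightarrow> 'k ^ 4" where
  "pt s c = vector [down (c + bar c), down (c * bar (\<phi> s) + bar c * \<phi> s),
     down (c * s + bar c * bar s), down (c * bar (\<phi> s) * s + bar c * \<phi> s * bar s)]"

lemma eps_pt [simp]:
  "\<epsilon> (pt s c $ 1) = c + bar c"
  "\<epsilon> (pt s c $ 2) = c * bar (\<phi> s) + bar c * \<phi> s"
  "\<epsilon> (pt s c $ 3) = c * s + bar c * bar s"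
  "\<epsilon> (pt s c $ 4) = c * bar (\<phi> s) * s + bar c * \<phi> s * bar s"
  by (simp_all add: pt_def vector_4_nth add.commute)

lemma eps_power_q: "\<epsilon> x ^ q = \<phi> (\<epsilon> x)"
  by simp

lemma vec4_eq_eps: "(u :: 'k ^ 4) = v \<longleftrightarrow> \<epsilon> (u $ 1) = \<epsilon> (v $ 1) \<and> \<epsilon> (u $ 2) = \<epsilon> (v $ 2) \<and>
    \<epsilon> (u $ 3) = \<epsilon> (v $ 3) \<and> \<epsilon> (u $ 4) = \<epsilon> (v $ 4)"
  by (simp only: vec_eq_iff_4 eps_eq)

lemma pt_add: "pt s (c + d) = pt s c + pt s d"
  unfolding vec4_eq_eps by (simp add: algebra_simps)

lemma pt_scale: "pt s (\<epsilon> k * c) = k *s pt s c"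
  unfolding vec4_eq_eps by (simp add: algebra_simps)

lemma pt_eq_0:
  assumes "s \<notin> range \<epsilon>" and "pt s c = 0"
  shows "c = 0"
proof -
  have "\<epsilon> (pt s c $ 1) = 0" "\<epsilon> (pt s c $ 3) = 0"
    by (simp_all only: assms(2) zero_index eps_0)
  then have "c + bar c = 0" "c * s + bar c * bar s = 0"
    by (simp_all only: eps_pt)
  then have "bar c = c" "c * s + bar c * bar s = 0"
    by (simp_all only: L.add_eq_0)
  then have "c * (s + bar s) = 0"
    by (simp add: distrib_left del: L.add_eq_0)
  with assms(1) show ?thesis
    by simp
qed

lemma pt_inj:
  assumes "s \<notin> range \<epsilon>" and "pt s c = pt s d"
  shows "c = d"
proof -
  have "pt s (c + d) = 0"
    using assms(2) by (simp add: pt_add vec_eq_iff_4)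
  then have "c + d = 0"
    by (rule pt_eq_0[OF assms(1)])
  then show ?thesis
    by simp
qed

text \<open>\<open>pt s c\<close> is a sum of two conjugate pure tensors, and \<open>pform\<close>
  factors on each of them.\<close>

lemma pform_pt:
  "pform t (\<phi> t) (pt s c) = c * (s + t) * \<phi> (bar s + t) + bar c * (bar s + t) * \<phi> (s + t)"
  by (simp add: pform_def algebra_simps)

lemma eps_sg: "\<epsilon> (sg X $ 1) = \<phi> (\<epsilon> (X $ 1))" "\<epsilon> (sg X $ 2) = \<phi> (\<epsilon> (X $ 3))"
    "\<epsilon> (sg X $ 3) = \<phi> (\<epsilon> (X $ 2))" "\<epsilon> (sg X $ 4) = \<phi> (\<epsilon> (X $ 4))"
  by (simp_all only: sg_nth phi_eps)

lemma pform_sg_pt: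
  "pform t (\<phi> t) (sg (pt s c)) =
    \<phi> c * (s + t) * \<phi> (s + t) + bar (\<phi> c) * (bar s + t) * \<phi> (bar s + t)"
  by (simp add: pform_def eps_sg del: phi_eps sg_nth) (simp add: algebra_simps)

lemma pt_in_hline: "pt s c \<in> hline s"
  by (simp add: hline_def pline_def pform_pt)

text \<open>Coordinates 1 and 3 of \<open>pt s c\<close> are the relative traces of c and of c s,
  which determine c. After subtracting this point only coordinates 2 and 4 remain, and they satisfy
  a linear relation whose coefficient s is outside the small field.\<close>

lemma hline_eq_range_pt:
  assumes "s \<notin> range \<epsilon>"
  shows "hline s = range (pt s)"
proof (intro equalityI subsetI)
  fix X
  assume X: "X \<in> hline s"
  define c where "c = (\<epsilon> (X $ 3) + bar s * \<epsilon> (X $ 1)) / (s + bar s)"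
  have ne: "s + bar s \<noteq> 0"
    using assms by simp
  have c: "c * (s + bar s) = \<epsilon> (X $ 3) + bar s * \<epsilon> (X $ 1)"
    "bar c * (s + bar s) = \<epsilon> (X $ 3) + s * \<epsilon> (X $ 1)"
    using ne by (simp_all add: c_def add.commute del: L.add_eq_0)
  have "(c + bar c) * (s + bar s) = \<epsilon> (X $ 1) * (s + bar s)"
    using c by (simp add: distrib_right) (simp add: algebra_simps)
  then have c1: "c + bar c = \<epsilon> (X $ 1)"
    using ne by (simp only: mult_cancel_right simp_thms)
  have c3: "c * s + bar c * bar s = \<epsilon> (X $ 3)"
  proof -
    have "c * s + bar c * bar s = c * (s + bar s) + bar s * (c + bar c)"
      by (simp add: algebra_simps)
    also have "\<dots> = \<epsilon> (X $ 3)"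
      by (simp only: c c1) (simp add: add.assoc)
    finally show ?thesis .
  qed
  define Y where "Y = X + pt s c"
  have Y13: "Y $ 1 = 0" "Y $ 3 = 0"
  proof -
    have "\<epsilon> (Y $ 1) = 0" "\<epsilon> (Y $ 3) = 0"
      by (simp_all only: Y_def vector_add_component eps_add eps_pt c1 c3 L.add_self)
    then show "Y $ 1 = 0" "Y $ 3 = 0"
      by (simp_all only: eps_eq_0)
  qed
  have "pform s (\<phi> s) Y = 0"
    using X pt_in_hline[of s c] by (simp only: Y_def pform_add hline_def pline_def mem_Collect_eq add_0)
  then have eq: "\<epsilon> (Y $ 4) + s * \<epsilon> (Y $ 2) = 0"
    by (simp add: pform_def Y13 del: L.add_eq_0)
  have "Y $ 2 = 0"
  proof (rule ccontr)
    assume "Y $ 2 \<noteq> 0"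
    with eq have "s = \<epsilon> (Y $ 4 / Y $ 2)"
      by (simp add: field_simps)
    with assms show False
      by blast
  qed
  with eq have "Y $ 4 = 0"
    by simp
  with \<open>Y $ 2 = 0\<close> Y13 have "X = pt s c"
    by (simp add: Y_def vec_eq_iff_4)
  then show "X \<in> range (pt s)"
    by blast
qed (auto simp: pt_in_hline)

lemma subspace_hline: "vec.subspace (hline t)"
  by (simp add: hline_def subspace_pline)

lemma hline_bar: "hline (bar t) = hline t"
proof -
  have "hline t \<subseteq> hline (bar t)" for t
  proof
    fix X
    assume "X \<in> hline t"
    then have "bar (pform t (\<phi> t) X) = 0"
      by (simp add: hline_def pline_def)
    then show "X \<in> hline (bar t)"
      by (simp add: hline_def pline_def pform_def del: L.add_eq_0)
  qed
  from this[of t] this[of "bar t"] show ?thesis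
    by simp
qed

lemma herm_pt: "herm q (pt s c) (pt s d) = 0"
proof -
  have "\<epsilon> (herm q (pt s c) (pt s d)) = 0"
    \<comment> \<open>Writing each q-th power as an application of \<open>\<phi>\<close> before
      expanding lets the terms cancel for every admissible \<open>\<phi>\<close>.\<close>
    unfolding herm_def eps_add eps_mult eps_power eps_power_q unfolding eps_pt by (simp add: algebra_simps)
  then show ?thesis
    by (simp only: eps_eq_0)
qed

text \<open>At t = s one term of \<open>pform_sg_pt\<close> vanishes and the other is a nonzero
  multiple of \<open>bar (\<phi> c)\<close>.\<close>

lemma sg_notin_hline:
  assumes "s \<notin> range \<epsilon>" and "X \<in> hline s" and "sg X \<in> hline s"
  shows "X = 0"
proof -
  obtain c where X: "X = pt s c"
    using assms(1,2) hline_eq_range_pt by auto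
  have "pform s (\<phi> s) (sg (pt s c)) = 0"
    using assms(3) by (simp add: X hline_def pline_def)
  then have "c = 0"
    using assms(1) unfolding pform_sg_pt by simp
  then show ?thesis
    using pt_scale[of s 0 0] by (simp add: X)
qed

lemma sg_independent:
  assumes "s \<notin> range \<epsilon>" and "X \<in> hline s" and "X \<noteq> 0" and "a *s X + b *s sg X \<in> hline s"
  shows "b = 0"
proof (rule ccontr)
  assume "b \<noteq> 0"
  have "(a *s X + b *s sg X) - a *s X \<in> hline s"
    by (intro vec.subspace_diff vec.subspace_scale subspace_hline assms)
  then have "b *s sg X \<in> hline s"
    by simp
  then have "inverse b *s (b *s sg X) \<in> hline s"
    by (rule vec.subspace_scale[OF subspace_hline])
  moreover have "inverse b *s (b *s sg X) = sg X"
    using \<open>b \<noteq> 0\<close> by (simp only: vector_smult_assoc left_inverse vector_smult_lid not_False_eq_True)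
  ultimately have "sg X \<in> hline s"
    by (simp only:)
  then show False
    using sg_notin_hline assms by blast
qed

lemma sg_independent':
  assumes "s \<notin> range \<epsilon>" and "X \<in> hline s" and "X \<noteq> 0" and "a *s X + b *s sg X = 0"
  shows "a = 0 \<and> b = 0"
proof -
  have "b = 0"
    by (rule sg_independent[OF assms(1-3), of a]) (simp add: assms(4) vec.subspace_0 subspace_hline)
  with assms(3,4) show ?thesis
    by simp
qed

lemma wline_pt_in_What_lines:
  assumes "s \<notin> range \<epsilon>" and "c \<noteq> 0"
  shows "wline (pt s c) \<in> What_lines q"
  using assms pt_eq_0 by (intro wline_in_What_lines herm_pt sg_independent'[OF _ pt_in_hline]) auto

lemma meeting_lines_hline:
  assumes "s \<notin> range \<epsilon>"
  shows "meeting_lines q (hline s) = {wline (pt s c) | c. c \<noteq> 0}"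
proof (intro equalityI subsetI)
  fix w
  assume "w \<in> meeting_lines q (hline s)"
  then have w: "w \<in> What_lines q" "proj_points w \<inter> proj_points (hline s) \<noteq> {}"
    by (auto simp: meeting_lines_def)
  have "vec.subspace w"
    using w(1) by (simp add: What_lines_def proj_lines_def)
  with w(2) obtain X where X: "X \<in> w" "X \<in> hline s" "X \<noteq> 0"
    by (auto simp: proj_points_disjoint_iff subspace_hline)
  then have "w = wline X"
    using What_line_eq_wline[OF w(1)] sg_independent'[OF assms] by blast
  moreover obtain c where "X = pt s c"
    using X(2) hline_eq_range_pt[OF assms] by auto
  moreover have "c \<noteq> 0"
    using \<open>X = pt s c\<close> X(3) pt_scale[of s 0 0] by auto
  ultimately show "w \<in> {wline (pt s c) | c. c \<noteq> 0}"
    by blast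
next
  fix w
  assume "w \<in> {wline (pt s c) | c. c \<noteq> 0}"
  then obtain c where c: "w = wline (pt s c)" "c \<noteq> 0"
    by blast
  have "pt s c \<in> w \<inter> hline s" "pt s c \<noteq> 0"
    using c pt_eq_0[OF assms] pt_in_hline by (auto simp: wline_def vec.span_base)
  then have "proj_points w \<inter> proj_points (hline s) \<noteq> {}"
    using c(1) by (subst proj_points_disjoint_iff) (auto simp: subspace_hline wline_def)
  then show "w \<in> meeting_lines q (hline s)"
    using wline_pt_in_What_lines[OF assms c(2)] by (simp add: meeting_lines_def c(1))
qed

lemma wline_pt_eqD:
  assumes "s \<notin> range \<epsilon>" and "c \<noteq> 0" and "wline (pt s c) = wline (pt s d)"
  obtains k where "d = \<epsilon> k * c"
proof -
  have "pt s d \<in> wline (pt s c)"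
    unfolding assms(3) by (simp add: wline_def vec.span_base)
  then obtain a b where ab: "pt s d = a *s pt s c + b *s sg (pt s c)"
    by (auto simp: wline_def in_vec_span_pair)
  have "b = 0"
    by (rule sg_independent[OF assms(1) pt_in_hline[of s c], of a])
      (use assms(1,2) pt_eq_0 ab[symmetric] pt_in_hline in auto)
  with ab have "pt s d = pt s (\<epsilon> a * c)"
    by (simp add: pt_scale)
  then have "d = \<epsilon> a * c"
    by (rule pt_inj[OF assms(1)])
  then show ?thesis
    by (rule that)
qed

end

section \<open>The Penttila--Williford relations\<close>

lemma proj_points_Int: "proj_points l \<inter> proj_points m = proj_points (l \<inter> m)"
  by (auto simp: proj_points_def)

lemma proj_points_span_singleton:
  assumes "v \<noteq> 0"
  shows "proj_points (vec.span {v :: 'a::field ^ 'n}) = {vec.span {v}}"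
  using assms by (auto simp: proj_points_eq vec_span_singleton_eq intro: vec.span_base)

context conjugation
begin

text \<open>The multiplier for which the determinant in \<open>wline_meets_hline_iff\<close> is an
  \<open>hform\<close>. Its first two factors arise from a bar(a) + d bar(d) with a = s + t and d =
  bar(s) + t, simplified by \<open>sum_products\<close>.\<close>

definition meet_coeff :: "'l \<Rightarrow> 'l \<Rightarrow> 'l" where
  "meet_coeff s t = (s + bar s) * (t + bar t) * bar (\<phi> (s + t)) * \<phi> (bar s + t)"

text \<open>\<open>cross s t\<close> lies in the small field, where every admissible
  \<open>\<phi>\<close> is the q-th power; this is why the same \<open>tau\<close> serves both
  families.\<close>

lemma phi_cross: "\<phi> (cross s t) = cross s t ^ q"
proof -
  obtain x where "cross s t = \<epsilon> x"
    by (rule bar_eq_selfE[OF bar_cross])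
  then show ?thesis
    by simp
qed

lemma tau_eq: "tau s t = cross s t + \<phi> (cross s t)"
  by (simp add: tau_def phi_cross)

lemma norms_eq:
  assumes "s \<notin> range \<epsilon>" and "t \<notin> range \<epsilon>"
  defines "e \<equiv> (s + bar s) * (t + bar t)"
  shows "e \<noteq> 0" and "(bar s + t) * (s + bar t) = e * cross s t"
    and "(s + t) * (bar s + bar t) = e * (cross s t + 1)"
proof -
  show e: "e \<noteq> 0"
    using assms by (simp add: e_def)
  show R: "(bar s + t) * (s + bar t) = e * cross s t"
    using e by (simp add: cross_def e_def)
  have "(s + t) * (bar s + bar t) + (bar s + t) * (s + bar t) = e"
    by (simp only: sum_products e_def)
  then have "(s + t) * (bar s + bar t) = e + e * cross s t"
    by (metis R L.add_self_left add.commute)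
  then show "(s + t) * (bar s + bar t) = e * (cross s t + 1)"
    by (simp only: distrib_left mult_1_right add.commute)
qed

lemma pt_in_hline_iff:
  "pt s c \<in> hline t \<longleftrightarrow> c * ((s + t) * \<phi> (bar s + t)) = bar c * ((bar s + t) * \<phi> (s + t))"
  by (simp add: hline_def pline_def pform_pt mult.assoc)

text \<open>With x = \<open>cross s t\<close>, the two norms are e \<phi>(e) (x + 1) \<phi>(x) and e
  \<phi>(e) x (\<phi>(x) + 1) by \<open>norms_eq\<close>, so they differ by e \<phi>(e) tau.\<close>

lemma tau_eq_0_iff:
  assumes "s \<notin> range \<epsilon>" and "t \<notin> range \<epsilon>"
  shows "tau s t = 0 \<longleftrightarrow>
    ((s + t) * \<phi> (bar s + t)) * bar ((s + t) * \<phi> (bar s + t)) =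
    ((bar s + t) * \<phi> (s + t)) * bar ((bar s + t) * \<phi> (s + t))"
proof -
  define e x where "e = (s + bar s) * (t + bar t)" and "x = cross s t"
  note n = norms_eq[OF assms, folded e_def x_def]
  have "((s + t) * \<phi> (bar s + t)) * bar ((s + t) * \<phi> (bar s + t)) =
      ((s + t) * (bar s + bar t)) * \<phi> ((bar s + t) * (s + bar t))"
    by (simp add: mult_ac)
  also have "\<dots> = e * \<phi> e * ((x + 1) * \<phi> x)"
    by (simp only: n) simp
  finally have 1: "((s + t) * \<phi> (bar s + t)) * bar ((s + t) * \<phi> (bar s + t)) = e * \<phi> e * ((x + 1) * \<phi> x)" .
  have "((bar s + t) * \<phi> (s + t)) * bar ((bar s + t) * \<phi> (s + t)) =
      ((bar s + t) * (s + bar t)) * \<phi> ((s + t) * (bar s + bar t))"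
    by (simp add: mult_ac)
  also have "\<dots> = e * \<phi> e * (x * (\<phi> x + 1))"
    by (simp only: n) simp
  finally have 2: "((bar s + t) * \<phi> (s + t)) * bar ((bar s + t) * \<phi> (s + t)) = e * \<phi> e * (x * (\<phi> x + 1))" .
  have "tau s t = 0 \<longleftrightarrow> x = \<phi> x"
    by (simp add: tau_eq x_def)
  also have "\<dots> \<longleftrightarrow> (x + 1) * \<phi> x = x * (\<phi> x + 1)"
    by (auto simp: algebra_simps)
  also have "\<dots> \<longleftrightarrow> e * \<phi> e * ((x + 1) * \<phi> x) = e * \<phi> e * (x * (\<phi> x + 1))"
    using n(1) by (simp only: mult_cancel_left mult_eq_0_iff phi_eq_0 simp_thms)
  finally show ?thesis
    by (simp only: 1 2)
qed

text \<open>\<open>pt s c\<close> lies on the second line iff c P = bar(c) R, and by Hilbert 90 this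
  has a nonzero solution exactly when P and R have the same norm.\<close>

lemma hline_Int_subset_iff:
  assumes "s \<notin> range \<epsilon>" and "t \<notin> range \<epsilon>" and "s \<noteq> t" and "s \<noteq> bar t"
  shows "hline s \<inter> hline t \<subseteq> {0} \<longleftrightarrow> tau s t \<noteq> 0"
proof -
  define P R where "P = (s + t) * \<phi> (bar s + t)" and "R = (bar s + t) * \<phi> (s + t)"
  have "bar s \<noteq> t"
    using assms(4) by auto
  with assms have ne: "R \<noteq> 0"
    by (simp add: R_def)
  have mem: "pt s c \<in> hline t \<longleftrightarrow> c * P = bar c * R" for c
    by (simp only: pt_in_hline_iff P_def R_def)
  have tau: "tau s t = 0 \<longleftrightarrow> P * bar P = R * bar R"
    unfolding P_def R_def by (rule tau_eq_0_iff) fact+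
  show ?thesis
  proof
    assume "hline s \<inter> hline t \<subseteq> {0}"
    then have triv: "c = 0" if "c * P = bar c * R" for c
      using that mem[of c] pt_in_hline[of s c] pt_eq_0[OF assms(1), of c] by blast
    show "tau s t \<noteq> 0"
    proof
      assume "tau s t = 0"
      then have eq: "P * bar P = R * bar R"
        by (simp only: tau)
      \<comment> \<open>The Hilbert 90 solution is \<open>R + bar P\<close>; should it vanish, then
        R itself is a solution.\<close>
      have "(R + bar P) * P = bar (R + bar P) * R"
        using eq by (simp add: algebra_simps)
      then have "R + bar P = 0"
        by (rule triv)
      then have "bar R = P"
        by (metis L.add_eq_0 bar_bar)
      then have "R * P = bar R * R"
        by (simp add: mult.commute)
      then have "R = 0"
        by (rule triv)
      with ne show False ..
    qed
  next
    assume nz: "tau s t \<noteq> 0"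
    show "hline s \<inter> hline t \<subseteq> {0}"
    proof
      fix X
      assume "X \<in> hline s \<inter> hline t"
      then obtain c where X: "X = pt s c" "c * P = bar c * R"
        using hline_eq_range_pt[OF assms(1)] mem by auto
      have "(c * P) * bar (c * P) = (bar c * R) * bar (bar c * R)"
        by (simp only: X(2))
      then have "(c * bar c) * (P * bar P) = (c * bar c) * (R * bar R)"
        by (simp add: mult_ac)
      with nz tau have "c = 0"
        by auto
      then show "X \<in> {0}"
        using pt_scale[of s 0 0] by (simp add: X(1))
    qed
  qed
qed

lemma bar_mult_commute_ratio:
  assumes "c \<noteq> 0" and "d * bar c = bar d * c"
  obtains k where "d = \<epsilon> k * c"
proof -
  have "bar (d / c) = d / c"
    using assms by (simp add: frac_eq_eq)
  then obtain k where "d / c = \<epsilon> k"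
    by (rule bar_eq_selfE)
  with assms(1) show ?thesis
    by (intro that[of k]) (simp add: field_simps)
qed

text \<open>Two nonzero solutions of c P = bar(c) R have a ratio fixed by \<open>bar\<close>, so
  they give the same projective point.\<close>

lemma hline_Int_eq_span:
  assumes "s \<notin> range \<epsilon>" and "s \<noteq> t" and "s \<noteq> bar t" and X: "X \<in> hline s \<inter> hline t" "X \<noteq> 0"
  shows "hline s \<inter> hline t = vec.span {X}"
proof
  define P R where "P = (s + t) * \<phi> (bar s + t)" and "R = (bar s + t) * \<phi> (s + t)"
  have "bar s \<noteq> t"
    using assms(3) by auto
  with assms have ne: "R \<noteq> 0"
    by (simp add: R_def)
  have mem: "pt s c \<in> hline t \<longleftrightarrow> c * P = bar c * R" for c
    by (simp only: pt_in_hline_iff P_def R_def)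
  obtain c where c: "X = pt s c" "c * P = bar c * R"
    using X hline_eq_range_pt[OF assms(1)] mem by auto
  have "c \<noteq> 0"
    using X(2) c(1) pt_scale[of s 0 0] by auto
  show "hline s \<inter> hline t \<subseteq> vec.span {X}"
  proof
    fix Y
    assume "Y \<in> hline s \<inter> hline t"
    then obtain d where d: "Y = pt s d" "d * P = bar d * R"
      using hline_eq_range_pt[OF assms(1)] mem by auto
    have "d * (c * P) = c * (d * P)"
      by (simp add: mult_ac)
    then have "(d * bar c) * R = (bar d * c) * R"
      by (simp only: c(2) d(2)) (simp add: mult_ac)
    with ne have "d * bar c = bar d * c"
      by simp
    with \<open>c \<noteq> 0\<close> obtain k where "d = \<epsilon> k * c"
      by (rule bar_mult_commute_ratio)
    then show "Y \<in> vec.span {X}"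
      by (simp add: d(1) c(1) pt_scale vec.span_base vec.span_scale)
  qed
  show "vec.span {X} \<subseteq> hline s \<inter> hline t"
    using X(1) by (simp add: vec_span_singleton_subset subspace_hline)
qed

lemma hline_eq_iff:
  assumes "s \<notin> range \<epsilon>"
  shows "hline s = hline t \<longleftrightarrow> s = t \<or> s = bar t"
proof
  assume eq: "hline s = hline t"
  show "s = t \<or> s = bar t"
  proof (rule ccontr)
    assume "\<not> ?thesis"
    then have ne: "s \<noteq> t" "bar s \<noteq> t"
      by auto
    define P R where "P = (s + t) * \<phi> (bar s + t)" and "R = (bar s + t) * \<phi> (s + t)"
    have all: "c * P = bar c * R" for c
      using pt_in_hline[of s c] by (simp only: eq pt_in_hline_iff P_def R_def)
    have "P = R"
      using all[of 1] by simp
    moreover have "R \<noteq> 0"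
      using ne by (simp add: R_def)
    ultimately have "bar s = s"
      using all[of s] by simp
    with assms show False
      by simp
  qed
qed (auto simp: hline_bar)

text \<open>The lines meet iff some nontrivial a X + b sg X is killed by the functional of the
  second line, that is, iff its values U at X and W at \<open>sg X\<close> are dependent over the
  small field; this is the vanishing of U bar(W) + bar(U) W.\<close>

lemma wline_meets_hline_iff:
  assumes "s \<notin> range \<epsilon>" and "t \<notin> range \<epsilon>" and "c \<noteq> 0"
  shows "wline (pt s c) \<in> meeting_lines q (hline t) \<longleftrightarrow> hform (meet_coeff s t) c c = 0"
proof -
  define X where "X = pt s c"
  define U W where "U = pform t (\<phi> t) X" and "W = pform t (\<phi> t) (sg X)"
  have "X \<noteq> 0"
    using pt_eq_0[OF assms(1)] assms(3) by (auto simp: X_def)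
  note indep = sg_independent'[OF assms(1) pt_in_hline[of s c], folded X_def, OF \<open>X \<noteq> 0\<close>]
  have "wline X \<in> meeting_lines q (hline t) \<longleftrightarrow> \<not> wline X \<inter> hline t \<subseteq> {0}"
    using wline_pt_in_What_lines[OF assms(1,3)]
    by (simp add: meeting_lines_def X_def[symmetric] proj_points_disjoint_iff subspace_hline wline_def)
  also have "\<dots> \<longleftrightarrow> (\<exists>a b. (a \<noteq> 0 \<or> b \<noteq> 0) \<and> \<epsilon> a * U + \<epsilon> b * W = 0)"
  proof
    assume "\<not> wline X \<inter> hline t \<subseteq> {0}"
    then obtain Y where Y: "Y \<in> wline X" "Y \<in> hline t" "Y \<noteq> 0"
      by blast
    then obtain a b where "Y = a *s X + b *s sg X"
      by (auto simp: wline_def in_vec_span_pair)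
    with Y have ab: "a *s X + b *s sg X \<in> hline t" "a *s X + b *s sg X \<noteq> 0"
      by simp_all
    then have "\<epsilon> a * U + \<epsilon> b * W = 0"
      by (simp only: hline_def pline_def mem_Collect_eq pform_add pform_scale U_def W_def)
    moreover have "a \<noteq> 0 \<or> b \<noteq> 0"
      using ab(2) by auto
    ultimately show "\<exists>a b. (a \<noteq> 0 \<or> b \<noteq> 0) \<and> \<epsilon> a * U + \<epsilon> b * W = 0"
      by blast
  next
    assume "\<exists>a b. (a \<noteq> 0 \<or> b \<noteq> 0) \<and> \<epsilon> a * U + \<epsilon> b * W = 0"
    then obtain a b where ab: "a \<noteq> 0 \<or> b \<noteq> 0" "\<epsilon> a * U + \<epsilon> b * W = 0"
      by blast
    have "a *s X + b *s sg X \<in> hline t"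
      using ab(2) by (simp only: hline_def pline_def mem_Collect_eq pform_add pform_scale U_def W_def)
    moreover have "a *s X + b *s sg X \<in> wline X"
      by (auto simp: wline_def in_vec_span_pair)
    moreover have "a *s X + b *s sg X \<noteq> 0"
      using ab(1) indep by blast
    ultimately show "\<not> wline X \<inter> hline t \<subseteq> {0}"
      by blast
  qed
  also have "\<dots> \<longleftrightarrow> U * bar W + bar U * W = 0"
  proof
    assume "\<exists>a b. (a \<noteq> 0 \<or> b \<noteq> 0) \<and> \<epsilon> a * U + \<epsilon> b * W = 0"
    then obtain a b where ab: "a \<noteq> 0 \<or> b \<noteq> 0" "\<epsilon> a * U = \<epsilon> b * W"
      by auto
    have "bar (\<epsilon> a * U) = bar (\<epsilon> b * W)"
      by (simp only: ab(2))
    then have ab': "\<epsilon> a * bar U = \<epsilon> b * bar W"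
      by simp
    have "\<epsilon> a * (U * bar W + bar U * W) = (\<epsilon> a * U) * bar W + (\<epsilon> a * bar U) * W"
      by (simp add: algebra_simps)
    also have "\<dots> = 0"
      by (simp only: ab ab') (simp add: mult_ac)
    finally have a: "\<epsilon> a * (U * bar W + bar U * W) = 0" .
    have "\<epsilon> b * (U * bar W + bar U * W) = U * (\<epsilon> b * bar W) + bar U * (\<epsilon> b * W)"
      by (simp add: algebra_simps)
    also have "\<dots> = 0"
      by (simp only: ab(2)[symmetric] ab'[symmetric]) (simp add: mult_ac)
    finally have "\<epsilon> b * (U * bar W + bar U * W) = 0" .
    with a ab(1) show "U * bar W + bar U * W = 0"
      by (simp only: mult_eq_0_iff eps_eq_0) blast
  next
    assume UW: "U * bar W + bar U * W = 0"
    show "\<exists>a b. (a \<noteq> 0 \<or> b \<noteq> 0) \<and> \<epsilon> a * U + \<epsilon> b * W = 0"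
    proof (cases "W = 0")
      case True
      then show ?thesis
        by (intro exI[of _ 0] exI[of _ 1]) simp
    next
      case False
      with UW obtain k where "U = \<epsilon> k * W"
        by (metis L.add_eq_0 bar_mult_commute_ratio)
      then show ?thesis
        by (intro exI[of _ 1] exI[of _ k]) simp
    qed
  qed
  also have "U * bar W + bar U * W = hform (meet_coeff s t) c c"
  proof -
    \<comment> \<open>Here a and d stand for s + t and bar(s) + t, the factors occurring in
      \<open>pform_pt\<close> and \<open>pform_sg_pt\<close>.\<close>
    have id: "(c * a * \<phi> d + bar c * d * \<phi> a) * bar (\<phi> c * a * \<phi> a + bar (\<phi> c) * d * \<phi> d) +
        bar (c * a * \<phi> d + bar c * d * \<phi> a) * (\<phi> c * a * \<phi> a + bar (\<phi> c) * d * \<phi> d) =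
        hform ((a * bar a + d * bar d) * bar (\<phi> a) * \<phi> d) c c" for a d
      by (simp add: hform_def algebra_simps)
    have "meet_coeff s t = ((s + t) * bar (s + t) + (bar s + t) * bar (bar s + t)) * bar (\<phi> (s + t)) * \<phi> (bar s + t)"
      using sum_products[of s t] by (simp add: meet_coeff_def)
    then show ?thesis
      by (simp only: U_def W_def X_def pform_pt pform_sg_pt id)
  qed
  finally show ?thesis
    by (simp only: X_def)
qed

text \<open>With x = \<open>cross s t\<close>, the norm of the multiplier is (e \<phi>(e))^2
  (\<phi>(x)^2 + \<phi>(x)), and e \<phi>(e) is fixed by \<open>\<phi>\<close>; adding the image
  under \<open>\<phi>\<close> leaves the factor tau (tau + 1).\<close>

lemma meet_coeff_discriminant:
  assumes "s \<notin> range \<epsilon>" and "t \<notin> range \<epsilon>"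
  shows "\<phi> (meet_coeff s t * bar (meet_coeff s t)) + meet_coeff s t * bar (meet_coeff s t) = 0 \<longleftrightarrow> tau s t = 0 \<or> tau s t = 1"
proof -
  define e x where "e = (s + bar s) * (t + bar t)" and "x = cross s t"
  note n = norms_eq[OF assms, folded e_def x_def]
  have x: "bar x = x" and e: "bar e = e"
    by (simp_all add: x_def e_def add.commute)
  have "meet_coeff s t * bar (meet_coeff s t) = (e * bar e) * \<phi> (((s + t) * (bar s + bar t)) * ((bar s + t) * (s + bar t)))"
    unfolding meet_coeff_def e_def[symmetric] by (simp add: mult_ac)
  also have "\<dots> = (e * \<phi> e)\<^sup>2 * ((\<phi> x)\<^sup>2 + \<phi> x)"
    by (simp only: n) (simp add: e power2_eq_square algebra_simps)
  finally have m: "meet_coeff s t * bar (meet_coeff s t) = (e * \<phi> e)\<^sup>2 * ((\<phi> x)\<^sup>2 + \<phi> x)" .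
  have "\<phi> (meet_coeff s t * bar (meet_coeff s t)) + meet_coeff s t * bar (meet_coeff s t) = (e * \<phi> e)\<^sup>2 * (tau s t * (tau s t + 1))"
    unfolding m tau_eq x_def[symmetric] by (simp add: e x power2_eq_square algebra_simps)
  then show ?thesis
    using n(1) by (simp add: del: L.add_eq_0) simp
qed

text \<open>Common lines are the zeros of the form among the c modulo scalars. Since
  \<open>c\<^sub>0\<close> is not a zero, each has a unique representative
  \<open>\<epsilon> y * c\<^sub>0 + g\<close>. The count is 1 for tau = 0 as well as for tau = 1;
  only disjointness separates these cases.\<close>

lemma card_meeting_lines_Int:
  assumes "s \<notin> range \<epsilon>" and "t \<notin> range \<epsilon>" and "s \<noteq> t" and "s \<noteq> bar t"
  shows "card (meeting_lines q (hline s) \<inter> meeting_lines q (hline t)) =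
    (if tau s t = 0 \<or> tau s t = 1 then 1 else q + 1)"
proof -
  let ?m = "meet_coeff s t"
  have "bar s \<noteq> t"
    using assms(4) by auto
  with assms have "?m \<noteq> 0"
    by (simp add: meet_coeff_def)
  then obtain c\<^sub>0 where c0: "hform ?m c\<^sub>0 c\<^sub>0 \<noteq> 0"
    using ex_hform_neq_0 by blast
  have "c\<^sub>0 \<noteq> 0"
    using c0 by (auto simp: hform_def)
  obtain w where w: "w \<notin> range \<epsilon>"
    using ex_not_range by blast
  define g where "g = w * c\<^sub>0"
  have g: "g / c\<^sub>0 \<notin> range \<epsilon>"
    using w \<open>c\<^sub>0 \<noteq> 0\<close> by (simp add: g_def)
  let ?c = "\<lambda>y. \<epsilon> y * c\<^sub>0 + g"
  let ?Y = "{y. hform ?m (?c y) (?c y) = 0}"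
  have nz: "?c y \<noteq> 0" for y
  proof
    assume "?c y = 0"
    then have "\<epsilon> y * c\<^sub>0 = w * c\<^sub>0"
      by (simp add: g_def)
    with w \<open>c\<^sub>0 \<noteq> 0\<close> show False
      by auto
  qed
  have "meeting_lines q (hline s) \<inter> meeting_lines q (hline t) = (\<lambda>y. wline (pt s (?c y))) ` ?Y"
  proof (intro equalityI subsetI)
    fix l
    assume "l \<in> meeting_lines q (hline s) \<inter> meeting_lines q (hline t)"
    then obtain c where c: "l = wline (pt s c)" "c \<noteq> 0" "hform ?m c c = 0"
      using wline_meets_hline_iff[OF assms(1,2)] by (auto simp: meeting_lines_hline[OF assms(1)])
    obtain y z where yz: "c = \<epsilon> y * c\<^sub>0 + \<epsilon> z * g"
      using ex_coordinates[OF \<open>c\<^sub>0 \<noteq> 0\<close> g] by blast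
    have "z \<noteq> 0"
    proof
      assume "z = 0"
      then have c': "c = \<epsilon> y * c\<^sub>0"
        by (simp add: yz)
      with c(2) have "y \<noteq> 0"
        by auto
      then have "hform ?m c c \<noteq> 0"
        using c0 by (simp add: c' hform_scale)
      with c(3) show False
        by simp
    qed
    define k where "k = y / z"
    have ck: "c = \<epsilon> z * ?c k"
      using \<open>z \<noteq> 0\<close> by (simp add: yz k_def distrib_left)
    then have "l = wline (pt s (?c k))"
      using \<open>z \<noteq> 0\<close> by (simp only: c(1) ck pt_scale wline_scale not_False_eq_True)
    moreover have "hform ?m (?c k) (?c k) = 0"
    proof -
      have "hform ?m c c = \<epsilon> z * (\<epsilon> (z ^ q) * hform ?m (?c k) (?c k))"
        unfolding ck by (simp only: hform_scale mult_ac)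
      with c(3) \<open>z \<noteq> 0\<close> show ?thesis
        by (simp only: mult_eq_0_iff eps_eq_0 power_eq_0_iff) blast
    qed
    ultimately show "l \<in> (\<lambda>y. wline (pt s (?c y))) ` ?Y"
      by blast
  next
    fix l
    assume "l \<in> (\<lambda>y. wline (pt s (?c y))) ` ?Y"
    then show "l \<in> meeting_lines q (hline s) \<inter> meeting_lines q (hline t)"
      using nz wline_meets_hline_iff[OF assms(1,2)] by (auto simp: meeting_lines_hline[OF assms(1)])
  qed
  moreover have "inj_on (\<lambda>y. wline (pt s (?c y))) ?Y"
  proof (rule inj_onI)
    fix y z
    assume "wline (pt s (?c y)) = wline (pt s (?c z))"
    then obtain k where k: "?c z = \<epsilon> k * ?c y"
      by (rule wline_pt_eqD[OF assms(1) nz])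
    have "c\<^sub>0 * (\<epsilon> z + w) = c\<^sub>0 * (\<epsilon> (k * y) + \<epsilon> k * w)"
      using k by (simp add: g_def algebra_simps)
    then have eq: "\<epsilon> z + w = \<epsilon> (k * y) + \<epsilon> k * w"
      using \<open>c\<^sub>0 \<noteq> 0\<close> by (simp only: mult_cancel_left simp_thms)
    have eq': "\<epsilon> z + bar w = \<epsilon> (k * y) + \<epsilon> k * bar w"
      using arg_cong[OF eq, of bar] by (simp only: bar_add bar_mult bar_eps)
    have "1 * (w + bar w) = (\<epsilon> z + w) + (\<epsilon> z + bar w)"
      by (simp add: algebra_simps)
    also have "\<dots> = \<epsilon> k * (w + bar w)"
      by (simp only: eq eq') (simp add: algebra_simps)
    finally have "1 * (w + bar w) = \<epsilon> k * (w + bar w)" .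
    then have "\<epsilon> k = 1"
      using w by (simp only: mult_cancel_right) simp
    then have "k = 1"
      by simp
    with eq show "y = z"
      by simp
  qed
  ultimately have "card (meeting_lines q (hline s) \<inter> meeting_lines q (hline t)) = card ?Y"
    by (simp only: card_image)
  then show ?thesis
    by (simp only: card_hform_zeros[OF c0 g] meet_coeff_discriminant[OF assms(1,2)])
qed

lemma pw_rel_hline_iff:
  assumes "s \<notin> range \<epsilon>" and "t \<notin> range \<epsilon>" and "s \<noteq> t" and "s \<noteq> bar t"
    and "hline s \<in> H" and "hline t \<in> H"
  shows "(hline s, hline t) \<in> pw_rel q H 1 \<longleftrightarrow> tau s t = 0"
    and "(hline s, hline t) \<in> pw_rel q H 2 \<longleftrightarrow> tau s t = 1"
    and "(hline s, hline t) \<in> pw_rel q H 3 \<longleftrightarrow> tau s t \<noteq> 0 \<and> tau s t \<noteq> 1"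
proof -
  let ?D = "proj_points (hline s) \<inter> proj_points (hline t)"
  have empty: "?D = {} \<longleftrightarrow> tau s t \<noteq> 0"
    using hline_Int_subset_iff[OF assms(1-4)] by (simp add: proj_points_disjoint_iff subspace_hline)
  have "card ?D = 1" if "tau s t = 0"
  proof -
    have "\<not> hline s \<inter> hline t \<subseteq> {0}"
      using that hline_Int_subset_iff[OF assms(1-4)] by simp
    then obtain X where X: "X \<in> hline s \<inter> hline t" "X \<noteq> 0"
      by blast
    then show ?thesis
      using hline_Int_eq_span[OF assms(1,3,4) X]
      by (simp add: proj_points_Int proj_points_span_singleton)
  qed
  moreover have "card ?D = 0" if "tau s t \<noteq> 0"
    using that empty by simp
  ultimately have card1: "card ?D = 1 \<longleftrightarrow> tau s t = 0"
    by (metis zero_neq_one)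
  note card2 = card_meeting_lines_Int[OF assms(1-4)]
  show "(hline s, hline t) \<in> pw_rel q H 1 \<longleftrightarrow> tau s t = 0"
    using assms(5,6) card1 by (simp add: pw_rel_def)
  show "(hline s, hline t) \<in> pw_rel q H 2 \<longleftrightarrow> tau s t = 1"
    using assms(5,6) empty card2 by (auto simp: pw_rel_def)
  show "(hline s, hline t) \<in> pw_rel q H 3 \<longleftrightarrow> tau s t \<noteq> 0 \<and> tau s t \<noteq> 1"
    using assms(5,6) empty card2 by (auto simp: pw_rel_def numeral_3_eq_3)
qed

end

section \<open>Lines disjoint from the symplectic subgeometry\<close>

context field_tower
begin

lemma zero_power_q [simp]: "(0 :: 'k) ^ q = 0" "(0 :: 'l) ^ q = 0"
  by (simp_all add: zero_power)

definition fam1 :: "('k ^ 4) set set" where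
  "fam1 = {pline t (t ^ q) | t. t \<notin> range \<epsilon>}"

text \<open>These are the lines \<open>hline (t ^ q)\<close> for \<open>\<phi>\<close> = x^(q^3),
  since (t^q)^(q^3) = t.\<close>

definition fam2 :: "('k ^ 4) set set" where
  "fam2 = {pline (t ^ q) t | t. t \<notin> range \<epsilon>}"

lemma power_q_in_range_iff [simp]: "t ^ q \<in> range \<epsilon> \<longleftrightarrow> t \<in> range \<epsilon>"
proof -
  interpret conjugation h q \<epsilon> "\<lambda>x. x ^ q"
    by (rule conjugation_power_q)
  show ?thesis
    by (simp only: bar_eq_self_iff[symmetric] bar_power phi_eq)
qed

text \<open>Hilbert 90 for the small field over GF(q): g + v^q g^q solves the equation for every g,
  and it cannot vanish both for g = 1 and for g = w.\<close>

lemma ex_normalizing_scalar: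
  fixes v :: 'k
  assumes "v * v ^ q = 1"
  shows "\<exists>k. k \<noteq> 0 \<and> k ^ q = v * k"
proof -
  have eq: "(g + v ^ q * g ^ q) ^ q = v * (g + v ^ q * g ^ q)" for g
  proof -
    have "v * (g + v ^ q * g ^ q) = v * g + (v * v ^ q) * g ^ q"
      by (simp only: distrib_left mult.assoc)
    also have "\<dots> = (g + v ^ q * g ^ q) ^ q"
      by (simp only: assms) (simp add: power_mult_distrib add.commute)
    finally show ?thesis ..
  qed
  obtain w :: 'k where w: "w ^ q \<noteq> w"
    using ex_power_q_neq by blast
  have "1 + v ^ q * 1 ^ q \<noteq> 0 \<or> w + v ^ q * w ^ q \<noteq> 0"
  proof (rule ccontr)
    assume "\<not> ?thesis"
    then have "v ^ q = 1" "w = v ^ q * w ^ q"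
      by auto
    with w show False
      by simp
  qed
  with eq show ?thesis
    by blast
qed

text \<open>Isotropy forces the third coordinate to vanish too, and a multiple of the last basis
  vector spans a point of the subgeometry. Hence coordinates 1 and 2 parametrize an external
  line.\<close>

lemma external_line_zero:
  assumes l: "l \<in> herm_lines q" and ext: "\<And>v. v \<in> l \<Longrightarrow> sg v = v \<Longrightarrow> v = 0"
    and X: "X \<in> l" "X $ 1 = 0" "X $ 2 = 0"
  shows "X = 0"
proof (rule ccontr)
  assume "X \<noteq> 0"
  have "herm q X X = 0"
    using l X(1) by (simp add: herm_lines_def)
  with X have X3: "X $ 3 = 0"
    by (simp add: herm_def)
  with X \<open>X \<noteq> 0\<close> have X4: "X $ 4 \<noteq> 0"
    by (simp add: vec_eq_iff_4)
  have "vec.subspace l"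
    using l by (simp add: herm_lines_def proj_lines_def)
  then have "inverse (X $ 4) *s X \<in> l"
    using X(1) by (rule vec.subspace_scale)
  moreover have "sg (inverse (X $ 4) *s X) = inverse (X $ 4) *s X"
    using X X3 X4 by (simp add: vec_eq_iff_4 power_inverse)
  ultimately have "inverse (X $ 4) *s X = 0"
    by (rule ext)
  with \<open>X \<noteq> 0\<close> X4 show False
    by simp
qed

text \<open>Both spaces contain u and w, and neither has a nonzero vector whose coordinates 1 and 2
  vanish; for the kernel this is the assumption on r.\<close>

lemma external_line_eq_pline:
  assumes l: "l \<in> herm_lines q" and ext: "\<And>v. v \<in> l \<Longrightarrow> sg v = v \<Longrightarrow> v = 0"
    and u: "u \<in> l" "u $ 1 = 0" "u $ 2 \<noteq> 0" "pform t r u = 0"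
    and w: "w \<in> l" "w $ 1 = 1" "w $ 2 = 0" "pform t r w = 0"
    and r: "r \<notin> range \<epsilon>"
  shows "l = pline t r"
proof -
  have sub: "vec.subspace l"
    using l by (simp add: herm_lines_def proj_lines_def)
  let ?Y = "\<lambda>X. X $ 1 *s w + (X $ 2 / u $ 2) *s u"
  have Y12: "(X - ?Y X) $ 1 = 0" "(X - ?Y X) $ 2 = 0" for X
    using u w by simp_all
  have Y: "?Y X \<in> l" "?Y X \<in> pline t r" for X
    by (intro vec.subspace_add vec.subspace_scale sub subspace_pline; use u w in \<open>simp add: pline_def\<close>)+
  have zero: "X = 0" if "X \<in> l" "X $ 1 = 0" "X $ 2 = 0" for X
    using l ext that by (rule external_line_zero)
  show ?thesis
  proof (intro equalityI subsetI)
    fix X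
    assume "X \<in> l"
    then have "X - ?Y X \<in> l"
      by (intro vec.subspace_diff sub Y)
    then have "X - ?Y X = 0"
      by (rule zero) (rule Y12)+
    then have "X = ?Y X"
      by (simp only: right_minus_eq)
    then show "X \<in> pline t r"
      using Y(2) by metis
  next
    fix X
    assume "X \<in> pline t r"
    then have "X - ?Y X \<in> pline t r"
      by (intro vec.subspace_diff subspace_pline Y)
    then have eq: "\<epsilon> ((X - ?Y X) $ 4) = r * \<epsilon> ((X - ?Y X) $ 3)"
      by (simp only: pline_def pform_def mem_Collect_eq Y12 eps_0 mult_zero_right add_0_right L.add_eq_0)
    have Y3: "(X - ?Y X) $ 3 = 0"
    proof (rule ccontr)
      assume "(X - ?Y X) $ 3 \<noteq> 0"
      with eq have "r = \<epsilon> ((X - ?Y X) $ 4 / (X - ?Y X) $ 3)"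
        by (simp only: eps_divide nonzero_eq_divide_eq eps_eq_0 not_False_eq_True)
      with r show False
        by blast
    qed
    with eq have "(X - ?Y X) $ 4 = 0"
      by (simp only: eps_0 mult_zero_right eps_eq_0)
    with Y12 Y3 have "X - ?Y X = 0"
      by (simp only: vec_eq_iff_4 zero_index)
    then have "X = ?Y X"
      by (simp only: right_minus_eq)
    then show "X \<in> l"
      using Y(1) by metis
  qed
qed

text \<open>The line has a basis w = (1, 0, w3, w4), u = (0, \<xi>, \<xi>^q, \<zeta>), with u
  normalized by Hilbert 90. For \<open>pform t r\<close> to kill both, T = r \<xi>^q must satisfy t
  \<xi> = T + \<zeta> and T^2 + (\<zeta> + \<zeta>^q) T + c = 0 with c = w4 \<xi>^(q + 1). A root T
  is taken, and it remains to see that one of t, r is the q-th power of the other.\<close>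

lemma external_lines_subset: "external_lines q \<subseteq> fam1 \<union> fam2"
proof
  fix l :: "('k ^ 4) set"
  assume "l \<in> external_lines q"
  then have l: "l \<in> herm_lines q" and disj: "proj_points l \<inter> What_points q = {}"
    by (auto simp: external_lines_def)
  have line: "l \<in> proj_lines"
    using l by (simp add: herm_lines_def)
  have sub: "vec.subspace l"
    using line by (simp add: proj_lines_def)
  have ext: "v = 0" if "v \<in> l" "sg v = v" for v
  proof (rule ccontr)
    assume "v \<noteq> 0"
    with that have "vec.span {v} \<in> What_points q"
      by (auto simp: What_points_def Vhat_eq)
    moreover have "vec.span {v} \<in> proj_points l"
      using that(1) \<open>v \<noteq> 0\<close> by (auto simp: proj_points_eq[OF sub])
    ultimately show False
      using disj by blast
  qed
  have h0: "herm q X Y = 0" if "X \<in> l" "Y \<in> l" for X Y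
    using l that by (simp add: herm_lines_def)
  have zero: "X = 0" if "X \<in> l" "X $ 1 = 0" "X $ 2 = 0" for X
    using l ext that by (rule external_line_zero)
  obtain w where w: "w \<in> l" "w $ 1 = 1" "w $ 2 = 0"
    using proj_line_coordinates[OF line zero] by blast
  obtain u' where u': "u' \<in> l" "u' $ 1 = 0" "u' $ 2 = 1"
    using proj_line_coordinates[OF line zero] by blast
  have "u' $ 3 * (u' $ 3) ^ q = 1"
    using h0[OF u'(1,1)] u'(2,3) by (simp add: herm_def add.commute)
  then obtain k where k: "k \<noteq> 0" "k ^ q = u' $ 3 * k"
    using ex_normalizing_scalar by blast
  define u where "u = k *s u'"
  define \<xi> \<zeta> where "\<xi> = u $ 2" and "\<zeta> = u $ 4"
  have u: "u \<in> l" "u $ 1 = 0" "u $ 2 = \<xi>" "u $ 3 = \<xi> ^ q" "u $ 4 = \<zeta>" "\<xi> \<noteq> 0"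
    using u' k vec.subspace_scale[OF sub u'(1), of k] by (simp_all add: u_def \<xi>_def \<zeta>_def mult.commute)
  have \<zeta>: "\<zeta> ^ q \<noteq> \<zeta>"
  proof
    assume "\<zeta> ^ q = \<zeta>"
    then have "sg u = u"
      using u by (simp add: vec_eq_iff_4 zero_power)
    with u ext[of u] show False
      by auto
  qed
  define c where "c = w $ 4 * \<xi> * \<xi> ^ q"
  have w3: "w $ 3 * \<xi> = \<zeta> ^ q"
    using h0[OF w(1) u(1)] w(2,3) u by (simp add: herm_def)
  have c: "c + c ^ q = \<zeta> * \<zeta> ^ q"
  proof -
    have "herm q w w * (\<xi> * \<xi> ^ q) = c + c ^ q + (w $ 3 * \<xi>) * (w $ 3 * \<xi>) ^ q"
      using w(2,3) by (simp add: herm_def c_def power_mult_distrib algebra_simps)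
    then have "c + c ^ q + (\<zeta> ^ q) * (\<zeta> ^ q) ^ q = 0"
      by (simp only: h0[OF w(1,1)] w3 mult_zero_left)
    then show ?thesis
      by (simp add: mult.commute)
  qed
  define b where "b = \<zeta> + \<zeta> ^ q"
  have "b \<noteq> 0"
    using \<zeta> by (auto simp: b_def)
  then obtain T where T: "T\<^sup>2 + \<epsilon> b * T + \<epsilon> c = 0"
    using ex_quadratic_root by blast
  have "(T\<^sup>2 + \<epsilon> b * T + \<epsilon> c) ^ q = 0"
    by (simp only: T) (simp add: zero_power)
  then have Tq: "(T ^ q)\<^sup>2 + \<epsilon> b * T ^ q + \<epsilon> (c ^ q) = 0"
    by (simp add: b_def power_mult_distrib power2_eq_square add.commute del: L.add_eq_0 flip: eps_power)
  \<comment> \<open>The q-th power of the quadratic equation is an equation for T^q. Since c + c^q =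
    \<zeta>^(q + 1), the two add up to a product, whose factors correspond to the two
    families.\<close>
  have "(T + T ^ q + \<epsilon> \<zeta>) * (T + T ^ q + \<epsilon> (\<zeta> ^ q)) =
      (T\<^sup>2 + \<epsilon> b * T + \<epsilon> c) + ((T ^ q)\<^sup>2 + \<epsilon> b * T ^ q + \<epsilon> (c ^ q)) + \<epsilon> (c + c ^ q + \<zeta> * \<zeta> ^ q)"
    by (simp add: b_def power2_eq_square algebra_simps)
  also have "\<dots> = 0"
    by (simp only: T Tq c K.add_self eps_0 add_0)
  finally have cases: "T + T ^ q = \<epsilon> \<zeta> \<or> T + T ^ q = \<epsilon> (\<zeta> ^ q)"
    by (simp only: mult_eq_0_iff L.add_eq_0)
  \<comment> \<open>If T came from x in the small field, either case would give \<zeta> = x + x^q,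
    which the q-th power fixes.\<close>
  have Tn: "T \<notin> range \<epsilon>"
  proof
    assume "T \<in> range \<epsilon>"
    then obtain x where "T = \<epsilon> x"
      by blast
    with cases have "\<epsilon> (x + x ^ q) = \<epsilon> \<zeta> \<or> \<epsilon> (x + x ^ q) = \<epsilon> (\<zeta> ^ q)"
      by simp
    then have "x + x ^ q = \<zeta> \<or> x + x ^ q = \<zeta> ^ q"
      by (simp only: eps_eq)
    then have "\<zeta> ^ q = \<zeta>"
    proof
      assume e: "x + x ^ q = \<zeta>"
      show ?thesis
        unfolding e[symmetric] by (simp add: add.commute)
    next
      assume e: "x + x ^ q = \<zeta> ^ q"
      have "(x + x ^ q) ^ q = \<zeta>"
        by (simp only: e power_q_q)
      then have "x + x ^ q = \<zeta>"
        by (simp add: add.commute)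
      with e show ?thesis
        by simp
    qed
    with \<zeta> show False ..
  qed
  have Tc: "T * (T + \<epsilon> b) = \<epsilon> c"
    using T by (simp add: power2_eq_square algebra_simps)
  have \<xi>0: "\<epsilon> \<xi> \<noteq> 0"
    using u(6) by simp
  from cases show "l \<in> fam1 \<union> fam2"
  proof
    assume eq: "T + T ^ q = \<epsilon> \<zeta>"
    define t where "t = T / \<epsilon> (\<xi> ^ q)"
    have t: "t * \<epsilon> (\<xi> ^ q) = T" "t ^ q * \<epsilon> \<xi> = T ^ q"
      using \<xi>0 by (simp_all add: t_def power_divide flip: eps_power)
    have "pform (t ^ q) t u = \<epsilon> \<zeta> + t ^ q * \<epsilon> \<xi> + t * \<epsilon> (\<xi> ^ q)"
      by (simp add: pform_def u)
    also have "\<dots> = 0"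
      by (simp only: t) (simp add: eq[symmetric] add_ac)
    finally have pu: "pform (t ^ q) t u = 0" .
    have "\<epsilon> (\<xi> * \<xi> ^ q) * pform (t ^ q) t w = \<epsilon> c + (t * \<epsilon> (\<xi> ^ q)) * \<epsilon> (w $ 3 * \<xi>) + (t ^ q * \<epsilon> \<xi>) * (t * \<epsilon> (\<xi> ^ q))"
      by (simp add: pform_def w c_def algebra_simps)
    also have "\<dots> = \<epsilon> c + T * (\<epsilon> (\<zeta> ^ q) + T ^ q)"
      by (simp only: t w3) (simp add: algebra_simps)
    also have "\<epsilon> (\<zeta> ^ q) + T ^ q = T + \<epsilon> b"
      using eq by (simp add: b_def) (metis L.add_self_left add.commute)
    also have "\<epsilon> c + T * (T + \<epsilon> b) = 0"
      by (simp only: Tc L.add_self)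
    finally have pw: "pform (t ^ q) t w = 0"
      using \<xi>0 by simp
    have tn: "t \<notin> range \<epsilon>"
    proof
      assume "t \<in> range \<epsilon>"
      then obtain x where "t = \<epsilon> x"
        by blast
      with t(1) have "T = \<epsilon> (x * \<xi> ^ q)"
        by simp
      with Tn show False
        by blast
    qed
    have "l = pline (t ^ q) t"
      by (rule external_line_eq_pline[OF l ext u(1,2) _ pu w pw tn]) (use u in auto)
    with tn show ?thesis
      by (auto simp: fam2_def)
  next
    assume eq: "T + T ^ q = \<epsilon> (\<zeta> ^ q)"
    define T' where "T' = T + \<epsilon> \<zeta>"
    have T'q: "T' ^ q = T"
    proof -
      have "T' ^ q = T ^ q + \<epsilon> (\<zeta> ^ q)"
        by (simp add: T'_def flip: eps_power)
      also have "\<dots> = T"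
        by (simp only: eq[symmetric]) (simp add: add_ac)
      finally show ?thesis .
    qed
    have T': "T' = T + \<epsilon> \<zeta>"
      by (simp add: T'_def add.assoc)
    define t where "t = T' / \<epsilon> \<xi>"
    have t: "t * \<epsilon> \<xi> = T'" "t ^ q * \<epsilon> (\<xi> ^ q) = T"
      using \<xi>0 T'q by (simp_all add: t_def power_divide)
    have "pform t (t ^ q) u = \<epsilon> \<zeta> + t * \<epsilon> \<xi> + t ^ q * \<epsilon> (\<xi> ^ q)"
      by (simp add: pform_def u)
    also have "\<dots> = 0"
      by (simp only: t) (simp add: T' add_ac)
    finally have pu: "pform t (t ^ q) u = 0" .
    have "\<epsilon> (\<xi> * \<xi> ^ q) * pform t (t ^ q) w = \<epsilon> c + (t ^ q * \<epsilon> (\<xi> ^ q)) * \<epsilon> (w $ 3 * \<xi>) + (t * \<epsilon> \<xi>) * (t ^ q * \<epsilon> (\<xi> ^ q))"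
      by (simp add: pform_def w c_def algebra_simps)
    also have "\<dots> = \<epsilon> c + T * (\<epsilon> (\<zeta> ^ q) + T')"
      by (simp only: t w3) (simp add: algebra_simps)
    also have "\<epsilon> (\<zeta> ^ q) + T' = T + \<epsilon> b"
      by (simp add: b_def T' add_ac)
    also have "\<epsilon> c + T * (T + \<epsilon> b) = 0"
      by (simp only: Tc L.add_self)
    finally have pw: "pform t (t ^ q) w = 0"
      using \<xi>0 by simp
    have tn: "t ^ q \<notin> range \<epsilon>"
    proof
      assume "t ^ q \<in> range \<epsilon>"
      then obtain x where "t ^ q = \<epsilon> x"
        by blast
      with t(2) have "T = \<epsilon> (x * \<xi> ^ q)"
        by simp
      with Tn show False
        by blast
    qed
    have "l = pline t (t ^ q)"
      by (rule external_line_eq_pline[OF l ext u(1,2) _ pu w pw tn]) (use u in auto)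
    with tn show ?thesis
      by (auto simp: fam1_def)
  qed
qed

end

section \<open>Isometries\<close>

lemma linear_vecI:
  assumes "\<And>X Y. f (X + Y) = f X + f Y" and "\<And>c X. f (c *s X) = c *s f X"
  shows "Vector_Spaces.linear (*s) (*s) (f :: 'a::field ^ 'n \<Rightarrow> 'a ^ 'm)"
  using assms by (simp add: Vector_Spaces.linear_iff vec.vector_space_axioms)

lemma linear_vecD:
  assumes "Vector_Spaces.linear (*s) (*s) (f :: 'a::field ^ 'n \<Rightarrow> 'a ^ 'm)"
  shows "f (X + Y) = f X + f Y" and "f (c *s X) = c *s f X"
  using assms by (simp_all add: Vector_Spaces.linear_iff)

context field_tower
begin

definition qform :: "'k ^ 4 \<Rightarrow> 'k" where
  "qform X = X $ 1 * X $ 4 + X $ 2 * X $ 3"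

text \<open>Such a map also preserves \<open>herm\<close>, because \<open>herm q X Y\<close> is the
  polar form of \<open>qform\<close> at X and \<open>sg Y\<close>; on \<open>Vhat q\<close> the form
  \<open>qform\<close> is \<open>Qhat q\<close>.\<close>

definition isometry :: "('k ^ 4 \<Rightarrow> 'k ^ 4) \<Rightarrow> bool" where
  "isometry f \<longleftrightarrow> Vector_Spaces.linear (*s) (*s) f \<and> (\<forall>X. sg (f X) = f (sg X)) \<and> (\<forall>X. qform (f X) = qform X)"

lemma herm_eq_polar: "herm q X Y = qform (X + sg Y) + qform X + qform (sg Y)"
  by (simp add: herm_def qform_def algebra_simps)

lemma herm_isometry:
  assumes "isometry f"
  shows "herm q (f X) (f Y) = herm q X Y"
proof -
  have "f X + sg (f Y) = f (X + sg Y)"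
    using assms by (simp add: isometry_def linear_vecD)
  with assms show ?thesis
    by (simp add: herm_eq_polar isometry_def)
qed

lemma Qhat_eq: "sg v = v \<Longrightarrow> Qhat q v = qform v"
  by (simp add: Qhat_def qform_def vec_eq_iff_4)

text \<open>On the points (1, x, x^q, x^(q + 1)) of the quadric, \<open>tmap\<close>,
  \<open>dmap\<close>, \<open>jmap\<close> and \<open>zmap\<close> act as x -> x + b, x -> b^2 x, x
  -> 1 / x and x -> x^q.\<close>

definition tmap :: "'k \<Rightarrow> 'k ^ 4 \<Rightarrow> 'k ^ 4" where
  "tmap b X = vector [X $ 1, X $ 2 + b * X $ 1, X $ 3 + b ^ q * X $ 1,
     X $ 4 + b * X $ 3 + b ^ q * X $ 2 + b * b ^ q * X $ 1]"

definition dmap :: "'k \<Rightarrow> 'k ^ 4 \<Rightarrow> 'k ^ 4" where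
  "dmap b X = vector [X $ 1 / (b * b ^ q), X $ 2 * b / b ^ q, X $ 3 * b ^ q / b, X $ 4 * b * b ^ q]"

definition jmap :: "'k ^ 4 \<Rightarrow> 'k ^ 4" where
  "jmap X = vector [X $ 4, X $ 3, X $ 2, X $ 1]"

definition zmap :: "'k ^ 4 \<Rightarrow> 'k ^ 4" where
  "zmap X = vector [X $ 1, X $ 3, X $ 2, X $ 4]"

lemma tmap_nth [simp]:
  "tmap b X $ 1 = X $ 1" "tmap b X $ 2 = X $ 2 + b * X $ 1" "tmap b X $ 3 = X $ 3 + b ^ q * X $ 1"
  "tmap b X $ 4 = X $ 4 + b * X $ 3 + b ^ q * X $ 2 + b * b ^ q * X $ 1"
  by (simp_all add: tmap_def vector_4_nth)

lemma dmap_nth [simp]: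
  "dmap b X $ 1 = X $ 1 / (b * b ^ q)" "dmap b X $ 2 = X $ 2 * b / b ^ q"
  "dmap b X $ 3 = X $ 3 * b ^ q / b" "dmap b X $ 4 = X $ 4 * b * b ^ q"
  by (simp_all add: dmap_def vector_4_nth)

lemma jmap_nth [simp]:
  "jmap X $ 1 = X $ 4" "jmap X $ 2 = X $ 3" "jmap X $ 3 = X $ 2" "jmap X $ 4 = X $ 1"
  by (simp_all add: jmap_def vector_4_nth)

lemma zmap_nth [simp]:
  "zmap X $ 1 = X $ 1" "zmap X $ 2 = X $ 3" "zmap X $ 3 = X $ 2" "zmap X $ 4 = X $ 4"
  by (simp_all add: zmap_def vector_4_nth)

lemma tmap_tmap: "tmap b (tmap b X) = X"
  by (simp add: vec_eq_iff_4 algebra_simps)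

lemma dmap_inverse: "b \<noteq> 0 \<Longrightarrow> dmap b (dmap (inverse b) X) = X" "b \<noteq> 0 \<Longrightarrow> dmap (inverse b) (dmap b X) = X"
  by (simp_all add: vec_eq_iff_4 power_inverse field_simps)

lemma jmap_jmap: "jmap (jmap X) = X"
  by (simp add: vec_eq_iff_4)

lemma isometry_tmap: "isometry (tmap b)"
  unfolding isometry_def
  by (intro conjI allI linear_vecI) (simp_all add: vec_eq_iff_4 qform_def algebra_simps power_mult_distrib)

lemma isometry_dmap: "b \<noteq> 0 \<Longrightarrow> isometry (dmap b)"
  unfolding isometry_def
  by (intro conjI allI linear_vecI)
    (simp_all add: vec_eq_iff_4 qform_def power_mult_distrib power_divide algebra_simps add_divide_distrib)

lemma isometry_jmap: "isometry jmap"
  unfolding isometry_def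
  by (intro conjI allI linear_vecI) (simp_all add: vec_eq_iff_4 qform_def mult.commute)

lemma pform_tmap: "pform t r (tmap b X) = 1 * pform (t + \<epsilon> (b ^ q)) (r + \<epsilon> b) X"
  by (simp add: pform_def algebra_simps)

lemma pform_dmap:
  assumes "b \<noteq> 0"
  shows "pform t r (dmap b X) = \<epsilon> (b * b ^ q) * pform (t / \<epsilon> (b ^ q) ^ 2) (r / \<epsilon> b ^ 2) X"
proof -
  have "\<epsilon> b \<noteq> 0"
    using assms by simp
  then show ?thesis
    by (simp add: pform_def power2_eq_square distrib_left mult_ac)
qed

lemma image_pline:
  assumes "\<And>X. f (f' X) = X" and "\<And>X. f' (f X) = X"
    and "\<And>X. pform t r (f' X) = k * pform t' r' X" and "k \<noteq> 0"
  shows "f ` pline t r = pline t' r'"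
proof (intro equalityI subsetI)
  fix Y
  assume "Y \<in> f ` pline t r"
  then show "Y \<in> pline t' r'"
    using assms(2,4) by (auto simp: pline_def) (metis assms(3) mult_eq_0_iff)
next
  fix Y
  assume "Y \<in> pline t' r'"
  then have "f' Y \<in> pline t r"
    by (simp add: pline_def assms(3))
  then show "Y \<in> f ` pline t r"
    by (metis assms(1) imageI)
qed

lemma tmap_pline: "tmap b ` pline t r = pline (t + \<epsilon> (b ^ q)) (r + \<epsilon> b)"
  by (rule image_pline[OF tmap_tmap tmap_tmap pform_tmap]) simp

lemma dmap_pline:
  assumes "b \<noteq> 0"
  shows "dmap b ` pline t r = pline (t * \<epsilon> (b ^ q) ^ 2) (r * \<epsilon> b ^ 2)"
proof (rule image_pline[OF dmap_inverse[OF assms]])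
  show "pform t r (dmap (inverse b) X) =
      \<epsilon> (inverse b * inverse b ^ q) * pform (t * \<epsilon> (b ^ q) ^ 2) (r * \<epsilon> b ^ 2) X" for X
    using assms by (subst pform_dmap) (simp_all add: power_inverse divide_inverse)
qed (use assms in simp)

lemma jmap_pline:
  assumes "t \<noteq> 0" and "r \<noteq> 0"
  shows "jmap ` pline t r = pline (inverse t) (inverse r)"
proof (rule image_pline[where f' = jmap and k = "t * r"])
  show "pform t r (jmap X) = (t * r) * pform (inverse t) (inverse r) X" for X
    using assms by (simp add: pform_def field_simps)
qed (use assms jmap_jmap in simp_all)

lemma zmap_pline: "zmap ` pline t r = pline r t"
proof (rule image_pline[where f' = zmap and k = 1])
  show "pform t r (zmap X) = 1 * pform r t X" for X
    by (simp add: pform_def mult_ac add_ac)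
qed (simp_all add: vec_eq_iff_4)

lemma scale_pline:
  assumes "a \<noteq> 0"
  shows "(*s) a ` pline t r = pline t r"
proof (rule image_pline[where f' = "(*s) (inverse a)"])
  show "pform t r (inverse a *s X) = \<epsilon> (inverse a) * pform t r X" for X
    by (rule pform_scale)
qed (use assms in simp_all)

section \<open>The two families and the sign of a map\<close>

definition fam :: "bool \<Rightarrow> ('k ^ 4) set set" where
  "fam s = (if s then fam1 else fam2)"

text \<open>Both families are preserved if \<open>s\<close> holds, and interchanged otherwise.\<close>

definition permutes_fam :: "bool \<Rightarrow> ('k ^ 4 \<Rightarrow> 'k ^ 4) \<Rightarrow> bool" where
  "permutes_fam s f \<longleftrightarrow> (\<forall>u. (`) f ` fam u = fam (u = s))"

text \<open>Equality of truth values is multiplication of signs, with \<open>True\<close> as the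
  trivial sign.\<close>

lemma permutes_fam_comp:
  assumes "permutes_fam s f" and "permutes_fam s' g"
  shows "permutes_fam (s = s') (f \<circ> g)"
proof -
  have "(`) (f \<circ> g) ` F = (`) f ` ((`) g ` F)" for F :: "('k ^ 4) set set"
    by (simp add: image_image image_comp)
  moreover have "((u = s') = s) = (u = (s = s'))" for u
    by auto
  ultimately show ?thesis
    using assms by (simp only: permutes_fam_def) blast
qed

lemma permutes_famI:
  assumes "\<And>X. f (f' X) = X" and "\<And>u l. l \<in> fam u \<Longrightarrow> f ` l \<in> fam (u = s)"
    and "\<And>u l. l \<in> fam u \<Longrightarrow> f' ` l \<in> fam (u = s)"
  shows "permutes_fam s f"
  unfolding permutes_fam_def
proof (intro allI equalityI subsetI)
  fix u l
  assume "l \<in> fam (u = s)"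
  then have "f' ` l \<in> fam u"
    using assms(3)[of l "u = s"] by (cases u; cases s) auto
  moreover have "l = f ` (f' ` l)"
    by (simp add: image_image assms(1))
  ultimately show "l \<in> (`) f ` fam u"
    by blast
qed (use assms(2) in auto)

lemma affine_in_range_iff:
  "t + \<epsilon> b \<in> range \<epsilon> \<longleftrightarrow> t \<in> range \<epsilon>" "b \<noteq> 0 \<Longrightarrow> t * \<epsilon> b \<in> range \<epsilon> \<longleftrightarrow> t \<in> range \<epsilon>"
  by (simp_all add: bar_eq_self_iff[symmetric])

text \<open>The generators act separately on the parameters t and r; each family is preserved as
  soon as the q-th power carries the two actions into each other.\<close>

lemma image_fam:
  assumes "\<And>t r. t \<notin> range \<epsilon> \<Longrightarrow> r \<notin> range \<epsilon> \<Longrightarrow> f ` pline t r = pline (\<alpha> t) (\<beta> r)"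
    and "\<And>t. \<beta> (t ^ q) = \<alpha> t ^ q" and "\<And>t. \<alpha> (t ^ q) = \<beta> t ^ q"
    and "\<And>t. t \<notin> range \<epsilon> \<Longrightarrow> \<alpha> t \<notin> range \<epsilon>" and "\<And>t. t \<notin> range \<epsilon> \<Longrightarrow> \<beta> t \<notin> range \<epsilon>"
    and "l \<in> fam u"
  shows "f ` l \<in> fam u"
proof (cases u)
  case True
  then obtain t where t: "l = pline t (t ^ q)" "t \<notin> range \<epsilon>"
    using assms(6) by (auto simp: fam_def fam1_def)
  then have "f ` l = pline (\<alpha> t) (\<alpha> t ^ q)"
    by (simp only: assms(1,2) power_q_in_range_iff not_False_eq_True)
  with True assms(4)[OF t(2)] show ?thesis
    unfolding fam_def fam1_def by auto
next
  case False
  then obtain t where t: "l = pline (t ^ q) t" "t \<notin> range \<epsilon>"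
    using assms(6) by (auto simp: fam_def fam2_def)
  then have "f ` l = pline (\<beta> t ^ q) (\<beta> t)"
    by (simp only: assms(1,3) power_q_in_range_iff not_False_eq_True)
  with False assms(5)[OF t(2)] show ?thesis
    unfolding fam_def fam2_def by auto
qed

lemma tmap_fam:
  assumes "l \<in> fam u"
  shows "tmap b ` l \<in> fam u"
proof (rule image_fam[OF _ _ _ _ _ assms])
  show "tmap b ` pline t r = pline (t + \<epsilon> (b ^ q)) (r + \<epsilon> b)" for t r
    by (rule tmap_pline)
  show "t ^ q + \<epsilon> b = (t + \<epsilon> (b ^ q)) ^ q" "t ^ q + \<epsilon> (b ^ q) = (t + \<epsilon> b) ^ q" for t
    by (simp_all only: power_q_add eps_power[symmetric] power_q_q)
qed (simp_all only: affine_in_range_iff not_False_eq_True)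

lemma dmap_fam:
  assumes "b \<noteq> 0" and "l \<in> fam u"
  shows "dmap b ` l \<in> fam u"
proof (rule image_fam[OF _ _ _ _ _ assms(2)])
  have "\<epsilon> (b ^ q) ^ 2 = \<epsilon> ((b\<^sup>2) ^ q)" "\<epsilon> b ^ 2 = \<epsilon> (b\<^sup>2)"
    by (simp_all add: power_mult[symmetric] mult.commute)
  then show "dmap b ` pline t r = pline (t * \<epsilon> ((b\<^sup>2) ^ q)) (r * \<epsilon> (b\<^sup>2))" for t r
    using dmap_pline[OF assms(1), of t r] by (simp only:)
  show "t ^ q * \<epsilon> (b\<^sup>2) = (t * \<epsilon> ((b\<^sup>2) ^ q)) ^ q" "t ^ q * \<epsilon> ((b\<^sup>2) ^ q) = (t * \<epsilon> (b\<^sup>2)) ^ q" for t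
    by (simp_all only: power_mult_distrib eps_power[symmetric] power_q_q)
qed (use assms(1) in \<open>simp_all only: affine_in_range_iff power_eq_0_iff not_False_eq_True simp_thms\<close>)

lemma jmap_fam:
  assumes "l \<in> fam u"
  shows "jmap ` l \<in> fam u"
proof (rule image_fam[where \<alpha> = inverse and \<beta> = inverse, OF _ _ _ _ _ assms])
  show "jmap ` pline t r = pline (inverse t) (inverse r)" if "t \<notin> range \<epsilon>" "r \<notin> range \<epsilon>" for t r
    using that eps_0 by (intro jmap_pline) (metis rangeI)+
  show "inverse t \<notin> range \<epsilon>" if "t \<notin> range \<epsilon>" for t
    using that by (simp add: bar_eq_self_iff[symmetric])
  then show "inverse t \<notin> range \<epsilon>" if "t \<notin> range \<epsilon>" for t
    using that by blast
qed (simp_all add: power_inverse)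

lemma zmap_fam: "l \<in> fam u \<Longrightarrow> zmap ` l \<in> fam (\<not> u)"
  by (cases u) (auto simp: fam_def fam1_def fam2_def zmap_pline)

lemma permutes_fam_tmap: "permutes_fam True (tmap b)"
  by (rule permutes_famI[where f' = "tmap b"]) (simp_all add: tmap_fam tmap_tmap)

lemma permutes_fam_dmap: "b \<noteq> 0 \<Longrightarrow> permutes_fam True (dmap b)"
  by (rule permutes_famI[where f' = "dmap (inverse b)"]) (simp_all add: dmap_fam dmap_inverse)

lemma permutes_fam_jmap: "permutes_fam True jmap"
  by (rule permutes_famI[where f' = jmap]) (simp_all add: jmap_fam jmap_jmap)

lemma permutes_fam_zmap: "permutes_fam False zmap"
  by (rule permutes_famI[where f' = zmap]) (simp_all add: zmap_fam vec_eq_iff_4)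

lemma permutes_fam_scale: "a \<noteq> 0 \<Longrightarrow> permutes_fam True ((*s) a)"
  by (rule permutes_famI[where f' = "(*s) (inverse a)"])
    (auto simp: fam_def fam1_def fam2_def scale_pline split: if_splits)

section \<open>Maps preserving the elliptic quadric\<close>

definition singular_vectors :: "('k ^ 4) set" where
  "singular_vectors = {k *s v | k v. sg v = v \<and> qform v = 0}"

text \<open>The points of the elliptic quadric other than the one spanned by the last basis vector.\<close>

definition opoint :: "'k \<Rightarrow> 'k ^ 4" where
  "opoint x = vector [1, x, x ^ q, x * x ^ q]"

definition e4 :: "'k ^ 4" where
  "e4 = vector [0, 0, 0, 1]"

lemma opoint_nth [simp]:
  "opoint x $ 1 = 1" "opoint x $ 2 = x" "opoint x $ 3 = x ^ q" "opoint x $ 4 = x * x ^ q"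
  by (simp_all add: opoint_def vector_4_nth)

lemma e4_nth [simp]: "e4 $ 1 = 0" "e4 $ 2 = 0" "e4 $ 3 = 0" "e4 $ 4 = 1"
  by (simp_all add: e4_def vector_4_nth)

lemma singular_vectorsI: "sg v = v \<Longrightarrow> qform v = 0 \<Longrightarrow> v \<in> singular_vectors"
  unfolding singular_vectors_def by (rule CollectI, rule exI[of _ 1], rule exI[of _ v]) simp

lemma opoint_singular: "opoint x \<in> singular_vectors"
  by (rule singular_vectorsI) (simp_all add: vec_eq_iff_4 qform_def power_mult_distrib mult.commute)

lemma e4_singular: "e4 \<in> singular_vectors"
  by (rule singular_vectorsI) (simp_all add: vec_eq_iff_4 qform_def)

lemma singular_vectorsE:
  assumes "v \<in> singular_vectors" and "v \<noteq> 0"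
  obtains k x where "k \<noteq> 0" "v = k *s opoint x" | k where "k \<noteq> 0" "v = k *s e4"
proof -
  obtain c w where cw: "v = c *s w" "sg w = w" "qform w = 0"
    using assms(1) by (auto simp: singular_vectors_def)
  have "c \<noteq> 0"
    using assms(2) cw(1) by auto
  have w: "w $ 1 ^ q = w $ 1" "w $ 3 ^ q = w $ 2" "w $ 2 ^ q = w $ 3"
    using cw(2) by (auto simp: vec_eq_iff_4)
  have Q: "w $ 1 * w $ 4 = w $ 2 * w $ 3"
    using cw(3) by (simp add: qform_def)
  show thesis
  proof (cases "w $ 1 = 0")
    case False
    have "w = w $ 1 *s opoint (w $ 2 / w $ 1)"
      using False Q by (simp add: vec_eq_iff_4 power_divide w field_simps)
    then have "v = (c * w $ 1) *s opoint (w $ 2 / w $ 1)"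
      by (metis cw(1) vector_smult_assoc)
    with \<open>c \<noteq> 0\<close> False show thesis
      by (intro that(1)) auto
  next
    case True
    then have "w $ 2 = 0 \<or> w $ 3 = 0"
      using Q by simp
    then have "w $ 2 = 0" "w $ 3 = 0"
      using w by auto
    with True have "w = w $ 4 *s e4"
      by (simp add: vec_eq_iff_4)
    then have "v = (c * w $ 4) *s e4"
      by (metis cw(1) vector_smult_assoc)
    moreover from this have "c * w $ 4 \<noteq> 0"
      using assms(2) by auto
    ultimately show thesis
      by (rule that(2)[rotated])
  qed
qed

text \<open>A matrix representing a projective class is determined only up to a scalar and may fail
  to commute with \<open>sg\<close>. Since \<open>singular_vectors\<close> contains all multiples,
  this weaker property does not depend on the representing unitary matrix.\<close>

definition preserves :: "('k ^ 4 \<Rightarrow> 'k ^ 4) \<Rightarrow> bool" where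
  "preserves f \<longleftrightarrow> Vector_Spaces.linear (*s) (*s) f \<and> (\<forall>X Y. herm q (f X) (f Y) = herm q X Y) \<and>
     f ` singular_vectors \<subseteq> singular_vectors"

lemma preserves_comp: "preserves f \<Longrightarrow> preserves g \<Longrightarrow> preserves (f \<circ> g)"
  unfolding preserves_def by (auto intro!: linear_vecI simp: linear_vecD image_subset_iff)

lemma isometry_singular:
  assumes "isometry f"
  shows "f ` singular_vectors \<subseteq> singular_vectors"
proof
  fix Y
  assume "Y \<in> f ` singular_vectors"
  then obtain k v where "Y = f (k *s v)" "sg v = v" "qform v = 0"
    by (auto simp: singular_vectors_def)
  then have "Y = k *s f v" "sg (f v) = f v" "qform (f v) = 0"
    using assms by (auto simp: isometry_def linear_vecD)
  then show "Y \<in> singular_vectors"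
    unfolding singular_vectors_def by blast
qed

lemma isometry_preserves: "isometry f \<Longrightarrow> preserves f"
  using isometry_singular herm_isometry by (simp add: preserves_def isometry_def)

lemma herm_opoint:
  "herm q X (opoint 0) = X $ 4" "herm q X e4 = X $ 1"
  "herm q (opoint x) (opoint 1) = (x + 1) * (x ^ q + 1)"
  by (simp_all add: herm_def algebra_simps)

lemma preserves_neq_0:
  assumes "preserves f" and "herm q X Y \<noteq> 0"
  shows "f X \<noteq> 0"
proof
  assume "f X = 0"
  then have "herm q X Y = herm q 0 (f Y)"
    using assms(1) by (metis preserves_def)
  with assms(2) show False
    by (simp add: herm_def)
qed

text \<open>The three fixed points force a common scalar a. If the quadric point x goes to y, then
  N(y) = N(x) and N(y + 1) = N(x + 1) for the norm N to GF(q), so y is x or x^q. A single x = w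
  outside GF(q) then decides whether f is a times the identity or a times
  \<open>zmap\<close>.\<close>

lemma permutes_fam_of_fixed_frame:
  assumes f: "preserves f" and fix1: "f (opoint 0) = a *s opoint 0" and fix4: "f e4 = d *s e4"
    and fix_one: "f (opoint 1) = k *s opoint 1"
  shows "\<exists>s. permutes_fam s f"
proof -
  have lin: "f (X + Y) = f X + f Y" "f (c *s X) = c *s f X" for X Y c
    using f by (simp_all add: preserves_def linear_vecD)
  have h: "herm q (f X) (f Y) = herm q X Y" for X Y
    using f by (simp add: preserves_def)
  have "a * d ^ q = 1"
    using h[of "opoint 0" e4] by (simp add: fix1 fix4 herm_scale) (simp add: herm_def mult.commute)
  then have ad: "a \<noteq> 0" "d \<noteq> 0"
    by auto
  \<comment> \<open>The middle coordinates span the orthogonal complement of \<open>opoint 0\<close>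
    and \<open>e4\<close>, hence an invariant subspace.\<close>
  have mid14: "f X $ 1 = 0" "f X $ 4 = 0" if "X $ 1 = 0" "X $ 4 = 0" for X
  proof -
    have "d ^ q * f X $ 1 = 0"
      using h[of X e4] that by (simp add: fix4 herm_scale herm_opoint)
    with ad show "f X $ 1 = 0"
      by simp
    have "a ^ q * f X $ 4 = 0"
      using h[of X "opoint 0"] that by (simp add: fix1 herm_scale herm_opoint)
    with ad show "f X $ 4 = 0"
      by simp
  qed
  define m :: "'k \<Rightarrow> 'k \<Rightarrow> 'k ^ 4" where "m = (\<lambda>x y. vector [0, x, y, 0])"
  have m_nth [simp]: "m x y $ 1 = 0" "m x y $ 2 = x" "m x y $ 3 = y" "m x y $ 4 = 0" for x y
    by (simp_all add: m_def vector_4_nth)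
  have split: "X = X $ 1 *s opoint 0 + m (X $ 2) (X $ 3) + X $ 4 *s e4" for X
    by (simp add: vec_eq_iff_4)
  have f_split: "f X = (X $ 1 * a) *s opoint 0 + f (m (X $ 2) (X $ 3)) + (X $ 4 * d) *s e4" for X
    by (subst split) (simp only: lin fix1 fix4 vector_smult_assoc)
  have fm: "f (m x y) $ 1 = 0" "f (m x y) $ 4 = 0" for x y
    by (rule mid14; simp)+
  have f14: "f X $ 1 = X $ 1 * a" "f X $ 4 = X $ 4 * d" for X
    by (subst f_split; simp add: fm)+
  have k: "k = a" "k = d"
    using f14[of "opoint 1"] by (simp_all add: fix_one)
  then have "d = a" "a * a ^ q = 1"
    using \<open>a * d ^ q = 1\<close> by auto
  have m1: "f (m 1 1) = a *s m 1 1"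
  proof -
    have "f (m 1 1) $ 2 = f (opoint 1) $ 2" "f (m 1 1) $ 3 = f (opoint 1) $ 3"
      by (subst f_split[of "opoint 1"]; simp)+
    then show ?thesis
      by (simp add: vec_eq_iff_4 fm fix_one k)
  qed
  have mx: "f (m x (x ^ q)) = a *s m x (x ^ q) \<or> f (m x (x ^ q)) = a *s m (x ^ q) x" for x
  proof -
    have "f (opoint x) \<in> singular_vectors"
      using f opoint_singular by (auto simp: preserves_def)
    moreover have fx1: "f (opoint x) $ 1 = a"
      by (simp add: f14)
    then have "f (opoint x) \<noteq> 0"
      using ad(1) by auto
    ultimately obtain y where y: "f (opoint x) = a *s opoint y"
    proof (cases rule: singular_vectorsE)
      case (1 k' y)
      with fx1 that show thesis
        by auto
    next
      case (2 k')
      with fx1 ad(1) show thesis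
        by auto
    qed
    have "y * y ^ q = x * x ^ q"
      using f14(2)[of "opoint x"] ad by (simp add: y \<open>d = a\<close> mult.commute)
    moreover have "(y + 1) * (y ^ q + 1) = (x + 1) * (x ^ q + 1)"
    proof -
      have "herm q (opoint x) (opoint 1) = herm q (a *s opoint y) (a *s opoint 1)"
        using h[of "opoint x" "opoint 1"] by (simp only: y fix_one k(1))
      also have "\<dots> = (a * a ^ q) * herm q (opoint y) (opoint 1)"
        by (simp only: herm_scale mult_ac)
      finally show ?thesis
        by (simp only: \<open>a * a ^ q = 1\<close> herm_opoint mult_1_left)
    qed
    moreover have "(z + 1) * (z ^ q + 1) = z * z ^ q + (z + z ^ q) + 1" for z :: 'k
      by (simp add: algebra_simps)
    ultimately have "x * x ^ q + (y + y ^ q) + 1 = x * x ^ q + (x + x ^ q) + 1"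
      by (simp only:)
    then have "y + y ^ q = x + x ^ q"
      by (simp only: add_left_cancel add_right_cancel)
    \<comment> \<open>Equal traces and norms: x, x^q and y, y^q are the roots of the same quadratic
      polynomial.\<close>
    have "(y + x) * (y + x ^ q) = y * y + y * (x + x ^ q) + x * x ^ q"
      by (simp add: algebra_simps)
    also have "\<dots> = y * y + y * (y + y ^ q) + y * y ^ q"
      by (simp only: \<open>y + y ^ q = x + x ^ q\<close> \<open>y * y ^ q = x * x ^ q\<close>)
    also have "\<dots> = 0"
      by (simp add: distrib_left)
    finally have "y = x \<or> y = x ^ q"
      by simp
    moreover have "f (m x (x ^ q)) = a *s m y (y ^ q)"
    proof -
      have "f (m x (x ^ q)) $ 2 = f (opoint x) $ 2" "f (m x (x ^ q)) $ 3 = f (opoint x) $ 3"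
        by (subst f_split[of "opoint x"]; simp)+
      then show ?thesis
        by (simp add: vec_eq_iff_4 fm y)
    qed
    ultimately show ?thesis
      by auto
  qed
  obtain w :: 'k where w: "w ^ q \<noteq> w"
    using ex_power_q_neq by blast
  \<comment> \<open>\<open>D\<close> is the determinant of (w, w^q) and (1, 1), which therefore form
    a basis of the middle coordinates.\<close>
  define D where "D = w + w ^ q"
  have "D \<noteq> 0"
    using w by (auto simp: D_def)
  have coords: "m x y = ((x + y) / D) *s m w (w ^ q) + (x + (x + y) / D * w) *s m 1 1" for x y
  proof -
    have "(x + y) / D * (w ^ q) + (x + (x + y) / D * w) = x + (x + y) / D * D"
      by (simp add: D_def distrib_left add_ac)
    also have "\<dots> = y"
      using \<open>D \<noteq> 0\<close> by simp
    finally have e3: "(x + y) / D * w ^ q + (x + (x + y) / D * w) = y"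
      by simp
    have e2: "(x + y) / D * w + (x + (x + y) / D * w) = x"
      by (simp only: add.left_commute[of _ x] K.add_self add_0_right)
    show ?thesis
      by (simp only: vec_eq_iff_4 m_nth vector_add_component vector_smult_component mult_1_right
          mult_zero_right add_0_right e2 e3 simp_thms)
  qed
  have fmxy: "f (m x y) = ((x + y) / D) *s f (m w (w ^ q)) + (x + (x + y) / D * w) *s (a *s m 1 1)" for x y
    by (subst coords) (simp only: lin m1)
  from mx[of w] show ?thesis
  proof
    assume e: "f (m w (w ^ q)) = a *s m w (w ^ q)"
    have "f (m x y) = a *s m x y" for x y
    proof -
      have "f (m x y) = a *s (((x + y) / D) *s m w (w ^ q) + (x + (x + y) / D * w) *s m 1 1)"
        by (simp only: fmxy[of x y] e vector_smult_assoc vector_add_ldistrib mult_ac)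
      then show ?thesis
        by (simp only: coords[of x y, symmetric])
    qed
    then have "f X = a *s X" for X
      by (subst f_split, subst (4) split) (simp add: \<open>d = a\<close> vec_eq_iff_4)
    then have "f = (*s) a"
      by blast
    with permutes_fam_scale[OF ad(1)] show ?thesis
      by blast
  next
    assume e: "f (m w (w ^ q)) = a *s m (w ^ q) w"
    have "f (m x y) = a *s m y x" for x y
    proof -
      have "m y x = ((x + y) / D) *s m (w ^ q) w + (x + (x + y) / D * w) *s m 1 1"
        using coords[of x y] by (simp add: vec_eq_iff_4)
      then show ?thesis
        by (simp only: fmxy[of x y] e vector_smult_assoc vector_add_ldistrib mult_ac)
    qed
    then have "f X = a *s zmap X" for X
      by (subst f_split) (simp add: \<open>d = a\<close> vec_eq_iff_4)
    then have "f = (*s) a \<circ> zmap"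
      by auto
    with permutes_fam_comp[OF permutes_fam_scale[OF ad(1)] permutes_fam_zmap] show ?thesis
      by blast
  qed
qed

lemma permutes_fam_of_comp:
  assumes "\<exists>s. permutes_fam s (g \<circ> f)" and "permutes_fam True g'" and "\<And>X. g' (g X) = X"
  shows "\<exists>s. permutes_fam s f"
proof -
  obtain s where "permutes_fam s (g \<circ> f)"
    using assms(1) by blast
  with assms(2) have "permutes_fam (True = s) (g' \<circ> (g \<circ> f))"
    by (rule permutes_fam_comp)
  moreover have "g' \<circ> (g \<circ> f) = f"
    by (simp add: fun_eq_iff assms(3))
  ultimately show ?thesis
    by auto
qed

lemma tmap_opoint: "tmap b (opoint x) = opoint (x + b)"
  by (simp add: vec_eq_iff_4 algebra_simps)

lemma tmap_e4: "tmap b e4 = e4"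
  by (simp add: vec_eq_iff_4)

lemma dmap_opoint: "b \<noteq> 0 \<Longrightarrow> dmap b (opoint x) = inverse (b * b ^ q) *s opoint (x * b\<^sup>2)"
  by (simp add: vec_eq_iff_4 power_mult_distrib power2_eq_square field_simps)

lemma dmap_e4: "dmap b e4 = (b * b ^ q) *s e4"
  by (simp add: vec_eq_iff_4)

lemma jmap_opoint_0: "jmap (opoint 0) = e4"
  by (simp add: vec_eq_iff_4)

lemma preserves_scale: "preserves f \<Longrightarrow> f (c *s X) = c *s f X"
  by (simp add: preserves_def linear_vecD)

lemma preserves_herm: "preserves f \<Longrightarrow> herm q (f X) (f Y) = herm q X Y"
  by (simp add: preserves_def)

lemma preserves_singularE:
  assumes "preserves f" and "X \<in> singular_vectors" and "herm q X Y \<noteq> 0"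
  obtains k x where "k \<noteq> 0" "f X = k *s opoint x" | k where "k \<noteq> 0" "f X = k *s e4"
proof -
  have "f X \<in> singular_vectors" "f X \<noteq> 0"
    using assms preserves_neq_0 by (auto simp: preserves_def)
  then show thesis
    by (cases rule: singular_vectorsE) (use that in blast)+
qed

text \<open>
  The maps \<^const>\<open>tmap\<close>, \<^const>\<open>dmap\<close> and \<^const>\<open>jmap\<close> act on the elliptic quadric as \<open>PGL(2, q\<^sup>2)\<close> on
  the projective line; sharp \<open>3\<close>-transitivity reduces to the case of a fixed frame.
\<close>

lemma permutes_fam_of_fixed_pair:
  assumes f: "preserves f" and fix1: "f (opoint 0) = a *s opoint 0" and fix4: "f e4 = d *s e4"
  shows "\<exists>s. permutes_fam s f"
proof -
  have nz: "herm q (opoint 1) e4 \<noteq> 0"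
    by (simp add: herm_opoint)
  obtain k y where ky: "k \<noteq> 0" "f (opoint 1) = k *s opoint y"
  proof (cases rule: preserves_singularE[OF f opoint_singular nz])
    case (2 k)
    have "herm q (f (opoint 1)) (f e4) = 1"
      by (simp add: preserves_herm[OF f] herm_opoint)
    then have False
      by (simp add: 2 fix4 herm_scale herm_opoint)
    then show thesis ..
  qed
  have "y \<noteq> 0"
  proof
    assume "y = 0"
    have "herm q (f (opoint 1)) (f (opoint 0)) = 1"
      by (simp add: preserves_herm[OF f] herm_opoint)
    then show False
      by (simp add: ky \<open>y = 0\<close> fix1 herm_scale herm_opoint)
  qed
  \<comment> \<open>With this b, \<open>dmap b\<close> takes the quadric point y to y b^2 =
    1.\<close>
  obtain b where b: "b\<^sup>2 = inverse y"
    using K.ex_square_root by blast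
  then have "b \<noteq> 0"
    using \<open>y \<noteq> 0\<close> by auto
  have "\<exists>s. permutes_fam s (dmap b \<circ> f)"
  proof (rule permutes_fam_of_fixed_frame)
    note dm = preserves_scale[OF isometry_preserves[OF isometry_dmap[OF \<open>b \<noteq> 0\<close>]]]
    show "preserves (dmap b \<circ> f)"
      by (intro preserves_comp isometry_preserves isometry_dmap f) fact
    show "(dmap b \<circ> f) (opoint 0) = (a * inverse (b * b ^ q)) *s opoint 0"
      by (simp only: o_apply fix1 dm dmap_opoint[OF \<open>b \<noteq> 0\<close>] mult_zero_left vector_smult_assoc)
    show "(dmap b \<circ> f) e4 = (d * (b * b ^ q)) *s e4"
      by (simp only: o_apply fix4 dm dmap_e4 vector_smult_assoc)
    show "(dmap b \<circ> f) (opoint 1) = (k * inverse (b * b ^ q)) *s opoint 1"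
      by (simp only: o_apply ky dm dmap_opoint[OF \<open>b \<noteq> 0\<close>] b right_inverse[OF \<open>y \<noteq> 0\<close>] vector_smult_assoc)
  qed
  moreover have "permutes_fam True (dmap (inverse b))"
    by (rule permutes_fam_dmap) (simp add: \<open>b \<noteq> 0\<close>)
  ultimately show ?thesis
    using dmap_inverse(2)[OF \<open>b \<noteq> 0\<close>] by (rule permutes_fam_of_comp)
qed

lemma permutes_fam_of_fixed_point:
  assumes f: "preserves f" and fix4: "f e4 = d *s e4"
  shows "\<exists>s. permutes_fam s f"
proof -
  have nz: "herm q (opoint 0) e4 \<noteq> 0"
    by (simp add: herm_opoint)
  obtain k y where ky: "k \<noteq> 0" "f (opoint 0) = k *s opoint y"
  proof (cases rule: preserves_singularE[OF f opoint_singular nz])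
    case (2 k)
    have "herm q (f (opoint 0)) (f e4) = 1"
      by (simp add: preserves_herm[OF f] herm_opoint)
    then have False
      by (simp add: 2 fix4 herm_scale herm_opoint)
    then show thesis ..
  qed
  have "\<exists>s. permutes_fam s (tmap y \<circ> f)"
  proof (rule permutes_fam_of_fixed_pair)
    note tm = preserves_scale[OF isometry_preserves[OF isometry_tmap]]
    show "preserves (tmap y \<circ> f)"
      by (intro preserves_comp isometry_preserves isometry_tmap f)
    show "(tmap y \<circ> f) (opoint 0) = k *s opoint 0"
      by (simp only: o_apply ky tm tmap_opoint K.add_self)
    show "(tmap y \<circ> f) e4 = d *s e4"
      by (simp only: o_apply fix4 tm tmap_e4)
  qed
  then show ?thesis
    by (rule permutes_fam_of_comp[OF _ permutes_fam_tmap tmap_tmap])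
qed

lemma preserves_permutes_fam:
  assumes f: "preserves f"
  shows "\<exists>s. permutes_fam s f"
proof -
  have nz: "herm q e4 (opoint 0) \<noteq> 0"
    by (simp add: herm_opoint)
  show ?thesis
  proof (cases rule: preserves_singularE[OF f e4_singular nz])
    case (1 k y)
    have "\<exists>s. permutes_fam s (jmap \<circ> (tmap y \<circ> f))"
    proof (rule permutes_fam_of_fixed_point)
      show "preserves (jmap \<circ> (tmap y \<circ> f))"
        by (intro preserves_comp isometry_preserves isometry_tmap isometry_jmap f)
      show "(jmap \<circ> (tmap y \<circ> f)) e4 = k *s e4"
        by (simp only: o_apply 1 preserves_scale[OF isometry_preserves[OF isometry_tmap]]
            preserves_scale[OF isometry_preserves[OF isometry_jmap]] tmap_opoint K.add_self jmap_opoint_0)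
    qed
    then have "\<exists>s. permutes_fam s (tmap y \<circ> f)"
      by (rule permutes_fam_of_comp[OF _ permutes_fam_jmap jmap_jmap])
    then show ?thesis
      by (rule permutes_fam_of_comp[OF _ permutes_fam_tmap tmap_tmap])
  next
    case (2 k)
    then show ?thesis
      using permutes_fam_of_fixed_point[OF f] by blast
  qed
qed

end

section \<open>Relative hemisystems as orbits\<close>

lemma mat_mult_vec: "mat c *v X = c *s (X :: 'a::field ^ 4)"
  by (simp add: vec_eq_iff_4 matrix_vector_mult_def mat_def sum_4)

lemma mat_mult_commute: "mat c ** A = (A :: 'a::field ^ 4 ^ 4) ** mat c"
  by (simp add: matrix_eq matrix_vector_mul_assoc[symmetric] mat_mult_vec vector_scalar_commute)

lemma mat_mult_mat: "mat c ** mat d = (mat (c * d) :: 'a::field ^ 4 ^ 4)"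
  by (simp add: matrix_eq matrix_vector_mul_assoc[symmetric] mat_mult_vec)

context field_tower
begin

abbreviation GU' :: "('k ^ 4 ^ 4) monoid" where
  "GU' \<equiv> GU q"

definition cls :: "'k ^ 4 ^ 4 \<Rightarrow> ('k ^ 4 ^ 4) set" where
  "cls A = GU_scalars q #>\<^bsub>GU q\<^esub> A"

lemma mult_GU [simp]: "mult (GU q) = ((**) :: 'k ^ 4 ^ 4 \<Rightarrow> _)"
  and one_GU [simp]: "one (GU q) = (mat 1 :: 'k ^ 4 ^ 4)"
  by (simp_all add: GU_def)

lemma one_scalar: "mat 1 \<in> (GU_scalars q :: ('k ^ 4 ^ 4) set)"
  using group.is_monoid[OF group_GU[of q, where 'k = 'k], THEN monoid.one_closed]
  by (auto simp: GU_scalars_def)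

lemma cls_eq: "cls A = {c ** A | c. c \<in> GU_scalars q}"
  by (auto simp: cls_def r_coset_def)

lemma carrier_PGU: "carrier (PGU q) = cls ` carrier GU'"
  by (simp add: PGU_def carrier_FactGroup cls_def)

lemma one_PGU: "one (PGU q) = cls (mat 1)"
  by (auto simp: PGU_def FactGroup_def cls_eq)

lemma mult_PGU:
  "mult (PGU q) (cls A) (cls B) = cls (A ** B)"
proof -
  have closed: "c ** d \<in> GU_scalars q" if "c \<in> GU_scalars q" "d \<in> GU_scalars q" for c d :: "'k ^ 4 ^ 4"
    using that monoid.m_closed[OF group.is_monoid[OF group_GU[of q, where 'k = 'k]], of c d]
    by (auto simp: GU_scalars_def mat_mult_mat)
  have comm: "(c ** A) ** (d ** B) = (c ** d) ** (A ** B)" if "d \<in> GU_scalars q" for c d :: "'k ^ 4 ^ 4"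
  proof -
    obtain x where "d = mat x"
      using \<open>d \<in> GU_scalars q\<close> by (auto simp: GU_scalars_def)
    then have "A ** d = d ** A"
      by (simp add: mat_mult_commute)
    then show ?thesis
      by (metis matrix_mul_assoc)
  qed
  have "cls A <#>\<^bsub>GU q\<^esub> cls B = cls (A ** B)"
  proof (intro equalityI subsetI)
    fix X
    assume "X \<in> cls A <#>\<^bsub>GU q\<^esub> cls B"
    then obtain c d where "c \<in> GU_scalars q" "d \<in> GU_scalars q" "X = (c ** A) ** (d ** B)"
      by (auto simp: set_mult_def cls_eq)
    then show "X \<in> cls (A ** B)"
      using comm closed by (auto simp: cls_eq)
  next
    fix X
    assume "X \<in> cls (A ** B)"
    then obtain c where "c \<in> GU_scalars q" "X = c ** (A ** B)"
      by (auto simp: cls_eq)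
    moreover have "mat 1 ** B \<in> cls B"
      unfolding cls_eq using one_scalar by blast
    ultimately have "X = (c ** A) ** (mat 1 ** B)" "c ** A \<in> cls A" "mat 1 ** B \<in> cls B"
      by (auto simp: cls_eq matrix_mul_assoc)
    then show "X \<in> cls A <#>\<^bsub>GU q\<^esub> cls B"
      by (auto simp: set_mult_def)
  qed
  then show ?thesis
    by (simp add: PGU_def FactGroup_def)
qed

lemma inv_PGU:
  assumes "A \<in> carrier GU'" and "B \<in> carrier GU'" and "B ** A = mat 1"
  shows "inv\<^bsub>PGU q\<^esub> (cls A) = cls B"
  by (rule group.inv_equality[OF group_PGU])
    (use assms in \<open>auto simp: mult_PGU one_PGU carrier_PGU\<close>)

lemma proj_act_cls:
  assumes "vec.subspace W"
  shows "proj_act (cls A) W = (*v) A ` W"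
proof (intro equalityI subsetI)
  fix Y
  assume "Y \<in> proj_act (cls A) W"
  then obtain c X where "X \<in> W" "Y = (mat c ** A) *v X"
    by (auto simp: proj_act_def cls_eq GU_scalars_def)
  then have "Y = A *v (c *s X)" "c *s X \<in> W"
    using vec.subspace_scale[OF assms]
    by (simp_all add: mat_mult_commute matrix_vector_mul_assoc[symmetric] mat_mult_vec)
  then show "Y \<in> (*v) A ` W"
    by blast
next
  fix Y
  assume "Y \<in> (*v) A ` W"
  moreover have "A \<in> cls A"
    using one_scalar unfolding cls_eq by (metis (mono_tags, lifting) matrix_mul_lid mem_Collect_eq)
  ultimately show "Y \<in> proj_act (cls A) W"
    unfolding proj_act_def by blast
qed

lemma subspace_image_matrix:
  fixes A :: "'k ^ 4 ^ 4"
  assumes "vec.subspace W"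
  shows "vec.subspace ((*v) A ` W)"
proof (rule vec.subspaceI)
  show "0 \<in> (*v) A ` W"
    using vec.subspace_0[OF assms] by (metis imageI matrix_vector_mult_0_right)
  show "x + y \<in> (*v) A ` W" if "x \<in> (*v) A ` W" "y \<in> (*v) A ` W" for x y
    using that vec.subspace_add[OF assms]
    by (auto simp: matrix_vector_right_distrib[symmetric])
  show "c *s x \<in> (*v) A ` W" if "x \<in> (*v) A ` W" for c x
    using that vec.subspace_scale[OF assms] by (auto simp: vector_scalar_commute[symmetric])
qed

lemma span_image_matrix: "(*v) (A :: 'k ^ 4 ^ 4) ` vec.span U = vec.span ((*v) A ` (U :: ('k ^ 4) set))"
proof
  show "vec.span ((*v) A ` U) \<subseteq> (*v) A ` vec.span U"
    by (rule vec.span_minimal) (auto intro: vec.span_base subspace_image_matrix)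
  have "A *v X \<in> vec.span ((*v) A ` U)" if "X \<in> vec.span U" for X
    using that
  proof (induction rule: vec.span_induct_alt)
    case base
    show ?case
      by (simp add: vec.span_zero)
  next
    case (step c x y)
    then show ?case
      by (simp add: matrix_vector_right_distrib vector_scalar_commute vec.span_add vec.span_scale vec.span_base)
  qed
  then show "(*v) A ` vec.span U \<subseteq> vec.span ((*v) A ` U)"
    by blast
qed

lemma matrix_isometry [simp]: "isometry f \<Longrightarrow> matrix f *v X = f X"
  by (simp add: isometry_def matrix_works)

lemma matrix_isometry_mult:
  assumes "isometry f" and "isometry g" and "\<And>X. f (g X) = X"
  shows "matrix f ** matrix g = mat 1"
  using assms by (simp add: matrix_eq matrix_vector_mul_assoc[symmetric])

lemma matrix_isometry_in_GU:
  assumes "isometry f" and "isometry g" and "\<And>X. f (g X) = X" and "\<And>X. g (f X) = X"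
  shows "matrix f \<in> carrier GU'"
proof -
  have "invertible (matrix f)"
    unfolding invertible_def using assms matrix_isometry_mult by blast
  with assms(1) show ?thesis
    by (simp add: GU_def herm_isometry)
qed

lemma singular_extensions_subspace: "W \<in> singular_extensions q \<Longrightarrow> vec.subspace (W :: ('k ^ 4) set)"
  by (auto simp: singular_extensions_def)

lemma PO_minus_cls_iff:
  assumes "A \<in> carrier GU'"
  shows "cls A \<in> PO_minus q \<longleftrightarrow> (`) ((*v) A) ` singular_extensions q = singular_extensions q"
proof -
  have "proj_act (cls A) ` singular_extensions q = (`) ((*v) A) ` singular_extensions q"
    by (intro image_cong refl proj_act_cls singular_extensions_subspace)
  with assms show ?thesis
    by (simp add: PO_minus_def stabilizer_def carrier_PGU)
qed

lemma isometry_singular_extensions: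
  assumes "isometry f" and "W \<in> singular_extensions q"
  shows "f ` W \<in> singular_extensions q"
proof -
  obtain U where U: "W = vec.span U" "Vhat_subspace q U" "\<forall>u\<in>U. Qhat q u = 0"
    using assms(2) by (auto simp: singular_extensions_def)
  have lin: "f (X + Y) = f X + f Y" "f (c *s X) = c *s f X" for X Y c
    using assms(1) by (simp_all add: isometry_def linear_vecD)
  have f0: "f 0 = 0"
    using lin(2)[of 0 0] by simp
  have sg: "sg (f X) = f (sg X)" "qform (f X) = qform X" for X
    using assms(1) by (simp_all add: isometry_def)
  have "f ` W = vec.span (f ` U)"
    using span_image_matrix[of "matrix f" U] assms(1) by (simp add: U(1))
  moreover have "Vhat_subspace q (f ` U)"
    unfolding Vhat_subspace_def
  proof (intro conjI ballI)
    show "f ` U \<subseteq> Vhat q"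
      using U(2) by (auto simp: Vhat_subspace_def Vhat_eq sg)
    show "0 \<in> f ` U"
      using U(2) f0 by (metis Vhat_subspace_def imageI)
    show "x + y \<in> f ` U" if "x \<in> f ` U" "y \<in> f ` U" for x y
      using that U(2) by (auto simp: Vhat_subspace_def lin(1)[symmetric])
    show "c *s x \<in> f ` U" if "c \<in> GF q" "x \<in> f ` U" for c x
      using that U(2) by (auto simp: Vhat_subspace_def lin(2)[symmetric])
  qed
  moreover have "Qhat q (f u) = 0" if "u \<in> U" for u
  proof -
    have "sg u = u"
      using that U(2) by (auto simp: Vhat_subspace_def Vhat_eq)
    with that U(3) show ?thesis
      by (metis Qhat_eq sg)
  qed
  ultimately show ?thesis
    unfolding singular_extensions_def by blast
qed

lemma isometry_in_PO_minus:
  assumes "isometry f" and "isometry g" and "\<And>X. f (g X) = X" and "\<And>X. g (f X) = X"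
  shows "cls (matrix f) \<in> PO_minus q"
proof -
  have f: "(*v) (matrix f) = f"
    using assms(1) by auto
  have "(`) f ` singular_extensions q = singular_extensions q"
  proof (intro equalityI subsetI)
    fix W :: "('k ^ 4) set"
    assume "W \<in> singular_extensions q"
    then have "g ` W \<in> singular_extensions q"
      by (rule isometry_singular_extensions[OF assms(2)])
    moreover have "W = f ` (g ` W)"
      by (simp add: image_image assms(3))
    ultimately show "W \<in> (`) f ` singular_extensions q"
      by blast
  qed (use isometry_singular_extensions[OF assms(1)] in auto)
  then show ?thesis
    by (simp only: PO_minus_cls_iff[OF matrix_isometry_in_GU[OF assms]] f)
qed

text \<open>A singular v in \<open>Vhat q\<close> spans a singular extension, which A maps to
  another one. That one contains a nonzero singular vector u of \<open>Vhat q\<close>, and u is a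
  multiple of A v; no more than a multiple can be expected.\<close>

lemma PO_minus_preserves:
  assumes A: "A \<in> carrier GU'" and PO: "cls A \<in> PO_minus q"
  shows "preserves ((*v) A)"
proof -
  have "(`) ((*v) A) ` singular_extensions q = singular_extensions q"
    using PO_minus_cls_iff[OF A] PO by simp
  then have SE: "(*v) A ` W \<in> singular_extensions q" if "W \<in> singular_extensions q" for W
    using that by blast
  have inj: "X = 0" if "A *v X = 0" for X
  proof -
    obtain B where "B ** A = mat 1"
      using A by (auto simp: GU_def invertible_def)
    then have "X = B *v (A *v X)"
      by (simp add: matrix_vector_mul_assoc)
    with that show ?thesis
      by simp
  qed
  have sing: "A *v v \<in> singular_vectors" if v: "sg v = v" "qform v = 0" for v
  proof (cases "v = 0")
    case True
    then show ?thesis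
      by (simp add: singular_vectorsI qform_def)
  next
    case False
    let ?U = "{c *s v | c. c \<in> GF q}"
    have "Vhat_subspace q ?U"
      unfolding Vhat_subspace_def
    proof (intro conjI ballI)
      show "?U \<subseteq> Vhat q"
        by (auto simp: Vhat_eq GF_def v(1))
      show "0 \<in> ?U"
        by (auto simp: GF_def intro!: exI[of _ 0])
      show "x + y \<in> ?U" if "x \<in> ?U" "y \<in> ?U" for x y
        using that by (auto simp: GF_def vector_sadd_rdistrib[symmetric] simp del: vector_sadd_rdistrib)
      show "c *s x \<in> ?U" if "c \<in> GF q" "x \<in> ?U" for c x
        using that by (auto simp: GF_def power_mult_distrib)
    qed
    moreover have "Qhat q u = 0" if "u \<in> ?U" for u
    proof -
      obtain c where c: "u = c *s v" "c ^ q = c"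
        using \<open>u \<in> ?U\<close> by (auto simp: GF_def)
      then have "sg u = u"
        by (simp add: v(1))
      then have "Qhat q u = qform u"
        by (rule Qhat_eq)
      also have "\<dots> = c * c * qform v"
        by (simp add: qform_def c(1) algebra_simps)
      finally show ?thesis
        by (simp add: v(2))
    qed
    ultimately have "vec.span ?U \<in> singular_extensions q"
      unfolding singular_extensions_def by blast
    moreover have "vec.span ?U = vec.span {v}"
    proof
      show "vec.span ?U \<subseteq> vec.span {v}"
        by (rule vec.span_minimal) (auto intro: vec.span_scale vec.span_base)
      have "v \<in> ?U"
        by (auto simp: GF_def intro!: exI[of _ 1])
      then show "vec.span {v} \<subseteq> vec.span ?U"
        by (simp add: vec_span_singleton_subset vec.span_base)
    qed
    ultimately have "(*v) A ` vec.span {v} \<in> singular_extensions q"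
      by (simp only: SE)
    then obtain U' where U': "(*v) A ` vec.span {v} = vec.span U'" "Vhat_subspace q U'" "\<forall>u\<in>U'. Qhat q u = 0"
      by (auto simp: singular_extensions_def)
    have "A *v v \<noteq> 0"
      using inj False by blast
    have "A *v v \<in> vec.span U'"
      unfolding U'(1)[symmetric] by (intro imageI vec.span_base) simp
    then obtain u where u: "u \<in> U'" "u \<noteq> 0"
      using \<open>A *v v \<noteq> 0\<close> vec.span_mono[of U' "{0}"] by auto
    then have "u \<in> (*v) A ` vec.span {v}"
      by (simp add: U'(1) vec.span_base)
    then obtain k where "u = A *v (k *s v)"
      unfolding vec.span_singleton by blast
    then have k: "u = k *s (A *v v)"
      by (simp only: vector_scalar_commute)
    with u(2) have "k \<noteq> 0"
      by auto
    then have "A *v v = inverse k *s u"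
      by (simp add: k)
    moreover have "sg u = u"
      using u(1) U'(2) by (auto simp: Vhat_subspace_def Vhat_eq)
    moreover from this have "qform u = 0"
      using u(1) U'(3) by (metis Qhat_eq)
    ultimately show ?thesis
      unfolding singular_vectors_def by blast
  qed
  have "A *v X \<in> singular_vectors" if X: "X \<in> singular_vectors" for X
  proof -
    obtain k v where kv: "X = k *s v" "sg v = v" "qform v = 0"
      using X by (auto simp: singular_vectors_def)
    obtain k' v' where "A *v v = k' *s v'" "sg v' = v'" "qform v' = 0"
      using sing[OF kv(2,3)] by (auto simp: singular_vectors_def)
    then have "A *v X = (k * k') *s v'"
      by (simp add: kv vector_scalar_commute)
    then show ?thesis
      unfolding singular_vectors_def using \<open>sg v' = v'\<close> \<open>qform v' = 0\<close> by blast
  qed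
  then show ?thesis
    using A by (auto simp: preserves_def GU_def)
qed

lemma PO_minus_subset: "PO_minus q \<subseteq> carrier (PGU q :: ('k ^ 4 ^ 4) set monoid)"
  by (auto simp: PO_minus_def stabilizer_def)

section \<open>Signs of projective classes\<close>

definition proj_permutes_fam :: "bool \<Rightarrow> ('k ^ 4 ^ 4) set \<Rightarrow> bool" where
  "proj_permutes_fam s g \<longleftrightarrow> g \<in> carrier (PGU q) \<and> (\<forall>u. proj_act g ` fam u = fam (u = s))"

lemma subspace_fam: "l \<in> fam u \<Longrightarrow> vec.subspace l"
  by (cases u) (auto simp: fam_def fam1_def fam2_def subspace_pline)

lemma proj_permutes_fam_cls:
  assumes "A \<in> carrier GU'"
  shows "proj_permutes_fam s (cls A) \<longleftrightarrow> permutes_fam s ((*v) A)"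
proof -
  have "proj_act (cls A) ` fam u = (`) ((*v) A) ` fam u" for u
    by (intro image_cong refl proj_act_cls subspace_fam)
  with assms show ?thesis
    by (simp add: proj_permutes_fam_def permutes_fam_def carrier_PGU)
qed

lemma PO_minus_permutes_fam:
  assumes "g \<in> PO_minus q"
  shows "\<exists>s. proj_permutes_fam s g"
proof -
  obtain A where A: "A \<in> carrier GU'" "g = cls A"
    using assms PO_minus_subset by (auto simp: carrier_PGU)
  then show ?thesis
    using preserves_permutes_fam[OF PO_minus_preserves] assms proj_permutes_fam_cls by blast
qed

lemma proj_permutes_fam_mult:
  assumes "proj_permutes_fam s g" and "proj_permutes_fam s' g'"
  shows "proj_permutes_fam (s = s') (g \<otimes>\<^bsub>PGU q\<^esub> g')"
proof -
  obtain A B where A: "A \<in> carrier GU'" "g = cls A" and B: "B \<in> carrier GU'" "g' = cls B"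
    using assms by (auto simp: proj_permutes_fam_def carrier_PGU)
  have "A ** B \<in> carrier GU'"
    using A B monoid.m_closed[OF group.is_monoid[OF group_GU[of q, where 'k = 'k]], of A B] by simp
  moreover have "(*v) (A ** B) = (*v) A \<circ> (*v) B"
    by (simp add: fun_eq_iff matrix_vector_mul_assoc)
  ultimately show ?thesis
    using assms permutes_fam_comp by (simp add: A B mult_PGU proj_permutes_fam_cls)
qed

lemma proj_permutes_fam_one: "proj_permutes_fam True \<one>\<^bsub>PGU q\<^esub>"
proof -
  have "mat 1 \<in> carrier GU'"
    using one_scalar by (auto simp: GU_scalars_def)
  moreover have "(*v) (mat 1) = (id :: 'k ^ 4 \<Rightarrow> _)"
    by (simp add: fun_eq_iff)
  ultimately show ?thesis
    by (simp add: one_PGU proj_permutes_fam_cls permutes_fam_def)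
qed

lemma proj_permutes_fam_inv:
  assumes "proj_permutes_fam s g"
  shows "proj_permutes_fam s (inv\<^bsub>PGU q\<^esub> g)"
proof -
  interpret P: group "PGU q :: ('k ^ 4 ^ 4) set monoid"
    by (rule group_PGU)
  obtain A where A: "A \<in> carrier GU'" "g = cls A"
    using assms by (auto simp: proj_permutes_fam_def carrier_PGU)
  obtain B where B: "B \<in> carrier GU'" "B ** A = mat 1"
    using group.l_inv_ex[OF group_GU[of q, where 'k = 'k] A(1)] by auto
  have img: "(`) ((*v) B) ` fam (u = s) = fam u" for u
  proof -
    have "(`) ((*v) A) ` fam u = fam (u = s)"
      using assms by (simp add: A proj_permutes_fam_cls permutes_fam_def)
    then have "(`) ((*v) B) ` fam (u = s) = (`) ((*v) B) ` (`) ((*v) A) ` fam u"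
      by (simp only:)
    also have "\<dots> = fam u"
      by (simp add: image_image matrix_vector_mul_assoc B(2))
    finally show ?thesis .
  qed
  have "((u = s) = s) = u" for u
    by auto
  with img[of "_ = s"] have "(`) ((*v) B) ` fam u = fam (u = s)" for u
    by simp
  then have "permutes_fam s ((*v) B)"
    by (simp add: permutes_fam_def)
  then show ?thesis
    using proj_permutes_fam_cls[OF B(1)] inv_PGU[OF A(1) B] by (simp add: A(2))
qed

text \<open>An inverse has the same sign, so both signs occur twice in a commutator and
  cancel.\<close>

lemma commutator_permutes_fam:
  assumes "c \<in> derived_set (PGU q) (PO_minus q)"
  shows "proj_permutes_fam True c"
proof -
  obtain g1 g2 where g: "g1 \<in> PO_minus q" "g2 \<in> PO_minus q"
    "c = g1 \<otimes>\<^bsub>PGU q\<^esub> g2 \<otimes>\<^bsub>PGU q\<^esub> inv\<^bsub>PGU q\<^esub> g1 \<otimes>\<^bsub>PGU q\<^esub> inv\<^bsub>PGU q\<^esub> g2"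
    using assms by auto
  obtain s1 s2 where s: "proj_permutes_fam s1 g1" "proj_permutes_fam s2 g2"
    using g PO_minus_permutes_fam by blast
  have "proj_permutes_fam (((s1 = s2) = s1) = s2) c"
    unfolding g(3) by (intro proj_permutes_fam_mult proj_permutes_fam_inv s)
  moreover have "(((s1 = s2) = s1) = s2) = True"
    by auto
  ultimately show ?thesis
    by (simp only:)
qed

lemma POmega_permutes_fam:
  assumes "g \<in> POmega_minus q"
  shows "proj_permutes_fam True g"
  using assms unfolding POmega_minus_def derived_def
proof (induction rule: generate.induct)
  case one
  show ?case
    by (rule proj_permutes_fam_one)
next
  case (incl c)
  then show ?case
    by (rule commutator_permutes_fam)
next
  case (inv c)
  then show ?case
    by (intro proj_permutes_fam_inv commutator_permutes_fam)
next
  case (eng g1 g2)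
  then show ?case
    using proj_permutes_fam_mult[of True g1 True g2] by simp
qed

section \<open>Explicit commutators and transitivity\<close>

lemma commutator_in_POmega:
  assumes f: "isometry f" "isometry f'" "\<And>X. f (f' X) = X" "\<And>X. f' (f X) = X"
    and g: "isometry g" "isometry g'" "\<And>X. g (g' X) = X" "\<And>X. g' (g X) = X"
    and k: "isometry k" "\<And>X. f (g (f' (g' X))) = k X"
  shows "cls (matrix k) \<in> POmega_minus q"
proof -
  have inv: "inv\<^bsub>PGU q\<^esub> (cls (matrix f)) = cls (matrix f')" "inv\<^bsub>PGU q\<^esub> (cls (matrix g)) = cls (matrix g')"
    by (rule inv_PGU[OF matrix_isometry_in_GU[OF f] matrix_isometry_in_GU[OF f(2,1,4,3)] matrix_isometry_mult[OF f(2,1,4)]],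
        rule inv_PGU[OF matrix_isometry_in_GU[OF g] matrix_isometry_in_GU[OF g(2,1,4,3)] matrix_isometry_mult[OF g(2,1,4)]])
  have "matrix f ** matrix g ** matrix f' ** matrix g' = matrix k"
    using f g k by (simp add: matrix_eq matrix_vector_mul_assoc[symmetric])
  then have "cls (matrix k) = cls (matrix f) \<otimes>\<^bsub>PGU q\<^esub> cls (matrix g) \<otimes>\<^bsub>PGU q\<^esub>
      inv\<^bsub>PGU q\<^esub> (cls (matrix f)) \<otimes>\<^bsub>PGU q\<^esub> inv\<^bsub>PGU q\<^esub> (cls (matrix g))"
    by (simp only: inv mult_PGU)
  moreover have "cls (matrix f) \<in> PO_minus q" "cls (matrix g) \<in> PO_minus q"
    by (rule isometry_in_PO_minus[OF f], rule isometry_in_PO_minus[OF g])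
  ultimately have "cls (matrix k) \<in> derived_set (PGU q) (PO_minus q)"
    by blast
  then show ?thesis
    unfolding POmega_minus_def derived_def by (rule generate.incl)
qed

text \<open>Conjugation by \<open>dmap w\<close> turns translation by c into translation by w^2 c,
  so the commutator is translation by (w^2 + 1) c. Every b arises once w^2 is not 1, which holds for
  w outside GF(q).\<close>

lemma tmap_in_POmega: "cls (matrix (tmap b)) \<in> POmega_minus q"
proof -
  obtain w :: 'k where w: "w ^ q \<noteq> w"
    using ex_power_q_neq by blast
  then have "w \<noteq> 0"
    by auto
  have "w\<^sup>2 + 1 \<noteq> 0"
  proof
    assume "w\<^sup>2 + 1 = 0"
    moreover have "(w + 1)\<^sup>2 = w\<^sup>2 + 1"
      by (simp add: power2_eq_square algebra_simps)
    ultimately have "w = 1"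
      by simp
    with w show False
      by simp
  qed
  define c where "c = b / (w\<^sup>2 + 1)"
  have b: "b = w * w * c + c"
    using \<open>w\<^sup>2 + 1 \<noteq> 0\<close> by (simp add: c_def power2_eq_square add_divide_distrib[symmetric] flip: distrib_left distrib_right)
      (simp add: field_simps)
  show ?thesis
  proof (rule commutator_in_POmega)
    show "isometry (dmap w)" "isometry (dmap (inverse w))" "isometry (tmap c)" "isometry (tmap c)" "isometry (tmap b)"
      using \<open>w \<noteq> 0\<close> by (simp_all add: isometry_dmap isometry_tmap)
    show "dmap w (tmap c (dmap (inverse w) (tmap c X))) = tmap b X" for X
      using \<open>w \<noteq> 0\<close> unfolding b
      by (simp add: vec_eq_iff_4 power_inverse power_mult_distrib) (simp add: field_simps)
  qed (use \<open>w \<noteq> 0\<close> in \<open>simp_all add: dmap_inverse tmap_tmap\<close>)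
qed

text \<open>Conjugation by \<open>jmap\<close> inverts \<open>dmap a\<close>, so the commutator is
  \<open>dmap\<close> at a^(-2), and every element of the small field is a square.\<close>

lemma dmap_in_POmega:
  assumes "b \<noteq> 0"
  shows "cls (matrix (dmap b)) \<in> POmega_minus q"
proof -
  obtain a where a: "a\<^sup>2 = inverse b"
    using K.ex_square_root by blast
  then have b: "b = inverse a * inverse a" "a \<noteq> 0"
    using assms by (auto simp: power2_eq_square nonzero_inverse_mult_distrib[symmetric])
      (metis inverse_inverse_eq inverse_mult_distrib)
  show ?thesis
  proof (rule commutator_in_POmega)
    show "isometry jmap" "isometry jmap" "isometry (dmap a)" "isometry (dmap (inverse a))" "isometry (dmap b)"
      using b(2) assms by (simp_all add: isometry_dmap isometry_jmap)
    show "jmap (dmap a (jmap (dmap (inverse a) X))) = dmap b X" for X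
      using b(2) unfolding b(1)
      by (simp add: vec_eq_iff_4 power_inverse power_mult_distrib) (simp add: field_simps)
  qed (use b(2) in \<open>simp_all add: dmap_inverse jmap_jmap\<close>)
qed

lemma affine_transitive:
  assumes "s \<notin> range \<epsilon>" and "t \<notin> range \<epsilon>"
  obtains b c where "b \<noteq> 0" "s = t * \<epsilon> b + \<epsilon> c"
proof -
  obtain c b where cb: "s = \<epsilon> c * 1 + \<epsilon> b * t"
    using ex_coordinates[of 1 t] assms(2) by (metis div_by_1 one_neq_zero)
  have "b \<noteq> 0"
  proof
    assume "b = 0"
    with cb have "s = \<epsilon> c"
      by simp
    with assms(1) show False
      by blast
  qed
  with cb show ?thesis
    by (intro that[of b c]) (simp_all add: add.commute mult.commute)
qed

lemma fam_transitive:
  assumes "l \<in> fam u" and "m \<in> fam u"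
  obtains g where "g \<in> POmega_minus q" "proj_act g l = m"
proof -
  have act: "proj_act (cls (matrix (tmap c)) \<otimes>\<^bsub>PGU q\<^esub> cls (matrix (dmap b))) l = tmap c ` dmap b ` l"
    if "b \<noteq> 0" for b c
  proof -
    have "(*v) (matrix (tmap c) ** matrix (dmap b)) = tmap c \<circ> dmap b"
      using that by (simp add: fun_eq_iff matrix_vector_mul_assoc[symmetric] isometry_tmap isometry_dmap)
    then show ?thesis
      using subspace_fam[OF assms(1)] by (simp add: mult_PGU proj_act_cls image_comp)
  qed
  have mem: "cls (matrix (tmap c)) \<otimes>\<^bsub>PGU q\<^esub> cls (matrix (dmap b)) \<in> POmega_minus q" if "b \<noteq> 0" for b c
    using tmap_in_POmega dmap_in_POmega[OF that] unfolding POmega_minus_def derived_def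
    by (rule generate.eng)
  have "\<exists>b c. b \<noteq> 0 \<and> tmap c ` dmap b ` l = m"
  proof (cases u)
    case True
    obtain t where t: "l = pline t (t ^ q)" "t \<notin> range \<epsilon>"
      using assms(1) True by (auto simp: fam_def fam1_def)
    obtain s where s: "m = pline s (s ^ q)" "s \<notin> range \<epsilon>"
      using assms(2) True by (auto simp: fam_def fam1_def)
    obtain b c where bc: "b \<noteq> 0" "s = t * \<epsilon> b + \<epsilon> c"
      using affine_transitive[OF s(2) t(2)] .
    \<comment> \<open>In this family the first parameter carries t, and \<open>dmap d\<close> scales
      it by (d^q)^2; hence d^2 has to be b^q, and likewise the translation below uses c^q.\<close>
    obtain d where d: "d\<^sup>2 = b ^ q"
      using K.ex_square_root by blast
    have "d \<noteq> 0"
      using d bc(1) by auto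
    have e: "\<epsilon> (d ^ q) ^ 2 = \<epsilon> b" "\<epsilon> d ^ 2 = \<epsilon> (b ^ q)"
    proof -
      have "(d ^ q)\<^sup>2 = (d\<^sup>2) ^ q"
        by (simp add: power_mult[symmetric] mult.commute)
      also have "\<dots> = b"
        by (simp only: d power_q_q)
      finally show "\<epsilon> (d ^ q) ^ 2 = \<epsilon> b"
        by (simp only: eps_power[symmetric])
      show "\<epsilon> d ^ 2 = \<epsilon> (b ^ q)"
        by (simp only: eps_power[symmetric] d)
    qed
    have "tmap (c ^ q) ` dmap d ` l = pline (t * \<epsilon> b + \<epsilon> ((c ^ q) ^ q)) (t ^ q * \<epsilon> (b ^ q) + \<epsilon> (c ^ q))"
      by (simp only: t dmap_pline[OF \<open>d \<noteq> 0\<close>] tmap_pline e)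
    also have "\<dots> = m"
      by (simp add: s bc power_mult_distrib)
    finally show ?thesis
      using \<open>d \<noteq> 0\<close> by blast
  next
    case False
    obtain t where t: "l = pline (t ^ q) t" "t \<notin> range \<epsilon>"
      using assms(1) False by (auto simp: fam_def fam2_def)
    obtain s where s: "m = pline (s ^ q) s" "s \<notin> range \<epsilon>"
      using assms(2) False by (auto simp: fam_def fam2_def)
    obtain b c where bc: "b \<noteq> 0" "s = t * \<epsilon> b + \<epsilon> c"
      using affine_transitive[OF s(2) t(2)] .
    obtain d where d: "d\<^sup>2 = b"
      using K.ex_square_root by blast
    have "d \<noteq> 0"
      using d bc(1) by auto
    have e: "\<epsilon> (d ^ q) ^ 2 = \<epsilon> (b ^ q)" "\<epsilon> d ^ 2 = \<epsilon> b"
    proof -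
      have "(d ^ q)\<^sup>2 = (d\<^sup>2) ^ q"
        by (simp add: power_mult[symmetric] mult.commute)
      then show "\<epsilon> (d ^ q) ^ 2 = \<epsilon> (b ^ q)"
        by (simp only: eps_power[symmetric] d)
      show "\<epsilon> d ^ 2 = \<epsilon> b"
        by (simp only: eps_power[symmetric] d)
    qed
    have "tmap c ` dmap d ` l = pline (t ^ q * \<epsilon> (b ^ q) + \<epsilon> (c ^ q)) (t * \<epsilon> b + \<epsilon> c)"
      by (simp only: t dmap_pline[OF \<open>d \<noteq> 0\<close>] tmap_pline e)
    also have "\<dots> = m"
      by (simp add: s bc power_mult_distrib)
    finally show ?thesis
      using \<open>d \<noteq> 0\<close> by blast
  qed
  with act mem that show ?thesis
    by blast
qed

lemma relative_hemisystem_eq_fam: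
  assumes "H \<in> relative_hemisystems q"
  shows "H = fam1 \<or> H = fam2"
proof -
  obtain l where l: "l \<in> external_lines q" "H = {proj_act g l | g. g \<in> POmega_minus q}"
    using assms by (auto simp: relative_hemisystems_def orbits_def orbit_def)
  have "\<exists>u. l \<in> fam u"
    using l(1) external_lines_subset unfolding fam_def by (metis (full_types) UnE subsetD)
  then obtain u where u: "l \<in> fam u"
    by blast
  have "proj_act g l \<in> fam u" if "g \<in> POmega_minus q" for g
    using POmega_permutes_fam[OF that] u unfolding proj_permutes_fam_def by (metis (full_types) imageI)
  moreover have "\<exists>g. g \<in> POmega_minus q \<and> proj_act g l = m" if "m \<in> fam u" for m
    using fam_transitive[OF u that] by blast
  ultimately have "H = fam u"
    unfolding l(2) by blast
  then show ?thesis
    by (simp add: fam_def split: if_splits)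
qed

end

section \<open>The isomorphism\<close>

lemma scheme_isoI:
  assumes bij: "bij_betw \<phi> X X'"
    and "\<And>i. i \<le> d \<Longrightarrow> R i \<subseteq> X \<times> X" and "\<And>i. i \<le> d \<Longrightarrow> R' i \<subseteq> X' \<times> X'"
    and iff: "\<And>i x y. i \<le> d \<Longrightarrow> x \<in> X \<Longrightarrow> y \<in> X \<Longrightarrow> (x, y) \<in> R i \<longleftrightarrow> (\<phi> x, \<phi> y) \<in> R' i"
  shows "scheme_iso d X R X' R' \<phi>"
  unfolding scheme_iso_def
proof (intro conjI allI impI)
  fix i
  assume i: "i \<le> d"
  have "{(\<phi> x, \<phi> y) | x y. (x, y) \<in> R i} = R' i"
  proof (intro equalityI subsetI)
    fix p
    assume "p \<in> {(\<phi> x, \<phi> y) | x y. (x, y) \<in> R i}"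
    then show "p \<in> R' i"
      using iff[OF i] assms(2)[OF i] by auto
  next
    fix p
    assume p: "p \<in> R' i"
    then obtain x' y' where xy': "p = (x', y')" "x' \<in> X'" "y' \<in> X'"
      using assms(3)[OF i] by auto
    then obtain x y where "x' = \<phi> x" "y' = \<phi> y" "x \<in> X" "y \<in> X"
      using bij_betw_imp_surj_on[OF bij] by blast
    then show "p \<in> {(\<phi> x, \<phi> y) | x y. (x, y) \<in> R i}"
      using p iff[OF i] xy'(1) by blast
  qed
  with i show "\<exists>j\<le>d. {(\<phi> x, \<phi> y) | x y. (x, y) \<in> R i} = R' j"
    by blast
qed (rule bij)

lemma le_3_cases: "i \<le> 3 \<Longrightarrow> i = 0 \<or> i = 1 \<or> i = 2 \<or> i = (3 :: nat)"
  by auto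

context conjugation
begin

text \<open>For pairs of equal lines: a line shares more than one point with itself, so the diagonal
  lies in none of the relations 1 to 3.\<close>

lemma card_proj_points_hline:
  assumes "s \<notin> range \<epsilon>"
  shows "card (proj_points (hline s)) \<noteq> 1" and "proj_points (hline s) \<noteq> {}"
proof -
  obtain w where w: "w \<notin> range \<epsilon>"
    using ex_not_range by blast
  then have "w \<noteq> 0"
    using eps_0 by (metis rangeI)
  then have nz: "pt s 1 \<noteq> 0" "pt s w \<noteq> 0"
    using pt_eq_0[OF assms] by (metis one_neq_zero)+
  then have pts: "vec.span {pt s 1} \<in> proj_points (hline s)" "vec.span {pt s w} \<in> proj_points (hline s)"
    using pt_in_hline by (auto simp: proj_points_eq subspace_hline)
  then show "proj_points (hline s) \<noteq> {}"
    by blast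
  show "card (proj_points (hline s)) \<noteq> 1"
  proof
    assume "card (proj_points (hline s)) = 1"
    then have "vec.span {pt s 1} = vec.span {pt s w}"
      using pts by (metis card_1_singletonE singletonD)
    then have "pt s w \<in> vec.span {pt s 1}"
      by (simp add: vec.span_base)
    then obtain k where "pt s w = pt s (\<epsilon> k * 1)"
      unfolding vec.span_singleton pt_scale by blast
    then have "w = \<epsilon> k"
      using pt_inj[OF assms] by simp
    with w show False
      by blast
  qed
qed

lemma hx_rel_iff_pw_rel:
  assumes s: "s \<notin> range \<epsilon>" and t: "t \<notin> range \<epsilon>" and H: "hline s \<in> H" "hline t \<in> H" and i: "i \<le> 3"
  shows "(ell s, ell t) \<in> hx_rel h \<epsilon> i \<longleftrightarrow> (hline s, hline t) \<in> pw_rel q H i"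
proof (cases "s = t \<or> s = bar t")
  case True
  then have "ell s = ell t" "hline s = hline t"
    by (auto simp: ell_bar hline_bar)
  moreover have "ell t \<in> elliptic_lines \<epsilon>"
    using t by (auto simp: elliptic_lines_eq)
  ultimately show ?thesis
    using le_3_cases[OF i] H card_proj_points_hline[OF t]
    by (auto simp: hx_rel_def pw_rel_def hx_related_def numeral_3_eq_3)
next
  case False
  then have "s \<noteq> t" "s \<noteq> bar t"
    by auto
  note st = s t this
  have "ell s \<noteq> ell t" "hline s \<noteq> hline t"
    using False by (simp_all add: ell_eq_iff[OF s t] hline_eq_iff[OF s])
  then have "(ell s, ell t) \<notin> hx_rel h \<epsilon> 0" "(hline s, hline t) \<notin> pw_rel q H 0"
    by (auto simp: hx_rel_def pw_rel_def)
  then show ?thesis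
    using le_3_cases[OF i] hx_rel_ell_iff[OF st] pw_rel_hline_iff[OF st H] by auto
qed

lemma scheme_isomorphism:
  assumes H: "H = hline ` (- range \<epsilon>)"
  shows "\<exists>\<psi>. scheme_iso 3 (elliptic_lines \<epsilon>) (hx_rel h \<epsilon>) H (pw_rel q H) \<psi> \<and>
    (\<forall>i\<le>3. \<forall>l\<in>elliptic_lines \<epsilon>. \<forall>l'\<in>elliptic_lines \<epsilon>. (l, l') \<in> hx_rel h \<epsilon> i \<longleftrightarrow> (\<psi> l, \<psi> l') \<in> pw_rel q H i)"
proof -
  \<comment> \<open>The chosen t does not matter, because \<open>ell\<close> and
    \<open>hline\<close> identify parameters by the same rule, t with \<open>bar t\<close>.\<close>
  define \<psi> where "\<psi> l = hline (SOME t. t \<notin> range \<epsilon> \<and> ell t = l)" for l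
  have \<psi>: "\<psi> (ell t) = hline t" if "t \<notin> range \<epsilon>" for t
  proof -
    have "\<exists>u. u \<notin> range \<epsilon> \<and> ell u = ell t"
      using that by blast
    then have "(SOME u. u \<notin> range \<epsilon> \<and> ell u = ell t) \<notin> range \<epsilon> \<and> ell (SOME u. u \<notin> range \<epsilon> \<and> ell u = ell t) = ell t"
      by (rule someI_ex)
    then show ?thesis
      unfolding \<psi>_def using ell_eq_iff hline_eq_iff that by blast
  qed
  have iff: "(l, l') \<in> hx_rel h \<epsilon> i \<longleftrightarrow> (\<psi> l, \<psi> l') \<in> pw_rel q H i"
    if "i \<le> 3" "l \<in> elliptic_lines \<epsilon>" "l' \<in> elliptic_lines \<epsilon>" for i l l'
  proof -
    obtain s t where "s \<notin> range \<epsilon>" "l = ell s" "t \<notin> range \<epsilon>" "l' = ell t"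
      using \<open>l \<in> _\<close> \<open>l' \<in> _\<close> by (auto simp: elliptic_lines_eq)
    then show ?thesis
      using hx_rel_iff_pw_rel[of s t H i] that(1) H by (simp add: \<psi>)
  qed
  have "bij_betw \<psi> (elliptic_lines \<epsilon>) H"
  proof (rule bij_betwI')
    show "\<psi> l = \<psi> l' \<longleftrightarrow> l = l'" if "l \<in> elliptic_lines \<epsilon>" "l' \<in> elliptic_lines \<epsilon>" for l l'
    proof -
      obtain s t where "s \<notin> range \<epsilon>" "l = ell s" "t \<notin> range \<epsilon>" "l' = ell t"
        using \<open>l \<in> _\<close> \<open>l' \<in> _\<close> by (auto simp: elliptic_lines_eq)
      then show ?thesis
        by (simp add: \<psi> ell_eq_iff hline_eq_iff)
    qed
    show "\<psi> l \<in> H" if "l \<in> elliptic_lines \<epsilon>" for l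
    proof -
      obtain t where "t \<notin> range \<epsilon>" "l = ell t"
        using \<open>l \<in> _\<close> by (auto simp: elliptic_lines_eq)
      then show ?thesis
        by (simp add: \<psi> H)
    qed
    show "\<exists>l\<in>elliptic_lines \<epsilon>. m = \<psi> l" if "m \<in> H" for m
    proof -
      obtain t where "t \<notin> range \<epsilon>" "m = hline t"
        using \<open>m \<in> H\<close> H by auto
      then have "m = \<psi> (ell t)" "ell t \<in> elliptic_lines \<epsilon>"
        by (auto simp: \<psi> elliptic_lines_eq)
      then show ?thesis
        by blast
    qed
  qed
  moreover have "hx_rel h \<epsilon> i \<subseteq> elliptic_lines \<epsilon> \<times> elliptic_lines \<epsilon>" "pw_rel q H i \<subseteq> H \<times> H" if "i \<le> 3" for i
    using le_3_cases[OF that] by (auto simp: hx_rel_def pw_rel_def hx_related_def numeral_3_eq_3)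
  ultimately have "scheme_iso 3 (elliptic_lines \<epsilon>) (hx_rel h \<epsilon>) H (pw_rel q H) \<psi>"
    using iff by (intro scheme_isoI)
  with iff show ?thesis
    by blast
qed

end

theorem mainTheorem1:
  fixes h q :: nat
    and \<epsilon> :: "'k::{field, finite} \<Rightarrow> 'l::{field, finite}"
    and H :: "('k ^ 4) set set"
  assumes "h \<ge> 1" and "q = 2 ^ h"
    and "CARD('k) = q ^ 2" and "CARD('l) = q ^ 4"
    and "field_embedding \<epsilon>"
    and "H \<in> relative_hemisystems q"
  shows "\<exists>\<phi>. scheme_iso 3 (elliptic_lines \<epsilon>) (hx_rel h \<epsilon>) H (pw_rel q H) \<phi> \<and>
           (\<forall>i\<le>3. \<forall>l\<in>elliptic_lines \<epsilon>. \<forall>l'\<in>elliptic_lines \<epsilon>.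
              (l, l') \<in> hx_rel h \<epsilon> i \<longleftrightarrow> (\<phi> l, \<phi> l') \<in> pw_rel q H i)"
proof -
  interpret field_tower h q \<epsilon>
    by unfold_locales fact+
  from assms(6) have "H = fam1 \<or> H = fam2"
    by (rule relative_hemisystem_eq_fam)
  then show ?thesis
  proof
    assume "H = fam1"
    interpret conjugation h q \<epsilon> "\<lambda>x. x ^ q"
      by (rule conjugation_power_q)
    have "H = hline ` (- range \<epsilon>)"
      using \<open>H = fam1\<close> by (auto simp: fam1_def hline_def)
    then show ?thesis
      by (rule scheme_isomorphism)
  next
    assume "H = fam2"
    interpret conjugation h q \<epsilon> "\<lambda>x. x ^ q ^ 3"
      by (rule conjugation_power_q3)
    have pow: "(t ^ q) ^ q ^ 3 = t" "(t ^ q ^ 3) ^ q = t" for t :: 'l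
      using power_card_eq[of t] by (simp_all add: card_l power_mult[symmetric] numeral_eq_Suc mult_ac)
    have range: "t ^ q ^ 3 \<in> range \<epsilon> \<longleftrightarrow> t \<in> range \<epsilon>" for t
      using pow(2)[of t] power_q_in_range_iff[of "t ^ q ^ 3"] by simp
    have "H = hline ` (- range \<epsilon>)"
    proof (intro equalityI subsetI)
      fix l
      assume "l \<in> H"
      then obtain t where t: "t \<notin> range \<epsilon>" "l = pline (t ^ q) t"
        by (auto simp: \<open>H = fam2\<close> fam2_def)
      then have "l = hline (t ^ q)"
        by (simp only: hline_def pow)
      moreover have "t ^ q \<in> - range \<epsilon>"
        using t(1) by (simp only: Compl_iff power_q_in_range_iff not_False_eq_True)
      ultimately show "l \<in> hline ` (- range \<epsilon>)"
        by (rule image_eqI)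
    next
      fix l
      assume "l \<in> hline ` (- range \<epsilon>)"
      then obtain t where t: "t \<notin> range \<epsilon>" "l = hline t"
        by blast
      then have "l = pline ((t ^ q ^ 3) ^ q) (t ^ q ^ 3)"
        by (simp only: hline_def pow)
      with t(1) range show "l \<in> H"
        unfolding \<open>H = fam2\<close> fam2_def by blast
    qed
    then show ?thesis
      by (rule scheme_isomorphism)
  qed
qed

end
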